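(* Consider the one-dimensional moving-boundary Darcy forward model on $D=(0,x^* )$ with pressure field $p[u]$, the Matérn Gaussian prior $\mu_0=\mathcal N(\bar u,\mathcal C_0)$ on $X=C(\overline D)$, and the observation operator $\mathcal G:X\to\mathbb R^M$ with components $\mathcal G_i(u)=\int_0^T\int_D\mathcal H_i(x,t)\,p[u](x,t)\,dx\,dt$, $\mathcal H_i\in L^\infty(D\times(0,T])$. Let $y=\mathcal G(u)+\eta$ with $u\sim\mu_0$ and $\eta\sim\mathcal N(0,\Sigma)$. Then the conditional distribution of $u\,|\,y$ is given by the posterior measure $\mu^y$, which is absolutely continuous with respect to $\mu_0$ and satisfies $$\frac{d\mu^y}{d\mu_0}(u)\propto\exp\bigl(-\Phi_y(u)\bigr),\qquad \Phi_y(u)=\tfrac12\|y-\mathcal G(u)\|_\Sigma^2 .$$ Moreover, $\mu^y$ admits at least one MAP estimator in the sense of small-ball probabilities, and every such MAP estimator is characterised as a minimiser of the Onsager--Machlup functional $$J_{\mathrm{OM}}(u)=\begin{cases}\Phi_y(u)+\tfrac12\|u-\bar u\|_E^2,&u-\bar u\in E,\\+\infty,&u-\bar u\in X\setminus E.\end{cases}$$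
   Context: Forward model. Let $x^*>0$, $D=(0,x^* )$, $T>0$, and let $\mu_f,\phi>0$ and $p_I>p_0$ be constants. For $u\in X=C(\overline D)$ (supremum norm), the model is: $-\frac{d}{dx}\bigl[e^{u(x)}\frac{dp}{dx}(x,t)\bigr]=0$ for $x\in(0,\Upsilon(t))$, $t>0$; $\frac{d\Upsilon}{dt}(t)+\frac1{\mu_f\phi}e^{u(\Upsilon(t))}\frac{dp}{dx}(\Upsilon(t),t)=0$, $\Upsilon(0)=0$; $p(0,t)=p_I$; $p(\Upsilon(t),t)=p_0$ for $t>0$; $p(x,0)=p_0$ for $x\in(0,x^*]$; and $\Upsilon(t)=x^*$ once the domain is filled. Its explicit solution, for $t\in(0,T]$, is as follows. Put $F[u](x)=\int_0^xe^{-u(z)}dz$, $W[u](x)=\int_0^xF[u](\xi)\,d\xi$ and filling time $\tau^*[u]=\frac{\mu_f\phi}{p_I-p_0}W[u](x^* )$. Then $\Upsilon[u](t)=W[u]^{-1}\bigl(\frac{p_I-p_0}{\mu_f\phi}t\bigr)$ for $t<\tau^*[u]$, $\Upsilon[u](t)=x^*$ for $t\ge\tau^*[u]$, and $$p[u](x,t)=\begin{cases}p_I-(p_I-p_0)\dfrac{F[u](x)}{F[u](\Upsilon[u](t))},&x\in(0,\Upsilon[u](t)),\\ p_0,&x\in D\setminus(0,\Upsilon[u](t)).\end{cases}$$ Prior. $\mathcal C_0=\sigma^2(\varkappa^2I-\Delta)^{-(\nu+d/2)}$ with $d=1$, $\sigma,\varkappa>0$, $\nu>d/2$ (fractional power defined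 spectrally with appropriate boundary conditions on $D$); it is self-adjoint, positive and trace class on $L^2(D)$ and $\mu_0(X)=1$. The Cameron--Martin space is $E=\operatorname{Range}(\mathcal C_0^{1/2})$ with $\langle h_1,h_2\rangle_E=\langle\mathcal C_0^{-1/2}h_1,\mathcal C_0^{-1/2}h_2\rangle_{L^2(D)}$; it is assumed that $\bar u\in E$. Noise. $\Sigma\in\mathbb R^{M\times M}$ is symmetric positive definite, $\|v\|_\Sigma^2=v^\top\Sigma^{-1}v$, and the noise is additive (independent of $u$). MAP estimator in the small-ball sense (Dashti--Law--Stuart--Voss): writing $B^\delta(z)$ for the open ball of radius $\delta$ centred at $z$ in $X$, $\tilde u\in X$ is a MAP estimator for $\mu^y$ if $\lim_{\delta\to0}\mu^y(B^\delta(\tilde u))\big/\sup_{z\in X}\mu^y(B^\delta(z))=1$. *)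

theory Defs
  imports "HOL-Probability.Probability"
begin

section \<open>The space of log-permeabilities\<close>

text \<open>The space of continuous functions on the interval from 0 to \<open>L\<close> with the supremum metric.
  Its elements are extensional (\<open>undefined\<close> outside \<open>{0..L}\<close>), so that they are
  determined by their values on the interval.\<close>

definition CX :: "real \<Rightarrow> (real \<Rightarrow> real) metric" where
  "CX L = cfunspace (top_of_set {0..L}) euclidean_metric"

definition borel_CX :: "real \<Rightarrow> (real \<Rightarrow> real) measure" where
  "borel_CX L = sigma (mspace (CX L)) {V. openin (mtopology_of (CX L)) V}"

section \<open>The forward model and the observation operator\<close>

definition Fint :: "(real \<Rightarrow> real) \<Rightarrow> real \<Rightarrow> real" where
  "Fint u x = integral {0..x} (\<lambda>z. exp (- u z))"

definition Wint :: "(real \<Rightarrow> real) \<Rightarrow> real \<Rightarrow> real" where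
  "Wint u x = integral {0..x} (Fint u)"

definition fill_time :: "real \<Rightarrow> real \<Rightarrow> real \<Rightarrow> real \<Rightarrow> real \<Rightarrow> (real \<Rightarrow> real) \<Rightarrow> real" where
  "fill_time L muf phi pI p0 u = muf * phi / (pI - p0) * Wint u L"

definition front ::
  "real \<Rightarrow> real \<Rightarrow> real \<Rightarrow> real \<Rightarrow> real \<Rightarrow> (real \<Rightarrow> real) \<Rightarrow> real \<Rightarrow> real" where
  "front L muf phi pI p0 u t =
     (if t < fill_time L muf phi pI p0 u
      then inv_into {0..L} (Wint u) ((pI - p0) / (muf * phi) * t) else L)"

text \<open>The explicit solution of the moving-boundary problem
  \<open>- d/dx (e\<^sup>u dp/dx) = 0\<close> behind the front,
  \<open>d front/dt = - e\<^sup>u dp/dx / (muf * phi)\<close> at the front,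
  with pressure \<open>pI\<close> at the inlet and \<open>p0\<close> at and beyond the front; used for \<open>t > 0\<close>.\<close>

definition pressure ::
  "real \<Rightarrow> real \<Rightarrow> real \<Rightarrow> real \<Rightarrow> real \<Rightarrow> (real \<Rightarrow> real) \<Rightarrow> real \<Rightarrow> real \<Rightarrow> real" where
  "pressure L muf phi pI p0 u x t =
     (if x \<in> {0<..<front L muf phi pI p0 u t}
      then pI - (pI - p0) * (Fint u x / Fint u (front L muf phi pI p0 u t)) else p0)"

definition Linf :: "'a::euclidean_space set \<Rightarrow> ('a \<Rightarrow> real) set" where
  "Linf S = {h \<in> borel_measurable (lebesgue_on S). \<exists>C. AE z in lebesgue_on S. \<bar>h z\<bar> \<le> C}"

definition obs_op ::
  "real \<Rightarrow> real \<Rightarrow> real \<Rightarrow> real \<Rightarrow> real \<Rightarrow> real \<Rightarrow> ('m::finite \<Rightarrow> real \<times> real \<Rightarrow> real) \<Rightarrow>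
   (real \<Rightarrow> real) \<Rightarrow> real ^ 'm" where
  "obs_op L T muf phi pI p0 H u =
     (\<chi> i. LINT t|lebesgue_on {0<..T}. LINT x|lebesgue_on {0<..<L}.
             H i (x, t) * pressure L muf phi pI p0 u x t)"

section \<open>Matern covariance operators\<close>

text \<open>Elements of \<open>L\<^sup>2(0,L)\<close> are represented by functions; equality is almost-everywhere
  equality on \<open>{0<..<L}\<close>.\<close>

definition L2 :: "real \<Rightarrow> (real \<Rightarrow> real) set" where
  "L2 L = {f \<in> borel_measurable (lebesgue_on {0<..<L}).
             integrable (lebesgue_on {0<..<L}) (\<lambda>x. (f x)\<^sup>2)}"

definition L2_inner :: "real \<Rightarrow> (real \<Rightarrow> real) \<Rightarrow> (real \<Rightarrow> real) \<Rightarrow> real" where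
  "L2_inner L f g = (LINT x|lebesgue_on {0<..<L}. f x * g x)"

text \<open>The boundary conditions \<open>A (f(0), f'(0)) + B (f(L), f'(L)) = 0\<close>. They make the negative second
  derivative self-adjoint iff the rows of \<open>(A|B)\<close> are independent and
  \<open>A J A\<^sup>T = B J B\<^sup>T\<close> for the rotation \<open>J\<close> by a right angle; for 2x2 matrices
  \<open>A J A\<^sup>T = det A * J\<close>. Dirichlet, Neumann, Robin and periodic conditions are all instances.\<close>

definition self_adjoint_bc :: "real ^ 2 ^ 2 \<Rightarrow> real ^ 2 ^ 2 \<Rightarrow> bool" where
  "self_adjoint_bc A B \<longleftrightarrow>
     (\<forall>v. v v* A = 0 \<and> v v* B = 0 \<longrightarrow> v = 0) \<and> det A = det B"

definition neg_laplace_eigenfun ::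
  "real \<Rightarrow> real ^ 2 ^ 2 \<Rightarrow> real ^ 2 ^ 2 \<Rightarrow> (real \<Rightarrow> real) \<Rightarrow> real \<Rightarrow> bool" where
  "neg_laplace_eigenfun L A B f l \<longleftrightarrow>
     (\<exists>f'. (\<forall>x\<in>{0..L}. (f has_real_derivative f' x) (at x within {0..L}) \<and>
                       (f' has_real_derivative - (l * f x)) (at x within {0..L})) \<and>
           A *v vector [f 0, f' 0] + B *v vector [f L, f' L] = 0)"

definition orthonormal_basis_L2 :: "real \<Rightarrow> (nat \<Rightarrow> real \<Rightarrow> real) \<Rightarrow> bool" where
  "orthonormal_basis_L2 L e \<longleftrightarrow>
     (\<forall>k. e k \<in> L2 L) \<and> (\<forall>j k. L2_inner L (e j) (e k) = (if j = k then 1 else 0)) \<and>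
     (\<forall>f\<in>L2 L. (\<forall>k. L2_inner L f (e k) = 0) \<longrightarrow> (AE x in lebesgue_on {0<..<L}. f x = 0))"

text \<open>A representative of the \<open>L\<^sup>2\<close>-limit of \<open>\<Sum>k. c k * \<langle>f, e k\<rangle> * e k\<close>.\<close>

definition diag_op ::
  "real \<Rightarrow> (nat \<Rightarrow> real \<Rightarrow> real) \<Rightarrow> (nat \<Rightarrow> real) \<Rightarrow> (real \<Rightarrow> real) \<Rightarrow> real \<Rightarrow> real" where
  "diag_op L e c f =
     (SOME g. g \<in> L2 L \<and>
        (\<lambda>n. LINT x|lebesgue_on {0<..<L}.
                (g x - (\<Sum>k<n. c k * L2_inner L f (e k) * e k x))\<^sup>2) \<longlonglongrightarrow> 0)"

text \<open>Eigenvalues of \<open>\<sigma>\<^sup>2 (\<kappa>\<^sup>2 I - Laplacian) powr -(\<nu> + d/2)\<close> for \<open>d = 1\<close>,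
  where \<open>lam k\<close> are those of the negative Laplacian.\<close>

definition matern_eigenvalue :: "real \<Rightarrow> real \<Rightarrow> real \<Rightarrow> (nat \<Rightarrow> real) \<Rightarrow> nat \<Rightarrow> real" where
  "matern_eigenvalue \<sigma> \<kappa> \<nu> lam k = \<sigma>\<^sup>2 * (\<kappa>\<^sup>2 + lam k) powr (- (\<nu> + 1 / 2))"

definition matern_cov ::
  "real \<Rightarrow> (nat \<Rightarrow> real \<Rightarrow> real) \<Rightarrow> (nat \<Rightarrow> real) \<Rightarrow> real \<Rightarrow> real \<Rightarrow> real \<Rightarrow>
   (real \<Rightarrow> real) \<Rightarrow> real \<Rightarrow> real" where
  "matern_cov L e lam \<sigma> \<kappa> \<nu> = diag_op L e (matern_eigenvalue \<sigma> \<kappa> \<nu> lam)"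

definition matern_cov_sqrt ::
  "real \<Rightarrow> (nat \<Rightarrow> real \<Rightarrow> real) \<Rightarrow> (nat \<Rightarrow> real) \<Rightarrow> real \<Rightarrow> real \<Rightarrow> real \<Rightarrow>
   (real \<Rightarrow> real) \<Rightarrow> real \<Rightarrow> real" where
  "matern_cov_sqrt L e lam \<sigma> \<kappa> \<nu> = diag_op L e (\<lambda>k. sqrt (matern_eigenvalue \<sigma> \<kappa> \<nu> lam k))"

section \<open>Gaussian measures and Cameron--Martin spaces\<close>

definition normal_law :: "real \<Rightarrow> real \<Rightarrow> real measure" where
  "normal_law m v =
     (if v = 0 then return borel m else density lborel (\<lambda>x. ennreal (normal_density m (sqrt v) x)))"

text \<open>A Borel probability measure on \<open>CX L\<close> which, as a measure on \<open>L\<^sup>2(0,L)\<close>, is Gaussian with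
  mean \<open>m\<close> and covariance operator \<open>C\<close>.\<close>

definition gaussian_CX ::
  "real \<Rightarrow> (real \<Rightarrow> real) \<Rightarrow> ((real \<Rightarrow> real) \<Rightarrow> real \<Rightarrow> real) \<Rightarrow> (real \<Rightarrow> real) measure \<Rightarrow> bool" where
  "gaussian_CX L m C \<mu> \<longleftrightarrow>
     prob_space \<mu> \<and> sets \<mu> = sets (borel_CX L) \<and>
     (\<forall>f\<in>L2 L. distr \<mu> borel (L2_inner L f) = normal_law (L2_inner L f m) (L2_inner L f (C f)))"

text \<open>In the following, \<open>R\<close> is the square root of the covariance operator.\<close>

definition cameron_martin :: "real \<Rightarrow> ((real \<Rightarrow> real) \<Rightarrow> real \<Rightarrow> real) \<Rightarrow> (real \<Rightarrow> real) set" where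
  "cameron_martin L R = {h. \<exists>g\<in>L2 L. AE x in lebesgue_on {0<..<L}. R g x = h x}"

definition op_inverse ::
  "real \<Rightarrow> ((real \<Rightarrow> real) \<Rightarrow> real \<Rightarrow> real) \<Rightarrow> (real \<Rightarrow> real) \<Rightarrow> real \<Rightarrow> real" where
  "op_inverse L R h = (SOME g. g \<in> L2 L \<and> (AE x in lebesgue_on {0<..<L}. R g x = h x))"

definition cm_inner ::
  "real \<Rightarrow> ((real \<Rightarrow> real) \<Rightarrow> real \<Rightarrow> real) \<Rightarrow> (real \<Rightarrow> real) \<Rightarrow> (real \<Rightarrow> real) \<Rightarrow> real" where
  "cm_inner L R h1 h2 = L2_inner L (op_inverse L R h1) (op_inverse L R h2)"

definition cm_norm :: "real \<Rightarrow> ((real \<Rightarrow> real) \<Rightarrow> real \<Rightarrow> real) \<Rightarrow> (real \<Rightarrow> real) \<Rightarrow> real" where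
  "cm_norm L R h = sqrt (cm_inner L R h h)"

text \<open>The density of the centred Gaussian on the observation space with covariance matrix \<open>S\<close>.\<close>

definition gaussian_density :: "real ^ 'm ^ 'm \<Rightarrow> real ^ 'm::finite \<Rightarrow> real" where
  "gaussian_density S v =
     exp (- (v \<bullet> (matrix_inv S *v v)) / 2) / sqrt ((2 * pi) ^ CARD('m) * det S)"

section \<open>Posterior and MAP estimators\<close>

text \<open>\<open>K\<close> is a regular conditional distribution of \<open>U\<close> (with values in \<open>S\<close>) given \<open>Y\<close> (with values
  in \<open>N\<close>).\<close>

definition regular_cond_distr ::
  "'w measure \<Rightarrow> 'a measure \<Rightarrow> ('w \<Rightarrow> 'a) \<Rightarrow> 'b measure \<Rightarrow> ('w \<Rightarrow> 'b) \<Rightarrow> ('b \<Rightarrow> 'a measure) \<Rightarrow> bool" where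
  "regular_cond_distr P S U N Y K \<longleftrightarrow>
     K \<in> measurable N (prob_algebra S) \<and>
     (\<forall>A\<in>sets S. AE \<omega> in P.
        real_cond_exp P (vimage_algebra (space P) Y N) (indicator (U -` A \<inter> space P)) \<omega>
          = measure (K (Y \<omega>)) A)"

definition misfit ::
  "real ^ 'm ^ 'm \<Rightarrow> ((real \<Rightarrow> real) \<Rightarrow> real ^ 'm::finite) \<Rightarrow> real ^ 'm \<Rightarrow> (real \<Rightarrow> real) \<Rightarrow> real" where
  "misfit S G y u = 1 / 2 * ((y - G u) \<bullet> (matrix_inv S *v (y - G u)))"

definition is_MAP :: "'a metric \<Rightarrow> 'a measure \<Rightarrow> 'a \<Rightarrow> bool" where
  "is_MAP X \<mu> u \<longleftrightarrow> u \<in> mspace X \<and>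
     ((\<lambda>\<delta>. measure \<mu> (mball_of X u \<delta>) / (SUP z\<in>mspace X. measure \<mu> (mball_of X z \<delta>)))
        \<longlongrightarrow> 1) (at_right 0)"

definition onsager_machlup ::
  "real \<Rightarrow> ((real \<Rightarrow> real) \<Rightarrow> real \<Rightarrow> real) \<Rightarrow> (real \<Rightarrow> real) \<Rightarrow> ((real \<Rightarrow> real) \<Rightarrow> real) \<Rightarrow>
   (real \<Rightarrow> real) \<Rightarrow> ereal" where
  "onsager_machlup L R m \<Phi> u =
     (if (\<lambda>x. u x - m x) \<in> cameron_martin L R
      then ereal (\<Phi> u + 1 / 2 * (cm_norm L R (\<lambda>x. u x - m x))\<^sup>2) else \<infinity>)"

end

theory Submission
  imports Defs
begin

text \<open>The posterior statement is Bayes' formula for additive noise with a positive density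
(\<open>regular_cond_distr_posterior\<close>), once \<open>G\<close> is known to be measurable. In fact \<open>G\<close> is continuous
for the supremum norm (\<open>obs_op_tendsto\<close>): the front depends continuously on the log-permeability
because \<open>Wint\<close> is strictly increasing and converges pointwise, hence the pressure converges
everywhere except at the front itself, and dominated convergence does the rest.

The statement on MAP estimators compares small balls. Let \<open>I u\<close> be half the squared Cameron--Martin
norm of \<open>u - ubar\<close>, infinite outside the Cameron--Martin space. Three facts about the Gaussian prior
carry the proof, the ball around \<open>ubar\<close> being the reference:

\<^item> \<open>\<mu>0 (ball h \<delta>) \<ge> exp (- I h) * \<mu>0 (ball ubar \<delta>)\<close> (\<open>mball_lower\<close>), from the Cameron--Martin
  shift formula and the symmetry of the ball;
\<^item> if \<open>\<mu>0 (ball z \<delta>) > exp (- R) * \<mu>0 (ball ubar \<delta>)\<close>, then some \<open>v\<close> within distance \<open>\<delta>\<close> of \<open>z\<close> has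
  \<open>I v \<le> R\<close> (\<open>mball_upper\<close>); a ball all of whose points have large \<open>I\<close> is exponentially
  light;
\<^item> all balls around \<open>ubar\<close> have positive mass (\<open>mball_centre_pos\<close>).

The second fact is an explicit form of Anderson's inequality. In finite dimension, with \<open>A\<close> the ball
around \<open>z\<close>, the Prekopa--Leindler inequality is applied to the densities of the Gaussian on \<open>A\<close> and
on its mirror image. Midpoints lie in the centred ball, half-differences lie in \<open>A\<close> and so have
squared norm at least \<open>2 * R\<close>, and the parallelogram law yields the factor \<open>exp (- R)\<close>
(\<open>gauss_PiM_explicit_Anderson\<close>). The passage to the infinite-dimensional space uses that a closed
supremum-norm ball is the intersection of countably many slabs \<open>\<bar>\<langle>u - z, f\<rangle>\<bar> \<le> \<delta>\<close>, with \<open>f\<close> a local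
average, and that \<open>\<langle>u, f\<rangle>\<close> is the sum of its expansion along the eigenfunctions for each \<open>u\<close>
(\<open>prob_ball_upper\<close>, \<open>prob_ball_lower\<close>). The coordinates along the eigenfunctions are independent
Gaussians, by a uniqueness argument for characteristic functions (\<open>distr_PiM_gauss_of_char\<close>).

The first and third fact make the sublevel sets of \<open>I\<close> totally bounded: points that are far apart
carry disjoint balls whose masses are bounded below (\<open>sublevel_totally_bounded\<close>). This compactness
turns the comparison of balls into the asymptotics
\<open>sup\<^sub>z \<mu>y (ball z \<delta>) / \<mu>0 (ball ubar \<delta>) \<longlongrightarrow> c * exp (- min J)\<close>, and a point attains it in the
limit iff it minimises \<open>J = \<Phi> + I\<close> (\<open>is_MAP_iff\<close>).\<close>

section \<open>The posterior for additive noise\<close>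

text \<open>The upper bound \<open>C\<close> on the noise density makes the evidence finite, and positivity of the density
makes it positive, for every single observation; so Bayes' formula holds at all \<open>y\<close> and not just at
almost all.\<close>

locale additive_noise = prob_space P for P :: "'w measure" +
  fixes S :: "'a measure" and U :: "'w \<Rightarrow> 'a" and \<eta> :: "'w \<Rightarrow> 'b::euclidean_space"
    and G :: "'a \<Rightarrow> 'b" and \<rho> :: "'b \<Rightarrow> real" and C :: real
  assumes U[measurable]: "U \<in> measurable P S" and G[measurable]: "G \<in> borel_measurable S"
    and \<eta>: "distributed P lborel \<eta> (\<lambda>v. ennreal (\<rho> v))"
    and indep: "indep_set (sets (vimage_algebra (space P) U S)) (sets (vimage_algebra (space P) \<eta> borel))"
    and \<rho>[measurable]: "\<rho> \<in> borel_measurable borel" and \<rho>_pos: "\<And>v. 0 < \<rho> v" and \<rho>_le: "\<And>v. \<rho> v \<le> C"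
begin

definition prior :: "'a measure" where "prior = distr P S U"
definition evidence :: "'b \<Rightarrow> real" where "evidence y = (LINT u|prior. \<rho> (y - G u))"
definition posterior :: "'b \<Rightarrow> 'a measure" where
  "posterior y = density prior (\<lambda>u. ennreal (\<rho> (y - G u) / evidence y))"
definition Y :: "'w \<Rightarrow> 'b" where "Y \<omega> = G (U \<omega>) + \<eta> \<omega>"

lemma \<eta>_measurable[measurable]: "\<eta> \<in> borel_measurable P"
  using distributed_measurable[OF \<eta>] by simp

lemma Y_measurable[measurable]: "Y \<in> borel_measurable P"
  unfolding Y_def by measurable

lemma sets_prior[measurable_cong, simp]: "sets prior = sets S" by (simp add: prior_def)
lemma space_prior[simp]: "space prior = space S" by (simp add: prior_def)

sublocale prior: prob_space prior
  unfolding prior_def by (rule prob_space_distr) simp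

lemma \<rho>_integrable: "integrable prior (\<lambda>u. \<rho> (y - G u))"
  using \<rho>_pos \<rho>_le by (intro prior.integrable_const_bound[of _ C]) (auto simp: less_imp_le abs_of_pos)

lemma evidence_nn: "(\<integral>\<^sup>+u. ennreal (\<rho> (y - G u)) \<partial>prior) = ennreal (evidence y)"
  unfolding evidence_def using \<rho>_pos by (intro nn_integral_eq_integral \<rho>_integrable) (auto simp: less_imp_le)

lemma evidence_pos: "0 < evidence y"
proof -
  have "0 \<le> evidence y" unfolding evidence_def using \<rho>_pos by (intro Bochner_Integration.integral_nonneg) (simp add: less_imp_le)
  moreover have "evidence y \<noteq> 0"
  proof
    assume "evidence y = 0"
    then have "AE u in prior. \<rho> (y - G u) = 0"
      using integral_nonneg_eq_0_iff_AE[OF \<rho>_integrable] \<rho>_pos by (simp add: evidence_def less_imp_le)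
    then have "AE u in prior. False" using \<rho>_pos by (auto elim!: eventually_mono simp: less_le)
    then show False using prior.AE_False by simp
  qed
  ultimately show ?thesis by simp
qed

lemma sets_posterior[measurable_cong, simp]: "sets (posterior y) = sets S" by (simp add: posterior_def)
lemma space_posterior[simp]: "space (posterior y) = space S" by (simp add: posterior_def)

lemma evidence_measurable[measurable]: "evidence \<in> borel_measurable borel"
  unfolding evidence_def by measurable

lemma emeasure_posterior:
  assumes A[measurable]: "A \<in> sets S"
  shows "emeasure (posterior y) A = (\<integral>\<^sup>+u. ennreal (\<rho> (y - G u)) * indicator A u \<partial>prior) / ennreal (evidence y)"
proof -
  have "emeasure (posterior y) A = (\<integral>\<^sup>+u. ennreal (\<rho> (y - G u)) * indicator A u / ennreal (evidence y) \<partial>prior)"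
    unfolding posterior_def using evidence_pos[of y] \<rho>_pos
    by (subst emeasure_density) (auto intro!: nn_integral_cong simp: divide_ennreal[symmetric] less_imp_le indicator_def)
  also have "\<dots> = (\<integral>\<^sup>+u. ennreal (\<rho> (y - G u)) * indicator A u \<partial>prior) / ennreal (evidence y)"
    by (rule nn_integral_divide) measurable
  finally show ?thesis .
qed

lemma prob_space_posterior: "prob_space (posterior y)"
proof
  have "emeasure (posterior y) (space S) = (\<integral>\<^sup>+u. ennreal (\<rho> (y - G u)) * indicator (space S) u \<partial>prior) / ennreal (evidence y)"
    by (rule emeasure_posterior) simp
  also have "(\<integral>\<^sup>+u. ennreal (\<rho> (y - G u)) * indicator (space S) u \<partial>prior) = ennreal (evidence y)"
    unfolding evidence_nn[symmetric] by (intro nn_integral_cong) simp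
  also have "ennreal (evidence y) / ennreal (evidence y) = 1"
    using evidence_pos[of y] by (simp add: divide_ennreal)
  finally show "emeasure (posterior y) (space (posterior y)) = 1" by simp
qed

lemma emeasure_posterior_measurable:
  assumes A[measurable]: "A \<in> sets S"
  shows "(\<lambda>y. emeasure (posterior y) A) \<in> borel_measurable borel"
  unfolding emeasure_posterior[OF A] by measurable

lemma posterior_measurable: "posterior \<in> measurable borel (prob_algebra S)"
proof (rule measurable_prob_algebraI)
  show "prob_space (posterior y)" for y by (rule prob_space_posterior)
  show "posterior \<in> borel \<rightarrow>\<^sub>M subprob_algebra S"
  proof (rule measurable_subprob_algebra)
    show "subprob_space (posterior y)" for y using prob_space_posterior by (rule prob_space_imp_subprob_space)
  qed (auto intro: emeasure_posterior_measurable)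
qed

text \<open>The joint law of \<open>U\<close> and \<open>Y\<close> has density \<open>\<rho> (y - G u)\<close> with respect to the product of the prior and
Lebesgue measure: this is independence of \<open>U\<close> and \<open>\<eta>\<close> followed by the translation \<open>y = G u + v\<close>.\<close>

lemma nn_integral_joint:
  assumes g[measurable]: "g \<in> borel_measurable (S \<Otimes>\<^sub>M borel)"
  shows "(\<integral>\<^sup>+\<omega>. g (U \<omega>, Y \<omega>) \<partial>P) = (\<integral>\<^sup>+y. \<integral>\<^sup>+u. ennreal (\<rho> (y - G u)) * g (u, y) \<partial>prior \<partial>lborel)"
proof -
  interpret e: prob_space "distr P borel \<eta>" by (rule prob_space_distr) simp
  interpret pq: pair_sigma_finite prior "lborel :: 'b measure"
    by standard
  have joint: "distr P S U \<Otimes>\<^sub>M distr P borel \<eta> = distr P (S \<Otimes>\<^sub>M borel) (\<lambda>\<omega>. (U \<omega>, \<eta> \<omega>))"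
  proof (rule pair_measure_eqI)
    show "sigma_finite_measure (distr P S U)" "sigma_finite_measure (distr P borel \<eta>)"
      using prior.sigma_finite_measure_axioms e.sigma_finite_measure_axioms by (simp_all add: prior_def)
    show "sets (distr P S U \<Otimes>\<^sub>M distr P borel \<eta>) = sets (distr P (S \<Otimes>\<^sub>M borel) (\<lambda>\<omega>. (U \<omega>, \<eta> \<omega>)))"
      by (simp cong: sets_pair_measure_cong)
    fix A B assume "A \<in> sets (distr P S U)" "B \<in> sets (distr P borel \<eta>)"
    then have A: "A \<in> sets S" and B: "B \<in> sets borel" by simp_all
    have "U -` A \<inter> space P \<in> sets (vimage_algebra (space P) U S)" "\<eta> -` B \<inter> space P \<in> sets (vimage_algebra (space P) \<eta> borel)"
      using A B by (auto intro: in_vimage_algebra)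
    from indep_setD[OF indep this]
    have "prob ((U -` A \<inter> space P) \<inter> (\<eta> -` B \<inter> space P)) = prob (U -` A \<inter> space P) * prob (\<eta> -` B \<inter> space P)" .
    moreover have "(\<lambda>\<omega>. (U \<omega>, \<eta> \<omega>)) -` (A \<times> B) \<inter> space P = (U -` A \<inter> space P) \<inter> (\<eta> -` B \<inter> space P)" by auto
    ultimately show "emeasure (distr P S U) A * emeasure (distr P borel \<eta>) B =
        emeasure (distr P (S \<Otimes>\<^sub>M borel) (\<lambda>\<omega>. (U \<omega>, \<eta> \<omega>))) (A \<times> B)"
      using A B by (simp add: emeasure_distr emeasure_eq_measure ennreal_mult')
  qed
  have "distr P borel \<eta> = distr P lborel \<eta>" by (rule distr_cong) auto
  also have "\<dots> = density lborel (\<lambda>v. ennreal (\<rho> v))" by (rule distributed_distr_eq_density[OF \<eta>])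
  finally have de: "distr P borel \<eta> = density lborel (\<lambda>v. ennreal (\<rho> v))" .
  have "(\<integral>\<^sup>+\<omega>. g (U \<omega>, Y \<omega>) \<partial>P) = (\<integral>\<^sup>+z. g (fst z, G (fst z) + snd z) \<partial>distr P (S \<Otimes>\<^sub>M borel) (\<lambda>\<omega>. (U \<omega>, \<eta> \<omega>)))"
    by (subst nn_integral_distr) (auto simp: Y_def)
  also have "\<dots> = (\<integral>\<^sup>+z. g (fst z, G (fst z) + snd z) \<partial>(prior \<Otimes>\<^sub>M distr P borel \<eta>))"
    unfolding joint[symmetric] prior_def ..
  also have "\<dots> = (\<integral>\<^sup>+u. \<integral>\<^sup>+v. g (u, G u + v) \<partial>distr P borel \<eta> \<partial>prior)"
    by (subst e.nn_integral_fst[symmetric]) (auto simp: case_prod_beta)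
  also have "\<dots> = (\<integral>\<^sup>+u. \<integral>\<^sup>+y. ennreal (\<rho> (y - G u)) * g (u, y) \<partial>lborel \<partial>prior)"
  proof (rule nn_integral_cong)
    fix u assume "u \<in> space prior"
    then have u: "u \<in> space S" by simp
    have gu[measurable]: "(\<lambda>y. g (u, y)) \<in> borel_measurable borel" using u by measurable
    have "(\<integral>\<^sup>+v. g (u, G u + v) \<partial>distr P borel \<eta>) = (\<integral>\<^sup>+v. ennreal (\<rho> v) * g (u, G u + v) \<partial>lborel)"
      unfolding de by (rule nn_integral_density) measurable
    also have "\<dots> = (\<integral>\<^sup>+v. (\<lambda>y. ennreal (\<rho> (y - G u)) * g (u, y)) (G u + v) \<partial>lborel)" by simp
    also have "\<dots> = (\<integral>\<^sup>+y. ennreal (\<rho> (y - G u)) * g (u, y) \<partial>distr lborel borel ((+) (G u)))"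
      by (rule nn_integral_distr[symmetric]) measurable
    finally show "(\<integral>\<^sup>+v. g (u, G u + v) \<partial>distr P borel \<eta>) = (\<integral>\<^sup>+y. ennreal (\<rho> (y - G u)) * g (u, y) \<partial>lborel)"
      by (simp add: lborel_distr_plus)
  qed
  also have "\<dots> = (\<integral>\<^sup>+y. \<integral>\<^sup>+u. ennreal (\<rho> (y - G u)) * g (u, y) \<partial>prior \<partial>lborel)"
    by (rule pq.Fubini'[symmetric]) measurable
  finally show ?thesis .
qed

lemma posterior_times_evidence:
  assumes A: "A \<in> sets S"
  shows "ennreal (evidence y) * emeasure (posterior y) A = (\<integral>\<^sup>+u. ennreal (\<rho> (y - G u)) * indicator A u \<partial>prior)"
proof -
  have "ennreal (evidence y) \<noteq> 0" "ennreal (evidence y) \<noteq> top" using evidence_pos[of y] by auto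
  then show ?thesis
    unfolding emeasure_posterior[OF A] ennreal_times_divide mult.commute[of "ennreal (evidence y)"]
    by (intro ennreal_mult_divide_eq)
qed

text \<open>Both sides of the defining property of the conditional expectation are integrals against the joint
law of \<open>U\<close> and \<open>Y\<close>. Integrating out \<open>u\<close> turns the posterior side into evidence times posterior
probability, which is the prior integral of the likelihood over \<open>A\<close>.\<close>

theorem regular_cond_distr_posterior: "regular_cond_distr P S U borel Y posterior"
  unfolding regular_cond_distr_def
proof (intro conjI ballI posterior_measurable)
  fix A assume A[measurable]: "A \<in> sets S"
  let ?F = "vimage_algebra (space P) Y borel"
  interpret finite_measure_subalgebra P ?F
  proof
    show "subalgebra P ?F" unfolding subalgebra_def
    proof
      show "sets ?F \<subseteq> sets P"
        by (subst sets_vimage_algebra2) (auto intro: measurable_sets[OF Y_measurable])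
    qed simp
  qed
  note em[measurable] = emeasure_posterior_measurable[OF A]
  have mm: "(\<lambda>y. measure (posterior y) A) \<in> borel_measurable borel" unfolding measure_def by measurable
  note [measurable] = mm
  have m1: "measure (posterior y) A \<le> 1" for y
    using prob_space.prob_le_1[OF prob_space_posterior] .
  show "AE \<omega> in P. real_cond_exp P ?F (indicator (U -` A \<inter> space P)) \<omega> = measure (posterior (Y \<omega>)) A"
  proof (rule real_cond_exp_charact)
    show "integrable P (indicator (U -` A \<inter> space P) :: _ \<Rightarrow> real)"
      using measurable_sets[OF U A] by (intro integrable_real_indicator) (simp_all add: less_top[symmetric])
    show "integrable P (\<lambda>\<omega>. measure (posterior (Y \<omega>)) A)"
      using m1 by (intro integrable_const_bound[of _ 1]) auto
    show "(\<lambda>\<omega>. measure (posterior (Y \<omega>)) A) \<in> borel_measurable ?F"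
      by (rule measurable_compose[OF measurable_vimage_algebra1 mm]) auto
    fix D assume "D \<in> sets ?F"
    then obtain B where B[measurable]: "B \<in> sets borel" and D: "D = Y -` B \<inter> space P"
      by (subst (asm) sets_vimage_algebra2) auto
    have eq: "(\<integral>\<^sup>+\<omega>. indicator A (U \<omega>) * indicator B (Y \<omega>) \<partial>P) = (\<integral>\<^sup>+\<omega>. emeasure (posterior (Y \<omega>)) A * indicator B (Y \<omega>) \<partial>P)"
    proof -
      have "(\<integral>\<^sup>+\<omega>. indicator A (U \<omega>) * indicator B (Y \<omega>) \<partial>P)
         = (\<integral>\<^sup>+y. \<integral>\<^sup>+u. ennreal (\<rho> (y - G u)) * (indicator A u * indicator B y) \<partial>prior \<partial>lborel)"
        using nn_integral_joint[of "\<lambda>(u, y). indicator A u * indicator B y"] by simp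
      also have "\<dots> = (\<integral>\<^sup>+y. ennreal (evidence y) * emeasure (posterior y) A * indicator B y \<partial>lborel)"
        unfolding posterior_times_evidence[OF A]
        by (intro nn_integral_cong, subst nn_integral_multc[symmetric]) (auto simp: mult.assoc)
      also have "\<dots> = (\<integral>\<^sup>+y. \<integral>\<^sup>+u. ennreal (\<rho> (y - G u)) * (emeasure (posterior y) A * indicator B y) \<partial>prior \<partial>lborel)"
        unfolding evidence_nn[symmetric]
        by (intro nn_integral_cong, subst nn_integral_multc) (auto simp: mult.assoc)
      also have "\<dots> = (\<integral>\<^sup>+\<omega>. emeasure (posterior (Y \<omega>)) A * indicator B (Y \<omega>) \<partial>P)"
        using nn_integral_joint[of "\<lambda>(u, y). emeasure (posterior y) A * indicator B y"] by simp
      finally show ?thesis .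
    qed
    have "(\<integral>\<omega>\<in>D. indicator (U -` A \<inter> space P) \<omega> \<partial>P) = (LINT \<omega>|P. (indicator A (U \<omega>) * indicator B (Y \<omega>) :: real))"
      unfolding set_lebesgue_integral_def D by (intro Bochner_Integration.integral_cong) (auto simp: indicator_def)
    also have "\<dots> = enn2real (\<integral>\<^sup>+\<omega>. ennreal (indicator A (U \<omega>) * indicator B (Y \<omega>)) \<partial>P)"
      by (rule integral_eq_nn_integral) auto
    also have "(\<integral>\<^sup>+\<omega>. ennreal (indicator A (U \<omega>) * indicator B (Y \<omega>)) \<partial>P) = (\<integral>\<^sup>+\<omega>. indicator A (U \<omega>) * indicator B (Y \<omega>) \<partial>P)"
      by (intro nn_integral_cong) (auto simp: indicator_def)
    also note eq
    also have "(\<integral>\<^sup>+\<omega>. emeasure (posterior (Y \<omega>)) A * indicator B (Y \<omega>) \<partial>P) = (\<integral>\<^sup>+\<omega>. ennreal (measure (posterior (Y \<omega>)) A * indicator B (Y \<omega>)) \<partial>P)"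
    proof (rule nn_integral_cong)
      fix \<omega>
      interpret po: prob_space "posterior (Y \<omega>)" by (rule prob_space_posterior)
      show "emeasure (posterior (Y \<omega>)) A * indicator B (Y \<omega>) = ennreal (measure (posterior (Y \<omega>)) A * indicator B (Y \<omega>))"
        by (auto simp: po.emeasure_eq_measure indicator_def)
    qed
    also have "enn2real \<dots> = (LINT \<omega>|P. measure (posterior (Y \<omega>)) A * indicator B (Y \<omega>))"
      by (rule integral_eq_nn_integral[symmetric]) auto
    also have "\<dots> = (\<integral>\<omega>\<in>D. measure (posterior (Y \<omega>)) A \<partial>P)"
      unfolding set_lebesgue_integral_def D by (intro Bochner_Integration.integral_cong) (auto simp: indicator_def)
    finally show "(\<integral>\<omega>\<in>D. indicator (U -` A \<inter> space P) \<omega> \<partial>P) = (\<integral>\<omega>\<in>D. measure (posterior (Y \<omega>)) A \<partial>P)" .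
  qed
qed

end

section \<open>The Prekopa--Leindler inequality on the line\<close>

text \<open>Sets of infinite measure are cut down to \<open>{- n..n}\<close>, where inner regularity of finite Borel measures
is available. Adding one point of \<open>A\<close> makes the compact sets nonempty, as Brunn--Minkowski needs,
even if \<open>A\<close> is a null set.\<close>

lemma emeasure_lborel_SUP_compact:
  fixes A :: "real set"
  assumes A: "A \<in> sets borel" "A \<noteq> {}"
  shows "emeasure lborel A = (SUP K\<in>{K. compact K \<and> K \<noteq> {} \<and> K \<subseteq> A}. emeasure lborel K)"
proof (rule antisym)
  show "(SUP K\<in>{K. compact K \<and> K \<noteq> {} \<and> K \<subseteq> A}. emeasure lborel K) \<le> emeasure lborel A"
    using A by (auto intro!: SUP_least emeasure_mono)
  show "emeasure lborel A \<le> (SUP K\<in>{K. compact K \<and> K \<noteq> {} \<and> K \<subseteq> A}. emeasure lborel K)"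
    unfolding le_SUP_iff
  proof (intro allI impI)
    fix y assume y: "y < emeasure lborel A"
    have "emeasure lborel A = emeasure lborel (\<Union>n. A \<inter> {- real n..real n})"
    proof -
      have "\<exists>n. - real n \<le> x \<and> x \<le> real n" for x
      proof -
        obtain n where "\<bar>x\<bar> \<le> real n" using real_arch_simple by blast
        then show ?thesis by (intro exI[of _ n]) auto
      qed
      then have "(\<Union>n. A \<inter> {- real n..real n}) = A" by auto
      then show ?thesis by simp
    qed
    also have "\<dots> = (SUP n. emeasure lborel (A \<inter> {- real n..real n}))"
      using A by (intro SUP_emeasure_incseq[symmetric]) (auto simp: incseq_def)
    finally obtain n where n: "y < emeasure lborel (A \<inter> {- real n..real n})"
      using y by (auto simp: less_SUP_iff)
    define D where "D = density lborel (indicator {- real n..real n})"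
    have D: "emeasure D B = emeasure lborel (B \<inter> {- real n..real n})" if "B \<in> sets borel" for B
    proof -
      have "emeasure D B = (\<integral>\<^sup>+x. indicator {- real n..real n} x * indicator B x \<partial>lborel)"
        unfolding D_def using that by (intro emeasure_density) auto
      also have "\<dots> = (\<integral>\<^sup>+x. indicator (B \<inter> {- real n..real n}) x \<partial>lborel)"
        by (intro nn_integral_cong) (auto simp: indicator_def)
      finally show ?thesis using that by simp
    qed
    have "emeasure D A = (SUP K\<in>{K. K \<subseteq> A \<and> compact K}. emeasure D K)"
    proof (rule inner_regular)
      show "sets D = sets borel" by (simp add: D_def)
      show "emeasure D (space D) \<noteq> \<infinity>"
        using D[of UNIV] by (simp add: D_def)
    qed (use A in auto)
    then obtain K where K: "K \<subseteq> A" "compact K" "y < emeasure D K"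
      using n D[OF A(1)] by (auto simp: less_SUP_iff)
    obtain a where a: "a \<in> A" using A by auto
    have "emeasure D K \<le> emeasure lborel (insert a K)"
      using K by (subst D) (auto intro!: emeasure_mono simp: compact_imp_closed borel_closed)
    then show "\<exists>i\<in>{K. compact K \<and> K \<noteq> {} \<and> K \<subseteq> A}. y < emeasure lborel i"
      using K a by (intro bexI[of _ "insert a K"]) auto
  qed
qed

text \<open>Let \<open>a\<close> be the largest point of \<open>K1\<close> and \<open>b\<close> the smallest of \<open>K2\<close>. The translates \<open>K1 + b\<close> and
\<open>a + K2\<close> lie in \<open>K1 + K2\<close> and meet only in \<open>a + b\<close>.\<close>

lemma Brunn_Minkowski_compact:
  fixes K1 K2 C :: "real set"
  assumes "compact K1" "K1 \<noteq> {}" "compact K2" "K2 \<noteq> {}" and C[measurable]: "C \<in> sets borel"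
    and sub: "\<And>a b. a \<in> K1 \<Longrightarrow> b \<in> K2 \<Longrightarrow> (a + b) / 2 \<in> C"
  shows "emeasure lborel K1 + emeasure lborel K2 \<le> 2 * emeasure lborel C"
proof -
  have [measurable]: "K1 \<in> sets borel" "K2 \<in> sets borel"
    using assms by (auto simp: compact_imp_closed borel_closed)
  obtain a where a: "a \<in> K1" "\<And>x. x \<in> K1 \<Longrightarrow> x \<le> a" using compact_attains_sup[of K1] assms by metis
  obtain b where b: "b \<in> K2" "\<And>x. x \<in> K2 \<Longrightarrow> b \<le> x" using compact_attains_inf[of K2] assms by metis
  have "emeasure lborel K1 + emeasure lborel K2
      = (\<integral>\<^sup>+z. indicator K1 (- b + 1 * z) \<partial>lborel) + (\<integral>\<^sup>+z. indicator K2 (- a + 1 * z) \<partial>lborel)"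
    using nn_integral_real_affine[of "indicator K1" 1 "- b"] nn_integral_real_affine[of "indicator K2" 1 "- a"]
    by simp
  also have "\<dots> = (\<integral>\<^sup>+z. indicator K1 (- b + 1 * z) + indicator K2 (- a + 1 * z) \<partial>lborel)"
    by (rule nn_integral_add[symmetric]) auto
  also have "\<dots> \<le> (\<integral>\<^sup>+z. indicator C (0 + (1/2) * z) \<partial>lborel)"
  proof (rule nn_integral_mono_AE)
    have "AE z in lborel. z \<noteq> a + b" by (rule AE_lborel_singleton)
    then show "AE z in lborel. indicator K1 (- b + 1 * z) + indicator K2 (- a + 1 * z)
        \<le> (indicator C (0 + (1/2) * z) :: ennreal)"
    proof eventually_elim
      case (elim z)
      have "z - b \<in> K1 \<Longrightarrow> z / 2 \<in> C" using sub[of "z - b" b] b by simp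
      moreover have "z - a \<in> K2 \<Longrightarrow> z / 2 \<in> C" using sub[of a "z - a"] a by simp
      moreover have "\<not> (z - b \<in> K1 \<and> z - a \<in> K2)" using a(2)[of "z - b"] b(2)[of "z - a"] elim by auto
      ultimately show ?case by (auto simp: indicator_def)
    qed
  qed
  also have "\<dots> = 2 * emeasure lborel C"
  proof -
    have "emeasure lborel C = ennreal (1/2) * (\<integral>\<^sup>+z. indicator C (0 + (1/2) * z) \<partial>lborel)"
      using nn_integral_real_affine[of "indicator C" "1/2" 0] by simp
    moreover have "2 * (ennreal (1/2) * X) = X" for X
    proof -
      have "2 * ennreal (1/2) = 1" by (metis ennreal_1 ennreal_mult'' ennreal_numeral field_sum_of_halves
            half_gt_zero_iff less_eq_real_def mult_2 zero_less_one)
      then show ?thesis by (simp add: mult.assoc[symmetric])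
    qed
    ultimately show ?thesis by metis
  qed
  finally show ?thesis .
qed

lemma Brunn_Minkowski_real:
  fixes A B C :: "real set"
  assumes A: "A \<in> sets borel" "A \<noteq> {}" and B: "B \<in> sets borel" "B \<noteq> {}" and C: "C \<in> sets borel"
    and sub: "\<And>a b. a \<in> A \<Longrightarrow> b \<in> B \<Longrightarrow> (a + b) / 2 \<in> C"
  shows "emeasure lborel A + emeasure lborel B \<le> 2 * emeasure lborel C"
proof -
  let ?S = "\<lambda>A::real set. {K. compact K \<and> K \<noteq> {} \<and> K \<subseteq> A}"
  have ne: "?S A \<noteq> {}" if "A \<noteq> {}" for A
  proof -
    obtain a where "a \<in> A" using \<open>A \<noteq> {}\<close> by auto
    then show ?thesis by (auto intro!: exI[of _ "{a}"])
  qed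
  have "emeasure lborel K + emeasure lborel B \<le> 2 * emeasure lborel C" if K: "K \<in> ?S A" for K
  proof -
    have "emeasure lborel K + emeasure lborel B = (SUP K'\<in>?S B. emeasure lborel K + emeasure lborel K')"
      using ne[OF B(2)] by (subst emeasure_lborel_SUP_compact[OF B]) (simp add: ennreal_SUP_add_right)
    also have "\<dots> \<le> 2 * emeasure lborel C"
      using K C sub by (intro SUP_least Brunn_Minkowski_compact) auto
    finally show ?thesis .
  qed
  moreover have "emeasure lborel A + emeasure lborel B = (SUP K\<in>?S A. emeasure lborel K + emeasure lborel B)"
    using ne[OF A(2)] by (subst emeasure_lborel_SUP_compact[OF A]) (simp add: ennreal_SUP_add_left)
  ultimately show ?thesis by (auto intro!: SUP_least)
qed

text \<open>The layer-cake formula for the levels below \<open>r\<close>, rescaled so that the level parameter runs through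
the unit interval. The rescaling allows functions with different suprema to be compared level by
level.\<close>

lemma nn_integral_levels:
  fixes h :: "real \<Rightarrow> ennreal" and r :: real
  assumes [measurable]: "h \<in> borel_measurable borel" and r: "0 < r"
  shows "ennreal r * (\<integral>\<^sup>+l\<in>{0<..<1}. emeasure lborel {x. ennreal (l * r) < h x} \<partial>lborel)
       = (\<integral>\<^sup>+x. min (h x) (ennreal r) \<partial>lborel)"
proof -
  let ?g = "\<lambda>l x. indicator {0<..<1} l * indicator {x. ennreal (l * r) < h x} x :: ennreal"
  have "(\<integral>\<^sup>+l\<in>{0<..<1}. emeasure lborel {x. ennreal (l * r) < h x} \<partial>lborel) = (\<integral>\<^sup>+l. \<integral>\<^sup>+x. ?g l x \<partial>lborel \<partial>lborel)"
    by (intro nn_integral_cong) (simp add: nn_integral_cmult mult.commute)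
  also have "\<dots> = (\<integral>\<^sup>+x. \<integral>\<^sup>+l. ?g l x \<partial>lborel \<partial>lborel)"
    by (rule lborel_pair.Fubini') (simp add: indicator_def)
  also have "ennreal r * \<dots> = (\<integral>\<^sup>+x. ennreal r * (\<integral>\<^sup>+l. ?g l x \<partial>lborel) \<partial>lborel)"
    by (rule nn_integral_cmult[symmetric]) (simp add: indicator_def)
  also have "\<dots> = (\<integral>\<^sup>+x. min (h x) (ennreal r) \<partial>lborel)"
  proof (rule nn_integral_cong)
    fix x :: real
    show "ennreal r * (\<integral>\<^sup>+l. ?g l x \<partial>lborel) = min (h x) (ennreal r)"
    proof (cases "h x")
      case (real y)
      have "?g l x = indicator {0<..<min 1 (y / r)} l" for l
        using real r by (auto simp: indicator_def ennreal_less_iff field_simps)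
      then have "(\<integral>\<^sup>+l. ?g l x \<partial>lborel) = ennreal (min 1 (y / r))"
        using real r by simp
      then have "ennreal r * (\<integral>\<^sup>+l. ?g l x \<partial>lborel) = ennreal (r * min 1 (y / r))"
        using r real by (simp add: ennreal_mult')
      also have "r * min 1 (y / r) = min y r" using r by (auto simp: min_def field_simps)
      finally show ?thesis using real r by (simp add: min_def)
    next
      case top
      then show ?thesis by (simp add: ennreal_less_top)
    qed
  qed
  finally show ?thesis .
qed

text \<open>With \<open>s\<close> and \<open>t\<close> the suprema of \<open>f\<close> and \<open>g\<close>, the level sets of \<open>f\<close> above \<open>l * s\<close> and of \<open>g\<close> above
\<open>l * t\<close> are nonempty for every \<open>l < 1\<close>, and their midpoints lie in the level set of \<open>h\<close> above
\<open>l * sqrt (s * t)\<close>. Brunn--Minkowski bounds the measures at each level, and the inequality of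
arithmetic and geometric means turns the resulting sum into a product.\<close>

lemma Prekopa_Leindler_real:
  fixes f g h :: "real \<Rightarrow> ennreal"
  assumes [measurable]: "f \<in> borel_measurable borel" "g \<in> borel_measurable borel" "h \<in> borel_measurable borel"
    and bound: "\<And>x. f x \<le> ennreal K" "\<And>x. g x \<le> ennreal K"
    and le: "\<And>x y. f x * g y \<le> (h ((x + y) / 2))\<^sup>2"
  shows "(\<integral>\<^sup>+x. f x \<partial>lborel) * (\<integral>\<^sup>+x. g x \<partial>lborel) \<le> (\<integral>\<^sup>+x. h x \<partial>lborel)\<^sup>2"
proof -
  have fin: "(SUP x. f x) < top" "(SUP x. g x) < top"
    using bound by (auto intro!: le_less_trans[OF SUP_least ennreal_less_top])
  then obtain s t where s: "(SUP x. f x) = ennreal s" "0 \<le> s" and t: "(SUP x. g x) = ennreal t" "0 \<le> t"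
    by (metis ennreal_cases less_irrefl)
  show ?thesis
  proof (cases "s = 0 \<or> t = 0")
    case True
    have "(\<forall>x. f x = 0) \<or> (\<forall>x. g x = 0)"
      using True s t by (metis SUP_upper UNIV_I ennreal_0 le_zero_eq)
    then show ?thesis by auto
  next
    case False
    then have pos: "0 < s" "0 < t" using s t by auto
    define r where "r = sqrt (s * t)"
    have r: "0 < r" "r\<^sup>2 = s * t" using pos by (auto simp: r_def)
    define lev where "lev = (\<lambda>(f :: real \<Rightarrow> ennreal) r. \<integral>\<^sup>+l\<in>{0<..<1}. emeasure lborel {x. ennreal (l * r) < f x} \<partial>lborel)"
    have F: "(\<integral>\<^sup>+x. f x \<partial>lborel) = ennreal s * lev f s"
    proof -
      have "min (f x) (ennreal s) = f x" for x using s(1) by (metis SUP_upper UNIV_I min.absorb1)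
      then show ?thesis using nn_integral_levels[of f s] pos by (simp add: lev_def)
    qed
    have G: "(\<integral>\<^sup>+x. g x \<partial>lborel) = ennreal t * lev g t"
    proof -
      have "min (g x) (ennreal t) = g x" for x using t(1) by (metis SUP_upper UNIV_I min.absorb1)
      then show ?thesis using nn_integral_levels[of g t] pos by (simp add: lev_def)
    qed
    have H: "ennreal r * lev h r \<le> (\<integral>\<^sup>+x. h x \<partial>lborel)"
      using nn_integral_levels[of h r] r by (auto simp: lev_def intro!: nn_integral_mono)
    have lev: "emeasure lborel {x. ennreal (l * s) < f x} + emeasure lborel {x. ennreal (l * t) < g x}
        \<le> 2 * emeasure lborel {x. ennreal (l * r) < h x}" if l: "0 < l" "l < 1" for l
    proof (rule Brunn_Minkowski_real)
      have "ennreal (l * s) < (SUP x. f x)" "ennreal (l * t) < (SUP x. g x)"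
        using s t l pos by (auto simp: ennreal_less_iff)
      then show "{x. ennreal (l * s) < f x} \<noteq> {}" "{x. ennreal (l * t) < g x} \<noteq> {}"
        by (auto simp: less_SUP_iff)
      fix a b assume ab: "a \<in> {x. ennreal (l * s) < f x}" "b \<in> {x. ennreal (l * t) < g x}"
      have "f a < top" "g b < top" using bound[of a] bound[of b] by (auto intro: le_less_trans[OF _ ennreal_less_top])
      then obtain u v where uv: "f a = ennreal u" "0 \<le> u" "g b = ennreal v" "0 \<le> v"
        by (metis ennreal_cases less_irrefl)
      show "(a + b) / 2 \<in> {x. ennreal (l * r) < h x}"
      proof (cases "h ((a + b) / 2)")
        case (real w)
        have "u * v \<le> w\<^sup>2" using le[of a b] uv real by (simp add: ennreal_mult'[symmetric] ennreal_power)
        moreover have "(l * s) * (l * t) < u * v"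
          using ab uv pos l by (intro mult_strict_mono') (auto simp: ennreal_less_iff)
        moreover have "(l * r)\<^sup>2 = (l * s) * (l * t)" using r by (simp add: power_mult_distrib power2_eq_square)
        ultimately have "(l * r)\<^sup>2 < w\<^sup>2" by simp
        then have "l * r < w" using real by (simp add: power2_less_imp_less)
        then show ?thesis using real l r by (simp add: ennreal_less_iff)
      qed (auto simp: ennreal_less_top)
    qed auto
    have ab: "lev f s + lev g t \<le> 2 * lev h r"
    proof -
      have "lev f s + lev g t = (\<integral>\<^sup>+l\<in>{0<..<1}. (emeasure lborel {x. ennreal (l * s) < f x}
           + emeasure lborel {x. ennreal (l * t) < g x}) \<partial>lborel)"
        unfolding lev_def by (subst nn_integral_add[symmetric]) (auto simp: distrib_right)
      also have "\<dots> \<le> (\<integral>\<^sup>+l\<in>{0<..<1}. (2 * emeasure lborel {x. ennreal (l * r) < h x}) \<partial>lborel)"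
        using lev by (intro nn_integral_mono) (auto simp: indicator_def)
      also have "\<dots> = 2 * lev h r" unfolding lev_def
        by (subst nn_integral_cmult[symmetric]) (auto simp: mult.assoc)
      finally show ?thesis .
    qed
    show ?thesis
    proof (cases "lev h r = top")
      case True
      then have "(\<integral>\<^sup>+x. h x \<partial>lborel) = top" using H r by (simp add: ennreal_mult_top top_unique)
      then show ?thesis by simp
    next
      case False
      then obtain c where c: "lev h r = ennreal c" "0 \<le> c" by (metis ennreal_cases)
      have "2 * lev h r < top" using c by (simp add: ennreal_mult_less_top)
      then have "lev f s + lev g t < top" using ab by (rule le_less_trans[rotated])
      then have "lev f s \<noteq> top" "lev g t \<noteq> top" by auto
      then obtain a b where a: "lev f s = ennreal a" "0 \<le> a" and b: "lev g t = ennreal b" "0 \<le> b"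
        by (metis ennreal_cases)
      have "ennreal (a + b) \<le> ennreal (2 * c)" using ab a b c by (simp add: ennreal_mult')
      then have abc: "a + b \<le> 2 * c" using c by (simp add: ennreal_le_iff)
      have "4 * (a * b) \<le> (a + b)\<^sup>2" using zero_le_power2[of "a - b"] by (simp add: power2_eq_square algebra_simps)
      also have "\<dots> \<le> (2 * c)\<^sup>2" using abc a b by (intro power_mono) auto
      finally have "a * b \<le> c\<^sup>2" by simp
      then have "(s * t) * (a * b) \<le> r\<^sup>2 * c\<^sup>2" using r pos by simp
      then have "ennreal ((s * a) * (t * b)) \<le> ennreal ((r * c)\<^sup>2)"
        by (intro ennreal_leI) (simp add: power_mult_distrib mult_ac)
      then have "(\<integral>\<^sup>+x. f x \<partial>lborel) * (\<integral>\<^sup>+x. g x \<partial>lborel) \<le> (ennreal r * lev h r)\<^sup>2"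
        using F G a b c pos r by (simp add: ennreal_mult'[symmetric] ennreal_power ennreal_mult''[symmetric])
      also have "\<dots> \<le> (\<integral>\<^sup>+x. h x \<partial>lborel)\<^sup>2" using H by (intro power_mono) auto
      finally show ?thesis .
    qed
  qed
qed

definition gauss :: "real \<Rightarrow> real measure" where
  "gauss s = density lborel (\<lambda>x. ennreal (normal_density 0 s x))"

lemma sets_gauss[measurable_cong, simp]: "sets (gauss s) = sets borel"
  by (simp add: gauss_def)

lemma space_gauss[simp]: "space (gauss s) = UNIV"
  by (simp add: gauss_def)

lemma prob_space_gauss: "0 < s \<Longrightarrow> prob_space (gauss s)"
  unfolding gauss_def by (rule prob_space_normal_density)

lemma nn_integral_gauss:
  "f \<in> borel_measurable borel \<Longrightarrow> (\<integral>\<^sup>+x. f x \<partial>gauss s) = (\<integral>\<^sup>+x. ennreal (normal_density 0 s x) * f x \<partial>lborel)"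
  unfolding gauss_def by (subst nn_integral_density) auto

text \<open>The parallelogram law for the exponent of the normal density \<open>p\<close>, that is
\<open>p x * p y * exp (((x - y) / (2 * s))\<^sup>2) = (p ((x + y) / 2))\<^sup>2\<close>, reduces the claim to Lebesgue
measure. The variable of \<open>g\<close> is reflected: a ball and its mirror image can then both be described
by the same function, without appeal to the symmetry of the measure.\<close>

lemma Prekopa_Leindler_gauss:
  fixes f g h :: "real \<Rightarrow> ennreal"
  assumes s: "0 < s"
    and [measurable]: "f \<in> borel_measurable borel" "g \<in> borel_measurable borel" "h \<in> borel_measurable borel"
    and bound: "\<And>x. f x \<le> ennreal K" "\<And>x. g x \<le> ennreal K"
    and le: "\<And>x y. f x * g y \<le> (h ((x - y) / 2))\<^sup>2 * ennreal (exp (((x + y) / (2 * s))\<^sup>2))"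
  shows "(\<integral>\<^sup>+x. f x \<partial>gauss s) * (\<integral>\<^sup>+x. g x \<partial>gauss s) \<le> (\<integral>\<^sup>+x. h x \<partial>gauss s)\<^sup>2"
proof -
  let ?p = "normal_density 0 s"
  have nb: "?p x \<le> 1 / sqrt (2 * pi * s\<^sup>2)" for x
    using s by (simp add: normal_density_def divide_right_mono)
  have npr: "?p x * ?p y * exp (((x - y) / (2 * s))\<^sup>2) = (?p ((x + y) / 2))\<^sup>2" for x y
  proof -
    have e: "- x\<^sup>2 / (2 * s\<^sup>2) + - y\<^sup>2 / (2 * s\<^sup>2) + ((x - y) / (2 * s))\<^sup>2 = 2 * (- ((x + y) / 2)\<^sup>2 / (2 * s\<^sup>2))"
      using s by (simp add: field_simps power2_eq_square)
    have "?p x * ?p y * exp (((x - y) / (2 * s))\<^sup>2) = (1 / sqrt (2 * pi * s\<^sup>2))\<^sup>2 *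
       (exp (- x\<^sup>2 / (2 * s\<^sup>2)) * exp (- y\<^sup>2 / (2 * s\<^sup>2)) * exp (((x - y) / (2 * s))\<^sup>2))"
      by (simp add: normal_density_def power2_eq_square)
    also have "exp (- x\<^sup>2 / (2 * s\<^sup>2)) * exp (- y\<^sup>2 / (2 * s\<^sup>2)) * exp (((x - y) / (2 * s))\<^sup>2)
       = exp (- x\<^sup>2 / (2 * s\<^sup>2) + - y\<^sup>2 / (2 * s\<^sup>2) + ((x - y) / (2 * s))\<^sup>2)"
      by (simp only: exp_add)
    also have "\<dots> = (exp (- ((x + y) / 2)\<^sup>2 / (2 * s\<^sup>2)))\<^sup>2" unfolding e by (rule exp_double)
    finally show ?thesis by (simp add: normal_density_def power_mult_distrib power_divide)
  qed
  have refl: "(\<integral>\<^sup>+x. ennreal (?p x) * g x \<partial>lborel) = (\<integral>\<^sup>+x. ennreal (?p x) * g (- x) \<partial>lborel)"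
    by (subst nn_integral_real_affine[where c="-1" and t=0]) (auto simp: normal_density_def)
  have "(\<integral>\<^sup>+x. ennreal (?p x) * f x \<partial>lborel) * (\<integral>\<^sup>+x. ennreal (?p x) * g (- x) \<partial>lborel)
      \<le> (\<integral>\<^sup>+x. ennreal (?p x) * h x \<partial>lborel)\<^sup>2"
  proof (rule Prekopa_Leindler_real)
    let ?B = "1 / sqrt (2 * pi * s\<^sup>2)"
    show "ennreal (?p x) * f x \<le> ennreal (?B * K)" "ennreal (?p x) * g (- x) \<le> ennreal (?B * K)" for x
    proof -
      have "ennreal (?B * K) = ennreal ?B * ennreal K" by (rule ennreal_mult') simp
      then show "ennreal (?p x) * f x \<le> ennreal (?B * K)" "ennreal (?p x) * g (- x) \<le> ennreal (?B * K)"
        using bound nb[of x] by (auto intro!: mult_mono ennreal_leI simp del: times_divide_eq_left)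
    qed
    fix x y
    have "(ennreal (?p x) * f x) * (ennreal (?p y) * g (- y)) = ennreal (?p x) * ennreal (?p y) * (f x * g (- y))"
      by (simp add: mult_ac)
    also have "\<dots> \<le> ennreal (?p x) * ennreal (?p y) * ((h ((x + y) / 2))\<^sup>2 * ennreal (exp (((x - y) / (2 * s))\<^sup>2)))"
      using le[of x "- y"] by (intro mult_left_mono) auto
    also have "\<dots> = ennreal (?p x * ?p y * exp (((x - y) / (2 * s))\<^sup>2)) * (h ((x + y) / 2))\<^sup>2"
      by (simp add: ennreal_mult'' ennreal_mult' mult_ac)
    also have "\<dots> = (ennreal (?p ((x + y) / 2)) * h ((x + y) / 2))\<^sup>2"
      unfolding npr by (simp add: ennreal_power power_mult_distrib)
    finally show "(ennreal (?p x) * f x) * (ennreal (?p y) * g (- y)) \<le> (ennreal (?p ((x + y) / 2)) * h ((x + y) / 2))\<^sup>2" .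
  qed auto
  then show ?thesis by (simp add: nn_integral_gauss refl)
qed

text \<open>The Cameron--Martin formula for \<open>\<epsilon> = 1\<close>. For \<open>\<epsilon> = -1\<close> the shift is combined with a reflection, and
the density is the same because the normal law is symmetric; \<open>a = 0\<close> gives reflection invariance.\<close>

lemma nn_integral_gauss_shift:
  fixes f :: "real \<Rightarrow> ennreal"
  assumes s: "0 < s" and e: "\<epsilon> = 1 \<or> \<epsilon> = -1" and [measurable]: "f \<in> borel_measurable borel"
  shows "(\<integral>\<^sup>+x. f (\<epsilon> * x - a) \<partial>gauss s) = (\<integral>\<^sup>+x. ennreal (exp (- a\<^sup>2 / (2 * s\<^sup>2) - a * x / s\<^sup>2)) * f x \<partial>gauss s)"
proof -
  let ?p = "normal_density 0 s"
  have "(\<integral>\<^sup>+x. f (\<epsilon> * x - a) \<partial>gauss s) = (\<integral>\<^sup>+x. ennreal (?p x) * f (\<epsilon> * x - a) \<partial>lborel)"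
    by (rule nn_integral_gauss) auto
  also have "\<dots> = (\<integral>\<^sup>+x. ennreal (?p (\<epsilon> * a + \<epsilon> * x)) * f x \<partial>lborel)"
    using e by (subst nn_integral_real_affine[where c="\<epsilon>" and t="\<epsilon> * a"]) (auto simp: algebra_simps)
  also have "\<dots> = (\<integral>\<^sup>+x. ennreal (?p x) * (ennreal (exp (- a\<^sup>2 / (2 * s\<^sup>2) - a * x / s\<^sup>2)) * f x) \<partial>lborel)"
  proof (intro nn_integral_cong)
    fix x
    have "?p (\<epsilon> * a + \<epsilon> * x) = ?p x * exp (- a\<^sup>2 / (2 * s\<^sup>2) - a * x / s\<^sup>2)"
    proof -
      have "(\<epsilon> * a + \<epsilon> * x)\<^sup>2 = (a + x)\<^sup>2" using e by (auto simp: power2_eq_square algebra_simps)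
      then have "- (\<epsilon> * a + \<epsilon> * x)\<^sup>2 / (2 * s\<^sup>2) = - x\<^sup>2 / (2 * s\<^sup>2) + (- a\<^sup>2 / (2 * s\<^sup>2) - a * x / s\<^sup>2)"
        using s by (simp add: field_simps power2_eq_square)
      then show ?thesis unfolding normal_density_def by (simp only: diff_0_right exp_add mult.assoc)
    qed
    then show "ennreal (?p (\<epsilon> * a + \<epsilon> * x)) * f x = ennreal (?p x) * (ennreal (exp (- a\<^sup>2 / (2 * s\<^sup>2) - a * x / s\<^sup>2)) * f x)"
      by (simp add: ennreal_mult' mult.assoc)
  qed
  also have "\<dots> = (\<integral>\<^sup>+x. ennreal (exp (- a\<^sup>2 / (2 * s\<^sup>2) - a * x / s\<^sup>2)) * f x \<partial>gauss s)"
    by (rule nn_integral_gauss[symmetric]) auto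
  finally show ?thesis .
qed

section \<open>Shifts of finite-dimensional Gaussian measures\<close>

lemma product_sigma_finite_gauss:
  assumes "\<And>k. 0 < (\<sigma> k :: real)" shows "product_sigma_finite (\<lambda>k. gauss (\<sigma> k))"
  unfolding product_sigma_finite_def
  using prob_space_gauss[OF assms] prob_space_imp_sigma_finite by blast

lemma space_PiM_gauss [simp]: "space (PiM I (\<lambda>k. gauss (\<sigma> k))) = extensional I"
  by (auto simp: space_PiM PiE_def)

lemma prob_space_PiM_gauss:
  assumes "\<And>k. 0 < \<sigma> k" shows "prob_space (PiM I (\<lambda>k. gauss (\<sigma> k)))"
  using prob_space_gauss[OF assms] by (intro prob_space_PiM) auto

lemma measurable_PiM_gauss_fun_upd:
  assumes f: "f \<in> borel_measurable (PiM (insert i I) (\<lambda>k. gauss (\<sigma> k)))"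
  shows "(\<lambda>(x, y). f (x(i := y))) \<in> borel_measurable (PiM I (\<lambda>k. gauss (\<sigma> k)) \<Otimes>\<^sub>M gauss (\<sigma> i))"
  using measurable_compose[OF measurable_add_dim f] by (simp add: case_prod_beta)

text \<open>The inequality passes to products: when one coordinate is integrated out, the one-dimensional
inequality for the slices says that the three integrated functions again satisfy the hypothesis,
with the exponents of the remaining coordinates.\<close>

lemma Prekopa_Leindler_PiM:
  fixes f g h :: "('i \<Rightarrow> real) \<Rightarrow> ennreal"
  assumes "finite I" and \<sigma>: "\<And>k. 0 < \<sigma> k"
    and "f \<in> borel_measurable (PiM I (\<lambda>k. gauss (\<sigma> k)))" "g \<in> borel_measurable (PiM I (\<lambda>k. gauss (\<sigma> k)))"
      "h \<in> borel_measurable (PiM I (\<lambda>k. gauss (\<sigma> k)))"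
    and "\<And>x. f x \<le> ennreal K" "\<And>x. g x \<le> ennreal K"
    and "\<And>x y. x \<in> extensional I \<Longrightarrow> y \<in> extensional I \<Longrightarrow>
      f x * g y \<le> (h (\<lambda>k\<in>I. (x k - y k) / 2))\<^sup>2 * ennreal (exp (\<Sum>k\<in>I. ((x k + y k) / (2 * \<sigma> k))\<^sup>2))"
  shows "(\<integral>\<^sup>+x. f x \<partial>PiM I (\<lambda>k. gauss (\<sigma> k))) * (\<integral>\<^sup>+x. g x \<partial>PiM I (\<lambda>k. gauss (\<sigma> k)))
    \<le> (\<integral>\<^sup>+x. h x \<partial>PiM I (\<lambda>k. gauss (\<sigma> k)))\<^sup>2"
  using assms(1,3-)
proof (induction I arbitrary: f g h rule: finite_induct)
  case empty
  interpret product_sigma_finite "\<lambda>k. gauss (\<sigma> k)" by (rule product_sigma_finite_gauss[OF \<sigma>])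
  have "(\<lambda>k\<in>{}. (undefined - undefined) / 2 :: real) = (\<lambda>k. undefined)" by auto
  then show ?case using empty(6)[of "\<lambda>_. undefined" "\<lambda>_. undefined"]
    by (simp add: nn_integral_empty)
next
  case (insert i I)
  let ?M = "\<lambda>k. gauss (\<sigma> k)"
  interpret product_sigma_finite ?M by (rule product_sigma_finite_gauss[OF \<sigma>])
  interpret gi: prob_space "?M i" by (rule prob_space_gauss[OF \<sigma>])
  note meas = insert.prems(1-3)
  note pair = measurable_PiM_gauss_fun_upd[OF meas(1)] measurable_PiM_gauss_fun_upd[OF meas(2)]
    measurable_PiM_gauss_fun_upd[OF meas(3)]
  define F where "F u x = (\<integral>\<^sup>+y. u (x(i := y)) \<partial>?M i)" for u :: "('i \<Rightarrow> real) \<Rightarrow> ennreal" and x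
  have F: "(\<integral>\<^sup>+x. u x \<partial>PiM (insert i I) ?M) = (\<integral>\<^sup>+x. F u x \<partial>PiM I ?M)"
    if "u \<in> borel_measurable (PiM (insert i I) ?M)" for u
    unfolding F_def using insert.hyps that by (rule product_nn_integral_insert)
  have Fm: "F u \<in> borel_measurable (PiM I ?M)" if "u \<in> borel_measurable (PiM (insert i I) ?M)" for u
  proof -
    have [measurable]: "(\<lambda>(x, y). u (x(i := y))) \<in> borel_measurable (PiM I ?M \<Otimes>\<^sub>M gauss (\<sigma> i))"
      by (rule measurable_PiM_gauss_fun_upd[OF that])
    show ?thesis unfolding F_def by measurable
  qed
  have slice: "(\<lambda>y. u (x(i := y))) \<in> borel_measurable borel"
    if "u \<in> borel_measurable (PiM (insert i I) ?M)" "x \<in> extensional I" for u x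
    using measurable_Pair2[OF measurable_PiM_gauss_fun_upd[OF that(1)], of x] that(2)
    by (simp cong: measurable_cong_sets)
  have "(\<integral>\<^sup>+x. F f x \<partial>PiM I ?M) * (\<integral>\<^sup>+x. F g x \<partial>PiM I ?M) \<le> (\<integral>\<^sup>+x. F h x \<partial>PiM I ?M)\<^sup>2"
  proof (rule insert.IH)
    show "F f \<in> borel_measurable (PiM I ?M)" "F g \<in> borel_measurable (PiM I ?M)"
      "F h \<in> borel_measurable (PiM I ?M)" using meas by (auto intro: Fm)
    have "F u x \<le> ennreal K" if "\<And>x. u x \<le> ennreal K" for u x
    proof -
      have "F u x \<le> (\<integral>\<^sup>+y. ennreal K \<partial>?M i)" unfolding F_def using that by (intro nn_integral_mono)
      then show ?thesis using gi.emeasure_space_1 by simp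
    qed
    then show "F f x \<le> ennreal K" "F g x \<le> ennreal K" for x using insert.prems by auto
  next
    fix x y :: "'i \<Rightarrow> real" assume xy: "x \<in> extensional I" "y \<in> extensional I"
    define m where "m = (\<lambda>k\<in>I. (x k - y k) / 2)"
    define S where "S = (\<Sum>k\<in>I. ((x k + y k) / (2 * \<sigma> k))\<^sup>2)"
    have m: "m \<in> extensional I" by (simp add: m_def)
    have "F f x * F g y \<le> (\<integral>\<^sup>+z. h (m(i := z)) * ennreal (exp (S / 2)) \<partial>?M i)\<^sup>2"
      unfolding F_def
    proof (rule Prekopa_Leindler_gauss[OF \<sigma>])
      show "f (x(i := z)) \<le> ennreal K" "g (y(i := z)) \<le> ennreal K" for z using insert.prems by auto
      fix s t
      have 1: "(\<lambda>k\<in>insert i I. ((x(i := s)) k - (y(i := t)) k) / 2) = m(i := (s - t) / 2)"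
        by (auto simp: m_def fun_eq_iff restrict_def)
      have 2: "(\<Sum>k\<in>insert i I. (((x(i := s)) k + (y(i := t)) k) / (2 * \<sigma> k))\<^sup>2) = ((s + t) / (2 * \<sigma> i))\<^sup>2 + S"
        using insert.hyps by (simp add: S_def) (intro sum.cong, auto)
      have "f (x(i := s)) * g (y(i := t)) \<le> (h (m(i := (s - t) / 2)))\<^sup>2 * ennreal (exp (((s + t) / (2 * \<sigma> i))\<^sup>2 + S))"
      proof -
        have "x(i := s) \<in> extensional (insert i I)" "y(i := t) \<in> extensional (insert i I)"
          using xy by (auto simp: extensional_def)
        from insert.prems(6)[OF this] show ?thesis unfolding 1 2 .
      qed
      also have "\<dots> = (h (m(i := (s - t) / 2)) * ennreal (exp (S / 2)))\<^sup>2 * ennreal (exp (((s + t) / (2 * \<sigma> i))\<^sup>2))"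
      proof -
        have "ennreal (exp (((s + t) / (2 * \<sigma> i))\<^sup>2 + S)) = (ennreal (exp (S / 2)))\<^sup>2 * ennreal (exp (((s + t) / (2 * \<sigma> i))\<^sup>2))"
          by (simp add: ennreal_power ennreal_mult''[symmetric] exp_add exp_double[symmetric] mult.commute)
        then show ?thesis by (simp add: power_mult_distrib mult_ac)
      qed
      finally show "f (x(i := s)) * g (y(i := t)) \<le> \<dots>" .
    qed (use xy m meas in \<open>auto intro!: slice\<close>)
    also have "(\<integral>\<^sup>+z. h (m(i := z)) * ennreal (exp (S / 2)) \<partial>?M i) = F h m * ennreal (exp (S / 2))"
      unfolding F_def using slice[OF meas(3) m]
      by (intro nn_integral_multc) (subst measurable_cong_sets[OF sets_gauss refl])
    also have "(F h m * ennreal (exp (S / 2)))\<^sup>2 = (F h m)\<^sup>2 * ennreal (exp S)"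
      by (simp add: power_mult_distrib ennreal_power exp_double[symmetric])
    finally show "F f x * F g y \<le> (F h (\<lambda>k\<in>I. (x k - y k) / 2))\<^sup>2 *
        ennreal (exp (\<Sum>k\<in>I. ((x k + y k) / (2 * \<sigma> k))\<^sup>2))" by (simp add: m_def S_def)
  qed
  then show ?case using meas by (simp add: F)
qed

lemma nn_integral_PiM_gauss_shift:
  fixes f :: "('i \<Rightarrow> real) \<Rightarrow> ennreal"
  assumes "finite I" and \<sigma>: "\<And>k. 0 < \<sigma> k" and e: "\<epsilon> = 1 \<or> \<epsilon> = -1"
    and "f \<in> borel_measurable (PiM I (\<lambda>k. gauss (\<sigma> k)))"
  shows "(\<integral>\<^sup>+x. f (\<lambda>k\<in>I. \<epsilon> * x k - a k) \<partial>PiM I (\<lambda>k. gauss (\<sigma> k))) =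
    (\<integral>\<^sup>+x. ennreal (exp (\<Sum>k\<in>I. - (a k)\<^sup>2 / (2 * (\<sigma> k)\<^sup>2) - a k * x k / (\<sigma> k)\<^sup>2)) * f x \<partial>PiM I (\<lambda>k. gauss (\<sigma> k)))"
  using assms(1,4)
proof (induction I arbitrary: f rule: finite_induct)
  case empty
  interpret product_sigma_finite "\<lambda>k. gauss (\<sigma> k)" by (rule product_sigma_finite_gauss[OF \<sigma>])
  show ?case by (simp add: nn_integral_empty)
next
  case (insert i I)
  let ?M = "\<lambda>k. gauss (\<sigma> k)"
  interpret product_sigma_finite ?M by (rule product_sigma_finite_gauss[OF \<sigma>])
  interpret gi: prob_space "?M i" by (rule prob_space_gauss[OF \<sigma>])
  note [measurable] = insert.prems
  let ?w = "\<lambda>k z. - (a k)\<^sup>2 / (2 * (\<sigma> k)\<^sup>2) - a k * z / (\<sigma> k)\<^sup>2"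
  have slice: "(\<lambda>y. f (x(i := y))) \<in> borel_measurable borel" if "x \<in> extensional I" for x
    using measurable_Pair2[OF measurable_PiM_gauss_fun_upd[OF insert.prems(1)], of x] that
    by (simp cong: measurable_cong_sets)
  define F where "F x = (\<integral>\<^sup>+y. ennreal (exp (?w i y)) * f (x(i := y)) \<partial>?M i)" for x
  have [measurable]: "(\<lambda>(x, y). f (x(i := y))) \<in> borel_measurable (PiM I ?M \<Otimes>\<^sub>M gauss (\<sigma> i))"
    by (rule measurable_PiM_gauss_fun_upd[OF insert.prems(1)])
  have Fm: "F \<in> borel_measurable (PiM I ?M)"
    unfolding F_def by measurable
  have r: "(\<lambda>k\<in>insert i I. \<epsilon> * (x(i := y)) k - a k) = (\<lambda>k\<in>I. \<epsilon> * x k - a k)(i := \<epsilon> * y - a i)" for x y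
    by (auto simp: fun_eq_iff)
  have "(\<integral>\<^sup>+x. f (\<lambda>k\<in>insert i I. \<epsilon> * x k - a k) \<partial>PiM (insert i I) ?M)
     = (\<integral>\<^sup>+x. \<integral>\<^sup>+y. f ((\<lambda>k\<in>I. \<epsilon> * x k - a k)(i := \<epsilon> * y - a i)) \<partial>?M i \<partial>PiM I ?M)"
    using insert.hyps by (subst product_nn_integral_insert) (simp_all only: r, measurable)
  also have "\<dots> = (\<integral>\<^sup>+x. F (\<lambda>k\<in>I. \<epsilon> * x k - a k) \<partial>PiM I ?M)"
    unfolding F_def by (intro nn_integral_cong nn_integral_gauss_shift[OF \<sigma> e slice]) simp
  also have "\<dots> = (\<integral>\<^sup>+x. ennreal (exp (\<Sum>k\<in>I. ?w k (x k))) * F x \<partial>PiM I ?M)"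
    by (rule insert.IH[OF Fm])
  also have "\<dots> = (\<integral>\<^sup>+x. \<integral>\<^sup>+y. ennreal (exp (\<Sum>k\<in>insert i I. ?w k ((x(i := y)) k))) * f (x(i := y)) \<partial>?M i \<partial>PiM I ?M)"
  proof (rule nn_integral_cong)
    fix x assume "x \<in> space (PiM I ?M)"
    then have x: "x \<in> extensional I" by simp
    have "ennreal (exp (\<Sum>k\<in>I. ?w k (x k))) * F x =
        (\<integral>\<^sup>+y. ennreal (exp (\<Sum>k\<in>I. ?w k (x k))) * (ennreal (exp (?w i y)) * f (x(i := y))) \<partial>?M i)"
      unfolding F_def using slice[OF x]
      by (intro nn_integral_cmult[symmetric]) (simp add: measurable_cong_sets[OF sets_gauss refl] borel_measurable_times_ennreal)
    also have "\<dots> = (\<integral>\<^sup>+y. ennreal (exp (\<Sum>k\<in>insert i I. ?w k ((x(i := y)) k))) * f (x(i := y)) \<partial>?M i)"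
    proof (rule nn_integral_cong)
      fix y
      have "(\<Sum>k\<in>insert i I. ?w k ((x(i := y)) k)) = ?w i y + (\<Sum>k\<in>I. ?w k (x k))"
        using insert.hyps by (subst sum.insert) (auto intro!: sum.cong)
      then show "ennreal (exp (\<Sum>k\<in>I. ?w k (x k))) * (ennreal (exp (?w i y)) * f (x(i := y)))
         = ennreal (exp (\<Sum>k\<in>insert i I. ?w k ((x(i := y)) k))) * f (x(i := y))"
        by (simp only: exp_add ennreal_mult'[OF exp_ge_zero]) (simp only: mult_ac)
    qed
    finally show "ennreal (exp (\<Sum>k\<in>I. ?w k (x k))) * F x = \<dots>" .
  qed
  also have "\<dots> = (\<integral>\<^sup>+x. ennreal (exp (\<Sum>k\<in>insert i I. ?w k (x k))) * f x \<partial>PiM (insert i I) ?M)"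
    using insert.hyps by (subst product_nn_integral_insert) auto
  finally show ?case .
qed

text \<open>For \<open>A\<close> a ball and \<open>B\<close> the centred ball of the same radius this is Anderson's inequality, improved by
the factor \<open>exp (- R / 2)\<close> where \<open>R\<close> bounds the squared Cameron--Martin norm on \<open>A\<close> from below.
It is Prekopa--Leindler for the indicators of \<open>A\<close>, \<open>A\<close> and \<open>exp (- R / 2)\<close> times that of \<open>B\<close>.\<close>

lemma gauss_PiM_explicit_Anderson:
  fixes A B :: "('i \<Rightarrow> real) set"
  assumes "finite I" and \<sigma>: "\<And>k. 0 < \<sigma> k"
    and [measurable]: "A \<in> sets (PiM I (\<lambda>k. gauss (\<sigma> k)))" "B \<in> sets (PiM I (\<lambda>k. gauss (\<sigma> k)))"
    and mid: "\<And>x y. x \<in> A \<Longrightarrow> y \<in> A \<Longrightarrow> (\<lambda>k\<in>I. (x k - y k) / 2) \<in> B"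
    and R: "\<And>x y. x \<in> A \<Longrightarrow> y \<in> A \<Longrightarrow> R \<le> (\<Sum>k\<in>I. ((x k + y k) / (2 * \<sigma> k))\<^sup>2)"
  shows "measure (PiM I (\<lambda>k. gauss (\<sigma> k))) A \<le> exp (- R / 2) * measure (PiM I (\<lambda>k. gauss (\<sigma> k))) B"
proof -
  let ?P = "PiM I (\<lambda>k. gauss (\<sigma> k))"
  interpret prob_space ?P by (rule prob_space_PiM_gauss[OF \<sigma>])
  have "(\<integral>\<^sup>+x. indicator A x \<partial>?P) * (\<integral>\<^sup>+x. indicator A x \<partial>?P) \<le> (\<integral>\<^sup>+x. ennreal (exp (- R / 2)) * indicator B x \<partial>?P)\<^sup>2"
  proof (rule Prekopa_Leindler_PiM[where K=1])
    fix x y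
    let ?S = "\<Sum>k\<in>I. ((x k + y k) / (2 * \<sigma> k))\<^sup>2"
    show "indicator A x * indicator A y \<le> (ennreal (exp (- R / 2)) * indicator B (\<lambda>k\<in>I. (x k - y k) / 2))\<^sup>2 * ennreal (exp ?S)"
    proof (cases "x \<in> A \<and> y \<in> A")
      case True
      have "(exp (- R / 2))\<^sup>2 * exp ?S = exp (- R + ?S)" by (simp add: exp_double[symmetric] exp_add[symmetric])
      also have "\<dots> \<ge> 1" using R[of x y] True by simp
      finally have "ennreal 1 \<le> ennreal ((exp (- R / 2))\<^sup>2 * exp ?S)" by (intro ennreal_leI)
      then show ?thesis using mid[of x y] True by (simp add: ennreal_power ennreal_mult' power_mult_distrib)
    qed auto
  qed (use assms in \<open>auto simp: indicator_def\<close>)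
  then have "emeasure ?P A * emeasure ?P A \<le> (ennreal (exp (- R / 2)) * emeasure ?P B)\<^sup>2"
    by (simp add: nn_integral_cmult)
  then have "ennreal ((measure ?P A)\<^sup>2) \<le> ennreal ((exp (- R / 2) * measure ?P B)\<^sup>2)"
    by (simp add: emeasure_eq_measure power2_eq_square ennreal_mult' ennreal_mult'')
  then have "(measure ?P A)\<^sup>2 \<le> (exp (- R / 2) * measure ?P B)\<^sup>2" by (simp add: ennreal_le_iff)
  then show ?thesis by (rule power2_le_imp_le) simp
qed

text \<open>The shift formula expresses the mass of the shifted set as the integral over \<open>S\<close> of
\<open>exp (- q / 2 - l x)\<close> with \<open>l\<close> linear. By symmetry of \<open>S\<close> the sign of \<open>l\<close> may be changed, and the
average of \<open>exp (- l x)\<close> and \<open>exp (l x)\<close> is at least 1.\<close>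

lemma gauss_PiM_shift_lower:
  fixes S :: "('i \<Rightarrow> real) set"
  assumes I: "finite I" and \<sigma>: "\<And>k. 0 < \<sigma> k"
    and S[measurable]: "S \<in> sets (PiM I (\<lambda>k. gauss (\<sigma> k)))"
    and sym: "\<And>x. x \<in> S \<Longrightarrow> (\<lambda>k\<in>I. - x k) \<in> S"
  shows "exp (- (\<Sum>k\<in>I. (a k)\<^sup>2 / (\<sigma> k)\<^sup>2) / 2) * measure (PiM I (\<lambda>k. gauss (\<sigma> k))) S
    \<le> measure (PiM I (\<lambda>k. gauss (\<sigma> k))) {x \<in> extensional I. (\<lambda>k\<in>I. x k - a k) \<in> S}"
proof -
  let ?P = "PiM I (\<lambda>k. gauss (\<sigma> k))"
  interpret prob_space ?P by (rule prob_space_PiM_gauss[OF \<sigma>])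
  let ?T = "{x \<in> extensional I. (\<lambda>k\<in>I. x k - a k) \<in> S}"
  define q where "q = (\<Sum>k\<in>I. (a k)\<^sup>2 / (\<sigma> k)\<^sup>2)"
  define l where "l x = (\<Sum>k\<in>I. a k * x k / (\<sigma> k)\<^sup>2)" for x
  have w: "(\<Sum>k\<in>I. - (a k)\<^sup>2 / (2 * (\<sigma> k)\<^sup>2) - a k * x k / (\<sigma> k)\<^sup>2) = - q / 2 - l x" for x
    by (simp add: q_def l_def sum_subtractf sum_divide_distrib sum_negf mult.commute)
  have [measurable]: "?T \<in> sets ?P"
  proof -
    have "(\<lambda>x. \<lambda>k\<in>I. x k - a k) -` S \<inter> space ?P \<in> sets ?P"
      by (rule measurable_sets[OF _ S]) measurable
    moreover have "(\<lambda>x. \<lambda>k\<in>I. x k - a k) -` S \<inter> space ?P = ?T" by auto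
    ultimately show ?thesis by (simp only:)
  qed
  have [measurable]: "l \<in> borel_measurable ?P" unfolding l_def by measurable
  have 1: "emeasure ?P ?T = (\<integral>\<^sup>+x. ennreal (exp (- q / 2 - l x)) * indicator S x \<partial>?P)"
  proof -
    have "emeasure ?P ?T = (\<integral>\<^sup>+x. indicator S (\<lambda>k\<in>I. 1 * x k - a k) \<partial>?P)"
    proof -
      have "emeasure ?P ?T = (\<integral>\<^sup>+x. indicator ?T x \<partial>?P)" by simp
      also have "\<dots> = (\<integral>\<^sup>+x. indicator S (\<lambda>k\<in>I. 1 * x k - a k) \<partial>?P)"
        by (intro nn_integral_cong) (simp add: indicator_def)
      finally show ?thesis .
    qed
    then show ?thesis using nn_integral_PiM_gauss_shift[where \<sigma>=\<sigma>, OF I \<sigma>, where \<epsilon>=1 and f="indicator S" and a=a] unfolding w by simp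
  qed
  have 2: "(\<integral>\<^sup>+x. ennreal (exp (- q / 2 - l x)) * indicator S x \<partial>?P) = (\<integral>\<^sup>+x. ennreal (exp (- q / 2 + l x)) * indicator S x \<partial>?P)"
  proof -
    have "(\<integral>\<^sup>+x. ennreal (exp (- q / 2 - l x)) * indicator S x \<partial>?P) =
       (\<integral>\<^sup>+x. ennreal (exp (- q / 2 - l (\<lambda>k\<in>I. -1 * x k - 0))) * indicator S (\<lambda>k\<in>I. -1 * x k - 0) \<partial>?P)"
      using nn_integral_PiM_gauss_shift[where \<sigma>=\<sigma>, OF I \<sigma>, where \<epsilon>="-1" and f="\<lambda>x. ennreal (exp (- q / 2 - l x)) * indicator S x" and a="\<lambda>_. 0"]
      by simp
    also have "\<dots> = (\<integral>\<^sup>+x. ennreal (exp (- q / 2 + l x)) * indicator S x \<partial>?P)"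
    proof (rule nn_integral_cong)
      fix x assume "x \<in> space ?P"
      then have x: "x \<in> extensional I" by simp
      have "l (\<lambda>k\<in>I. -1 * x k - 0) = - l x" by (simp add: l_def sum_negf)
      moreover have "(\<lambda>k\<in>I. -1 * x k - 0) \<in> S \<longleftrightarrow> x \<in> S"
      proof -
        have "(\<lambda>k\<in>I. - (\<lambda>k\<in>I. - x k) k) = x" using x by (auto simp: extensional_def fun_eq_iff)
        then show ?thesis using sym[of x] sym[of "\<lambda>k\<in>I. - x k"] by auto
      qed
      ultimately show "ennreal (exp (- q / 2 - l (\<lambda>k\<in>I. -1 * x k - 0))) * indicator S (\<lambda>k\<in>I. -1 * x k - 0)
         = ennreal (exp (- q / 2 + l x)) * indicator S x" by (simp add: indicator_def)
    qed
    finally show ?thesis .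
  qed
  have "2 * (ennreal (exp (- q / 2)) * emeasure ?P S) = (\<integral>\<^sup>+x. ennreal (2 * exp (- q / 2)) * indicator S x \<partial>?P)"
    by (simp add: nn_integral_cmult ennreal_mult' mult.assoc)
  also have "\<dots> \<le> (\<integral>\<^sup>+x. (ennreal (exp (- q / 2 - l x)) * indicator S x + ennreal (exp (- q / 2 + l x)) * indicator S x) \<partial>?P)"
  proof (intro nn_integral_mono)
    fix x
    have "2 \<le> exp (- l x) + exp (l x)" using exp_ge_add_one_self[of "l x"] exp_ge_add_one_self[of "- l x"] by linarith
    then have "exp (- q / 2) * 2 \<le> exp (- q / 2) * (exp (- l x) + exp (l x))" by (intro mult_left_mono) auto
    moreover have "2 * exp (- q / 2) \<le> exp (- q / 2 - l x) + exp (- q / 2 + l x)"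
      if "exp (- q / 2) * 2 \<le> exp (- q / 2) * (exp (- l x) + exp (l x))"
    proof -
      have "exp (- q / 2 - l x) = exp (- q / 2) * exp (- l x)" "exp (- q / 2 + l x) = exp (- q / 2) * exp (l x)"
        using exp_add[of "- q / 2" "- l x"] exp_add[of "- q / 2" "l x"] by simp_all
      with that show ?thesis by (simp only: distrib_left mult.commute[of 2])
    qed
    ultimately have "2 * exp (- q / 2) \<le> exp (- q / 2 - l x) + exp (- q / 2 + l x)" by blast
    then have "ennreal (2 * exp (- q / 2)) \<le> ennreal (exp (- q / 2 - l x)) + ennreal (exp (- q / 2 + l x))"
      by (simp add: ennreal_plus[symmetric] del: ennreal_plus)
    then show "ennreal (2 * exp (- q / 2)) * indicator S x \<le>
        ennreal (exp (- q / 2 - l x)) * indicator S x + ennreal (exp (- q / 2 + l x)) * indicator S x"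
      by (auto simp: indicator_def)
  qed
  also have "\<dots> = 2 * emeasure ?P ?T"
  proof -
    have "(\<integral>\<^sup>+x. (ennreal (exp (- q / 2 - l x)) * indicator S x + ennreal (exp (- q / 2 + l x)) * indicator S x) \<partial>?P)
      = (\<integral>\<^sup>+x. ennreal (exp (- q / 2 - l x)) * indicator S x \<partial>?P) + (\<integral>\<^sup>+x. ennreal (exp (- q / 2 + l x)) * indicator S x \<partial>?P)"
      by (rule nn_integral_add) measurable
    then show ?thesis by (simp only: 2[symmetric] 1[symmetric] mult_2)
  qed
  finally have "ennreal (2 * (exp (- q / 2) * measure ?P S)) \<le> ennreal (2 * measure ?P ?T)"
    by (simp add: emeasure_eq_measure ennreal_mult')
  then show ?thesis by (simp add: q_def ennreal_le_iff)
qed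

section \<open>Independence from characteristic functions\<close>

lemma char_gauss:
  assumes s: "0 < s" shows "char (gauss s) t = complex_of_real (exp (- (s * t)\<^sup>2 / 2))"
proof -
  have "char (gauss s) t = (CLINT x|lborel. normal_density 0 s x *\<^sub>R iexp (t * x))"
    unfolding char_def gauss_def by (subst integral_density) (auto simp: normal_density_nonneg)
  also have "\<dots> = \<bar>s\<bar> *\<^sub>R (CLINT x|lborel. normal_density 0 s (0 + s * x) *\<^sub>R iexp (t * (0 + s * x)))"
    using s by (intro lborel_integral_real_affine) auto
  also have "\<dots> = (CLINT x|lborel. std_normal_density x *\<^sub>R iexp ((s * t) * x))"
  proof -
    have "s * normal_density 0 s (s * x) = std_normal_density x" for x
      using s by (simp add: normal_density_def power_mult_distrib real_sqrt_mult)
    then have eq: "s *\<^sub>R (normal_density 0 s (s * x) *\<^sub>R z) = std_normal_density x *\<^sub>R z" for x and z :: complex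
      by (metis scaleR_scaleR)
    have "\<bar>s\<bar> *\<^sub>R (CLINT x|lborel. normal_density 0 s (0 + s * x) *\<^sub>R iexp (t * (0 + s * x)))
        = (CLINT x|lborel. s *\<^sub>R (normal_density 0 s (s * x) *\<^sub>R iexp (t * (s * x))))"
      using s by (subst integral_scaleR_right) simp
    also have "\<dots> = (CLINT x|lborel. std_normal_density x *\<^sub>R iexp ((s * t) * x))"
      unfolding eq by (simp add: mult_ac)
    finally show ?thesis .
  qed
  also have "\<dots> = char std_normal_distribution (s * t)"
    unfolding char_def by (subst integral_density) (auto simp: normal_density_nonneg)
  finally show ?thesis by (simp add: char_std_normal_distribution)
qed

context prob_space begin

text \<open>Normalised, \<open>w\<close> is the density of a probability measure under which \<open>X\<close> has the same characteristic
function as before, hence the same law.\<close>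

lemma expectation_weight_factor_nonneg:
  fixes w X :: "'a \<Rightarrow> real"
  assumes [measurable]: "w \<in> borel_measurable M" "X \<in> borel_measurable M" and B[measurable]: "B \<in> sets borel"
    and w: "\<And>x. 0 \<le> w x" "\<And>x. w x \<le> C"
    and f: "\<And>s. (CLINT x|M. w x * iexp (s * X x)) = (LINT x|M. w x) * (CLINT x|M. iexp (s * X x))"
  shows "(LINT x|M. w x * indicator B (X x)) = (LINT x|M. w x) * prob (X -` B \<inter> space M)"
proof -
  have int: "integrable M w" using w by (intro integrable_const_bound[of _ C]) auto
  define m where "m = (LINT x|M. w x)"
  have m0: "0 \<le> m" using w by (simp add: m_def)
  show ?thesis
  proof (cases "m = 0")
    case True
    then have "AE x in M. w x = 0" using integral_nonneg_eq_0_iff_AE[OF int] w by (simp add: m_def)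
    then have "(LINT x|M. w x * indicator B (X x)) = 0" by (intro integral_eq_zero_AE) (auto elim: eventually_mono)
    then show ?thesis using True m_def by simp
  next
    case False
    then have m: "0 < m" using m0 by simp
    define D where "D = density M (\<lambda>x. ennreal (w x / m))"
    have "emeasure D (space D) = (\<integral>\<^sup>+x. ennreal (w x / m) \<partial>M)"
      by (simp add: D_def emeasure_density cong: nn_integral_cong)
    also have "\<dots> = ennreal (LINT x|M. w x / m)" using int w m by (intro nn_integral_eq_integral) auto
    also have "\<dots> = 1" using m by (simp add: m_def[symmetric])
    finally interpret D: prob_space D by (rule prob_spaceI)
    have Dm[measurable_cong]: "sets D = sets M" by (simp add: D_def)
    have "distr D borel X = distr M borel X"
    proof (rule Levy_uniqueness)
      show "real_distribution (distr D borel X)" "real_distribution (distr M borel X)"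
        by (auto intro!: D.real_distribution_distr real_distribution_distr)
      show "char (distr D borel X) = char (distr M borel X)"
      proof
        fix s
        have "char (distr D borel X) s = (CLINT x|D. iexp (s * X x))"
          unfolding char_def by (subst integral_distr) auto
        also have "\<dots> = (CLINT x|M. (w x / m) *\<^sub>R iexp (s * X x))"
          unfolding D_def using w m by (subst integral_density) auto
        also have "\<dots> = (CLINT x|M. (1 / m) *\<^sub>R (w x * iexp (s * X x)))"
          by (intro Bochner_Integration.integral_cong) (auto simp: scaleR_conv_of_real)
        also have "\<dots> = (1 / m) *\<^sub>R (m * (CLINT x|M. iexp (s * X x)))"
          unfolding integral_scaleR_right using f[of s] m_def by simp
        also have "\<dots> = char (distr M borel X) s"
          unfolding char_def using m by (subst integral_distr) (auto simp: scaleR_conv_of_real)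
        finally show "char (distr D borel X) s = char (distr M borel X) s" .
      qed
    qed
    then have "measure (distr D borel X) B = measure (distr M borel X) B" by simp
    then have eq: "measure D (X -` B \<inter> space M) = prob (X -` B \<inter> space M)"
      by (simp add: measure_distr D_def)
    have "measure D (X -` B \<inter> space M) = (LINT x|D. indicator B (X x))"
    proof -
      have "(LINT x|D. indicator B (X x)) = (LINT x|D. (indicator (X -` B \<inter> space M) x :: real))"
        by (intro Bochner_Integration.integral_cong) (auto simp: D_def indicator_def)
      then show ?thesis by (simp add: D_def Int_absorb1)
    qed
    also have "\<dots> = (LINT x|M. (w x / m) *\<^sub>R indicator B (X x))"
      unfolding D_def using w m by (subst integral_density) auto
    also have "\<dots> = (LINT x|M. w x * indicator B (X x)) / m" by simp
    finally show ?thesis using eq m by (simp add: m_def[symmetric] field_simps)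
  qed
qed

text \<open>The hypothesis is inherited by the conjugate of \<open>W\<close>, hence by the real weight \<open>1 + Re W\<close>, which is
nonnegative.\<close>

lemma expectation_weight_factor_Re:
  fixes W :: "'a \<Rightarrow> complex" and X :: "'a \<Rightarrow> real"
  assumes [measurable]: "W \<in> borel_measurable M" "X \<in> borel_measurable M" and B[measurable]: "B \<in> sets borel"
    and W: "\<And>x. cmod (W x) \<le> 1"
    and f: "\<And>s. (CLINT x|M. W x * iexp (s * X x)) = (CLINT x|M. W x) * (CLINT x|M. iexp (s * X x))"
  shows "(LINT x|M. Re (W x) * indicator B (X x)) = (LINT x|M. Re (W x)) * prob (X -` B \<inter> space M)"
proof -
  have [measurable]: "(\<lambda>x. cnj (W x)) \<in> borel_measurable M"
    by (rule measurable_compose[OF assms(1)]) (intro borel_measurable_continuous_onI continuous_intros)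
  have iW: "integrable M W" using W by (intro integrable_const_bound[of _ 1]) auto
  have ie: "integrable M (\<lambda>x. iexp (s * X x))" for s by (intro integrable_const_bound[of _ 1]) auto
  have iWe: "integrable M (\<lambda>x. W x * iexp (s * X x))" for s
    using W by (intro integrable_const_bound[of _ 1]) (auto simp: norm_mult)
  have iWe': "integrable M (\<lambda>x. cnj (W x) * iexp (s * X x))" for s
    using W by (intro integrable_const_bound[of _ 1]) (auto simp: norm_mult)
  have cn: "(CLINT x|M. cnj (W x) * iexp (s * X x)) = cnj (CLINT x|M. W x) * (CLINT x|M. iexp (s * X x))" for s
  proof -
    have "(CLINT x|M. cnj (W x) * iexp (s * X x)) = (CLINT x|M. cnj (W x * iexp ((- s) * X x)))"
      by (intro Bochner_Integration.integral_cong) (auto simp: exp_cnj)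
    also have "\<dots> = cnj (CLINT x|M. W x * iexp ((- s) * X x))" by (rule Bochner_Integration.integral_cnj)
    also have "\<dots> = cnj (CLINT x|M. W x) * cnj (CLINT x|M. iexp ((- s) * X x))" unfolding f by simp
    also have "cnj (CLINT x|M. iexp ((- s) * X x)) = (CLINT x|M. iexp (s * X x))"
      unfolding Bochner_Integration.integral_cnj[symmetric] by (intro Bochner_Integration.integral_cong) (auto simp: exp_cnj)
    finally show ?thesis .
  qed
  have R: "integrable M (\<lambda>x. Re (W x))" using iW by simp
  \<comment> \<open>The shift by 1 makes the weight nonnegative.\<close>
  define w where "w x = 1 + Re (W x)" for x
  have "(LINT x|M. w x * indicator B (X x)) = (LINT x|M. w x) * prob (X -` B \<inter> space M)"
  proof (rule expectation_weight_factor_nonneg[where C=2])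
    show "0 \<le> w x" "w x \<le> 2" for x using W[of x] abs_Re_le_cmod[of "W x"] by (auto simp: w_def abs_le_iff)
    fix s
    have "(CLINT x|M. complex_of_real (w x) * iexp (s * X x)) =
       (CLINT x|M. iexp (s * X x) + (1 / 2) * (W x * iexp (s * X x) + cnj (W x) * iexp (s * X x)))"
      by (intro Bochner_Integration.integral_cong refl) (simp add: w_def distrib_right[symmetric] complex_add_cnj algebra_simps)
    also have "\<dots> = (CLINT x|M. iexp (s * X x)) + (1 / 2) * ((CLINT x|M. W x * iexp (s * X x)) +
        (CLINT x|M. cnj (W x) * iexp (s * X x)))"
      using ie[of s] iWe[of s] iWe'[of s] by simp
    also have "\<dots> = (CLINT x|M. iexp (s * X x)) + (1 / 2) * ((CLINT x|M. W x) * (CLINT x|M. iexp (s * X x)) +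
        cnj (CLINT x|M. W x) * (CLINT x|M. iexp (s * X x)))"
      unfolding f cn ..
    also have "\<dots> = (1 + (1/2) * ((CLINT x|M. W x) + cnj (CLINT x|M. W x))) * (CLINT x|M. iexp (s * X x))"
      by (simp add: algebra_simps)
    also have "1 + (1/2) * ((CLINT x|M. W x) + cnj (CLINT x|M. W x)) = complex_of_real (LINT x|M. w x)"
      unfolding w_def using R iW by (simp add: complex_add_cnj integral_Re prob_space)
    finally show "(CLINT x|M. complex_of_real (w x) * iexp (s * X x)) = complex_of_real (LINT x|M. w x) * (CLINT x|M. iexp (s * X x))" .
  qed (auto simp: w_def)
  moreover have "(LINT x|M. w x) = 1 + (LINT x|M. Re (W x))" unfolding w_def using R by (simp add: prob_space)
  moreover have "(LINT x|M. w x * indicator B (X x)) = prob (X -` B \<inter> space M) + (LINT x|M. Re (W x) * indicator B (X x))"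
  proof -
    have i1: "integrable M (\<lambda>x. indicator B (X x) :: real)" by (intro integrable_const_bound[of _ 1]) auto
    have i2: "integrable M (\<lambda>x. Re (W x) * indicator B (X x))"
      using order_trans[OF abs_Re_le_cmod W] by (intro integrable_const_bound[of _ 1]) (auto simp: indicator_def)
    have "(LINT x|M. w x * indicator B (X x)) = (LINT x|M. indicator B (X x) + Re (W x) * indicator B (X x))"
      by (simp add: w_def distrib_right)
    also have "\<dots> = (LINT x|M. indicator B (X x)) + (LINT x|M. Re (W x) * indicator B (X x))"
      using i1 i2 by (rule Bochner_Integration.integral_add)
    also have "(LINT x|M. indicator B (X x)) = prob (X -` B \<inter> space M)"
    proof -
      have "(LINT x|M. indicator B (X x)) = (LINT x|M. (indicator (X -` B \<inter> space M) x :: real))"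
        by (intro Bochner_Integration.integral_cong) (auto simp: indicator_def)
      then show ?thesis by (simp add: Int_absorb1)
    qed
    finally show ?thesis .
  qed
  ultimately show ?thesis by (simp add: distrib_right)
qed

lemma expectation_weight_factor:
  fixes W :: "'a \<Rightarrow> complex" and X :: "'a \<Rightarrow> real"
  assumes [measurable]: "W \<in> borel_measurable M" "X \<in> borel_measurable M" and B[measurable]: "B \<in> sets borel"
    and W: "\<And>x. cmod (W x) \<le> 1"
    and f: "\<And>s. (CLINT x|M. W x * iexp (s * X x)) = (CLINT x|M. W x) * (CLINT x|M. iexp (s * X x))"
  shows "(CLINT x|M. W x * indicator B (X x)) = (CLINT x|M. W x) * complex_of_real (prob (X -` B \<inter> space M))"
proof -
  have iW: "integrable M W" using W by (intro integrable_const_bound[of _ 1]) auto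
  have iWB: "integrable M (\<lambda>x. W x * indicator B (X x))"
    using W by (intro integrable_const_bound[of _ 1]) (auto simp: norm_mult indicator_def)
  have 1: "(LINT x|M. Re (W x) * indicator B (X x)) = (LINT x|M. Re (W x)) * prob (X -` B \<inter> space M)"
    by (rule expectation_weight_factor_Re) (use W f in auto)
  have 2: "(LINT x|M. Re (- \<i> * W x) * indicator B (X x)) = (LINT x|M. Re (- \<i> * W x)) * prob (X -` B \<inter> space M)"
  proof (rule expectation_weight_factor_Re)
    fix s
    have "(CLINT x|M. - \<i> * W x * iexp (s * X x)) = - \<i> * (CLINT x|M. W x * iexp (s * X x))"
      by (simp only: mult.assoc integral_mult_right_zero)
    then show "(CLINT x|M. - \<i> * W x * iexp (s * X x)) = (CLINT x|M. - \<i> * W x) * (CLINT x|M. iexp (s * X x))"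
      unfolding f by (simp add: mult.assoc)
  qed (use W in \<open>auto simp: norm_mult\<close>)
  show ?thesis
  proof (rule complex_eqI)
    have "Re (CLINT x|M. W x * indicator B (X x)) = (LINT x|M. Re (W x * indicator B (X x)))"
      by (rule integral_Re[symmetric, OF iWB])
    also have "\<dots> = (LINT x|M. Re (W x) * indicator B (X x))"
      by (intro Bochner_Integration.integral_cong) (auto simp: indicator_def)
    finally show "Re (CLINT x|M. W x * indicator B (X x)) = Re ((CLINT x|M. W x) * complex_of_real (prob (X -` B \<inter> space M)))"
      using 1 integral_Re[OF iW] by simp
    have "Im (CLINT x|M. W x * indicator B (X x)) = (LINT x|M. Im (W x * indicator B (X x)))"
      by (rule integral_Im[symmetric, OF iWB])
    also have "\<dots> = (LINT x|M. Im (W x) * indicator B (X x))"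
      by (intro Bochner_Integration.integral_cong) (auto simp: indicator_def)
    finally show "Im (CLINT x|M. W x * indicator B (X x)) = Im ((CLINT x|M. W x) * complex_of_real (prob (X -` B \<inter> space M)))"
      using 2 integral_Im[OF iW] by simp
  qed
qed

text \<open>The exponentials in the factorised characteristic function are replaced by indicators, one variable
at a time. At each step the product of the other factors is a bounded complex weight to which
\<open>expectation_weight_factor\<close> applies.\<close>

lemma prob_eq_prod_of_char:
  fixes X :: "'i \<Rightarrow> 'a \<Rightarrow> real"
  assumes I: "finite I" and X[measurable]: "\<And>k. X k \<in> borel_measurable M" and B[measurable]: "\<And>k. B k \<in> sets borel"
    and ch: "\<And>t. (CLINT x|M. \<Prod>k\<in>I. iexp (t k * X k x)) = (\<Prod>k\<in>I. CLINT x|M. iexp (t k * X k x))"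
  shows "prob {x \<in> space M. \<forall>k\<in>I. X k x \<in> B k} = (\<Prod>k\<in>I. prob (X k -` B k \<inter> space M))"
proof -
  define Z where "Z S t k x = (if k \<in> S then indicator (B k) (X k x) else iexp (t k * X k x))" for S t k x
  have Zm[measurable]: "Z S t k \<in> borel_measurable M" for S t k unfolding Z_def by measurable
  have Z1: "cmod (Z S t k x) \<le> 1" for S t k x by (auto simp: Z_def indicator_def)
  have "(CLINT x|M. \<Prod>k\<in>I. Z S t k x) = (\<Prod>k\<in>I. CLINT x|M. Z S t k x)" if "finite S" "S \<subseteq> I" for S t
    using that
  proof (induction S arbitrary: t rule: finite_induct)
    case empty
    then show ?case using ch by (simp add: Z_def)
  next
    case (insert j S)
    then have j: "j \<in> I" "j \<notin> S" by auto
    define W where "W x = (\<Prod>k\<in>I - {j}. Z S t k x)" for x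
    define p where "p = (\<Prod>k\<in>I - {j}. CLINT x|M. Z S t k x)"
    have We: "(CLINT x|M. W x * iexp (s * X j x)) = p * (CLINT x|M. iexp (s * X j x))" for s
    proof -
      have "(CLINT x|M. \<Prod>k\<in>I. Z S (t(j := s)) k x) = (\<Prod>k\<in>I. CLINT x|M. Z S (t(j := s)) k x)"
        by (rule insert.IH) (use insert in auto)
      moreover have Zj: "Z S (t(j := s)) j = (\<lambda>x. iexp (s * X j x))" using j by (auto simp: Z_def fun_eq_iff)
      moreover have Zk: "Z S (t(j := s)) k = Z S t k" if "k \<noteq> j" for k using that by (auto simp: Z_def fun_eq_iff)
      moreover have "(\<Prod>k\<in>I. Z S (t(j := s)) k x) = W x * iexp (s * X j x)" for x
        unfolding W_def using j I by (subst prod.remove[of I j]) (simp_all add: Zj Zk mult.commute)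
      moreover have "(\<Prod>k\<in>I. CLINT x|M. Z S (t(j := s)) k x) = p * (CLINT x|M. iexp (s * X j x))"
        unfolding p_def using j I by (subst prod.remove[of I j]) (simp_all add: Zj Zk mult.commute)
      ultimately show ?thesis by simp
    qed
    have p: "(CLINT x|M. W x) = p" using We[of 0] by (simp add: prob_space)
    have "(CLINT x|M. W x * indicator (B j) (X j x)) = (CLINT x|M. W x) * complex_of_real (prob (X j -` B j \<inter> space M))"
    proof (rule expectation_weight_factor)
      show "cmod (W x) \<le> 1" for x unfolding W_def using Z1
        by (simp add: prod_norm[symmetric] prod_le_1)
    qed (use We p in \<open>auto simp: W_def\<close>)
    moreover have "(CLINT x|M. indicator (B j) (X j x) :: complex) = complex_of_real (prob (X j -` B j \<inter> space M))"
    proof -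
      have "(CLINT x|M. indicator (B j) (X j x) :: complex) = (CLINT x|M. complex_of_real (indicator (X j -` B j \<inter> space M) x))"
        by (intro Bochner_Integration.integral_cong) (auto simp: indicator_def)
      then show ?thesis by (simp add: Int_absorb1)
    qed
    moreover have Zj: "Z (insert j S) t j = (\<lambda>x. indicator (B j) (X j x))" by (auto simp: Z_def fun_eq_iff)
    moreover have Zk: "Z (insert j S) t k = Z S t k" if "k \<noteq> j" for k using that by (auto simp: Z_def fun_eq_iff)
    moreover have "(\<Prod>k\<in>I. Z (insert j S) t k x) = W x * indicator (B j) (X j x)" for x
      unfolding W_def using j I by (subst prod.remove[of I j]) (simp_all add: Zj Zk mult.commute)
    moreover have "(\<Prod>k\<in>I. CLINT x|M. Z (insert j S) t k x) = p * (CLINT x|M. indicator (B j) (X j x))"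
      unfolding p_def using j I by (subst prod.remove[of I j]) (simp_all add: Zj Zk mult.commute)
    ultimately show ?case using p by simp
  qed
  from this[of I "\<lambda>_. 0"] have "(CLINT x|M. \<Prod>k\<in>I. indicator (B k) (X k x)) = (\<Prod>k\<in>I. CLINT x|M. indicator (B k) (X k x) :: complex)"
    using I by (simp add: Z_def)
  moreover have "(CLINT x|M. indicator (B k) (X k x) :: complex) = complex_of_real (prob (X k -` B k \<inter> space M))" for k
  proof -
    have "(CLINT x|M. indicator (B k) (X k x) :: complex) = (CLINT x|M. complex_of_real (indicator (X k -` B k \<inter> space M) x))"
      by (intro Bochner_Integration.integral_cong) (auto simp: indicator_def)
    then show ?thesis by (simp add: Int_absorb1)
  qed
  moreover have "(CLINT x|M. \<Prod>k\<in>I. indicator (B k) (X k x) :: complex) = complex_of_real (prob {x \<in> space M. \<forall>k\<in>I. X k x \<in> B k})"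
  proof -
    have "(\<Prod>k\<in>I. indicator (B k) (X k x)) = complex_of_real (indicator {x \<in> space M. \<forall>k\<in>I. X k x \<in> B k} x)"
      if "x \<in> space M" for x
      using that I by (auto simp: indicator_def)
    then have "(CLINT x|M. \<Prod>k\<in>I. indicator (B k) (X k x) :: complex) = (CLINT x|M. complex_of_real (indicator {x \<in> space M. \<forall>k\<in>I. X k x \<in> B k} x))"
      by (intro Bochner_Integration.integral_cong) auto
    also have "\<dots> = complex_of_real (prob ({x \<in> space M. \<forall>k\<in>I. X k x \<in> B k} \<inter> space M))" by simp
    finally show ?thesis by (simp add: Int_absorb2 subsetI)
  qed
  ultimately have "complex_of_real (prob {x \<in> space M. \<forall>k\<in>I. X k x \<in> B k}) = complex_of_real (\<Prod>k\<in>I. prob (X k -` B k \<inter> space M))"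
    by simp
  then show ?thesis by (simp only: of_real_eq_iff)
qed

text \<open>A random vector all of whose linear combinations are centred Gaussian with the variances of
independent summands has independent Gaussian components.\<close>

lemma distr_PiM_gauss_of_char:
  fixes X :: "'i \<Rightarrow> 'a \<Rightarrow> real"
  assumes I: "finite I" and \<sigma>: "\<And>k. 0 < \<sigma> k" and X[measurable]: "\<And>k. X k \<in> borel_measurable M"
    and ch: "\<And>t. (CLINT x|M. iexp (\<Sum>k\<in>I. t k * X k x)) = complex_of_real (exp (- (\<Sum>k\<in>I. (\<sigma> k * t k)\<^sup>2) / 2))"
  shows "distr M (PiM I (\<lambda>k. gauss (\<sigma> k))) (\<lambda>x. \<lambda>k\<in>I. X k x) = PiM I (\<lambda>k. gauss (\<sigma> k))"
proof -
  have c1: "(CLINT x|M. iexp (s * X k x)) = complex_of_real (exp (- (\<sigma> k * s)\<^sup>2 / 2))" if k: "k \<in> I" for k s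
  proof -
    have "(\<Sum>j\<in>I. (if j = k then s else 0) * X j x) = s * X k x" for x
      using I k by (subst sum.remove[of I k]) auto
    moreover have "(\<Sum>j\<in>I. (\<sigma> j * (if j = k then s else 0))\<^sup>2) = (\<sigma> k * s)\<^sup>2"
      using I k by (subst sum.remove[of I k]) auto
    ultimately show ?thesis using ch[of "\<lambda>j. if j = k then s else 0"] by simp
  qed
  have prod: "(CLINT x|M. \<Prod>k\<in>I. iexp (t k * X k x)) = (\<Prod>k\<in>I. CLINT x|M. iexp (t k * X k x))" for t
  proof -
    have "(\<Prod>k\<in>I. iexp (t k * X k x)) = iexp (\<Sum>k\<in>I. t k * X k x)" for x
      using I by (simp add: exp_sum[symmetric] sum_distrib_left)
    moreover have "(\<Prod>k\<in>I. CLINT x|M. iexp (t k * X k x)) = complex_of_real (exp (- (\<Sum>k\<in>I. (\<sigma> k * t k)\<^sup>2) / 2))"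
    proof -
      have "(\<Prod>k\<in>I. CLINT x|M. iexp (t k * X k x)) = (\<Prod>k\<in>I. complex_of_real (exp (- (\<sigma> k * t k)\<^sup>2 / 2)))"
        by (intro prod.cong refl c1)
      also have "\<dots> = complex_of_real (exp (\<Sum>k\<in>I. - (\<sigma> k * t k)\<^sup>2 / 2))"
        using I by (simp add: exp_sum)
      finally show ?thesis by (simp add: sum_negf sum_divide_distrib)
    qed
    ultimately show ?thesis using ch by simp
  qed
  have law: "distr M borel (X k) = gauss (\<sigma> k)" if k: "k \<in> I" for k
  proof (rule Levy_uniqueness)
    show "real_distribution (distr M borel (X k))" by (intro real_distribution_distr) simp
    show "real_distribution (gauss (\<sigma> k))"
      using prob_space_gauss[OF \<sigma>] by (simp add: real_distribution_def real_distribution_axioms_def)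
    show "char (distr M borel (X k)) = char (gauss (\<sigma> k))"
    proof
      fix s
      show "char (distr M borel (X k)) s = char (gauss (\<sigma> k)) s"
        unfolding char_gauss[OF \<sigma>] c1[OF k, symmetric] unfolding char_def by (subst integral_distr) auto
    qed
  qed
  interpret product_sigma_finite "\<lambda>k. gauss (\<sigma> k)"
    unfolding product_sigma_finite_def using prob_space_gauss[OF \<sigma>] prob_space_imp_sigma_finite by blast
  show ?thesis
  proof (rule PiM_eqI[OF I])
    fix A assume A: "\<And>k. k \<in> I \<Longrightarrow> A k \<in> sets (gauss (\<sigma> k))"
    define B where "B k = (if k \<in> I then A k else UNIV)" for k
    have B[measurable]: "B k \<in> sets borel" for k using A by (auto simp: B_def)
    have AB: "PiE I A = PiE I B" by (intro PiE_cong) (simp add: B_def)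
    have "emeasure (distr M (PiM I (\<lambda>k. gauss (\<sigma> k))) (\<lambda>x. \<lambda>k\<in>I. X k x)) (PiE I A)
       = emeasure M {x \<in> space M. \<forall>k\<in>I. X k x \<in> B k}"
    proof -
      have "(\<lambda>x. \<lambda>k\<in>I. X k x) -` PiE I B \<inter> space M = {x \<in> space M. \<forall>k\<in>I. X k x \<in> B k}"
        by (auto simp: PiE_iff)
      moreover have "PiE I B \<in> sets (PiM I (\<lambda>k. gauss (\<sigma> k)))" using I by (intro sets_PiM_I_finite) auto
      ultimately show ?thesis unfolding AB by (subst emeasure_distr) auto
    qed
    also have "\<dots> = ennreal (\<Prod>k\<in>I. prob (X k -` B k \<inter> space M))"
      unfolding emeasure_eq_measure by (subst prob_eq_prod_of_char[OF I X B prod]) simp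
    also have "\<dots> = (\<Prod>k\<in>I. ennreal (prob (X k -` B k \<inter> space M)))" by (simp add: prod_ennreal)
    also have "\<dots> = (\<Prod>k\<in>I. emeasure (gauss (\<sigma> k)) (A k))"
    proof (intro prod.cong refl)
      fix k assume k: "k \<in> I"
      have "emeasure (gauss (\<sigma> k)) (A k) = emeasure (distr M borel (X k)) (B k)" using law[OF k] k by (simp add: B_def)
      then show "ennreal (prob (X k -` B k \<inter> space M)) = emeasure (gauss (\<sigma> k)) (A k)"
        by (simp add: emeasure_distr emeasure_eq_measure)
    qed
    finally show "emeasure (distr M (PiM I (\<lambda>k. gauss (\<sigma> k))) (\<lambda>x. \<lambda>k\<in>I. X k x)) (PiE I A) = (\<Prod>k\<in>I. emeasure (gauss (\<sigma> k)) (A k))" .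
  qed simp
qed

end

section \<open>Gaussian series and infinite intersections of slabs\<close>

text \<open>Finitely many of the independent Gaussian variables \<open>X\<close> at a time have the product law, and each
functional \<open>l j\<close> is, at every point, the sum of a series in the \<open>X k\<close>. The sets of interest are the
infinite intersections of the slabs \<open>\<bar>l j - b j\<bar> \<le> \<delta>\<close>; for a Gaussian measure on a function space
these are the closed balls.\<close>

locale gaussian_series = prob_space +
  fixes X :: "nat \<Rightarrow> 'a \<Rightarrow> real" and \<sigma> :: "nat \<Rightarrow> real" and a :: "nat \<Rightarrow> nat \<Rightarrow> real" and l :: "nat \<Rightarrow> 'a \<Rightarrow> real"
  assumes X_measurable[measurable]: "X k \<in> borel_measurable M"
    and l_measurable[measurable]: "l j \<in> borel_measurable M"
    and \<sigma>_pos: "0 < \<sigma> k"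
    and law: "distr M (PiM {..<N} (\<lambda>k. gauss (\<sigma> k))) (\<lambda>\<omega>. \<lambda>k\<in>{..<N}. X k \<omega>) = PiM {..<N} (\<lambda>k. gauss (\<sigma> k))"
    and conv: "\<omega> \<in> space M \<Longrightarrow> (\<lambda>k. a j k * X k \<omega>) sums l j \<omega>"
begin

definition cyl :: "(nat \<Rightarrow> real) \<Rightarrow> real \<Rightarrow> nat \<Rightarrow> 'a set" where
  "cyl b \<delta> n = {\<omega>\<in>space M. \<forall>j<n. \<bar>l j \<omega> - b j\<bar> \<le> \<delta>}"

text \<open>The slabs with the series truncated after \<open>N\<close> terms; an event about the first \<open>N\<close> variables only.\<close>

definition tcyl :: "(nat \<Rightarrow> real) \<Rightarrow> real \<Rightarrow> nat \<Rightarrow> nat \<Rightarrow> 'a set" where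
  "tcyl b \<delta> n N = {\<omega>\<in>space M. \<forall>j<n. \<bar>(\<Sum>k<N. a j k * X k \<omega>) - b j\<bar> \<le> \<delta>}"

definition tail :: "real \<Rightarrow> nat \<Rightarrow> nat \<Rightarrow> 'a set" where
  "tail \<epsilon> n N = {\<omega>\<in>space M. \<exists>j<n. \<epsilon> < \<bar>(\<Sum>k<N. a j k * X k \<omega>) - l j \<omega>\<bar>}"

lemma sets_cyl[measurable]: "cyl b \<delta> n \<in> events" "tcyl b \<delta> n N \<in> events" "tail \<epsilon> n N \<in> events"
  unfolding cyl_def tcyl_def tail_def by measurable

lemma prob_tail: assumes "0 < \<epsilon>" shows "(\<lambda>N. prob (tail \<epsilon> n N)) \<longlonglongrightarrow> 0"
proof -
  have "(\<lambda>N. LINT \<omega>|M. indicator (tail \<epsilon> n N) \<omega>) \<longlonglongrightarrow> (LINT \<omega>|M. (0::real))"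
  proof (rule integral_dominated_convergence[where w="\<lambda>_. 1"])
    show "AE \<omega> in M. (\<lambda>N. indicator (tail \<epsilon> n N) \<omega> :: real) \<longlonglongrightarrow> 0"
    proof (rule AE_I2)
      fix \<omega> assume \<omega>: "\<omega> \<in> space M"
      have "\<forall>\<^sub>F N in sequentially. \<forall>j\<in>{..<n}. \<bar>(\<Sum>k<N. a j k * X k \<omega>) - l j \<omega>\<bar> < \<epsilon>"
      proof (rule eventually_ball_finite)
        show "\<forall>j\<in>{..<n}. \<forall>\<^sub>F N in sequentially. \<bar>(\<Sum>k<N. a j k * X k \<omega>) - l j \<omega>\<bar> < \<epsilon>"
          using conv[OF \<omega>] assms unfolding sums_def tendsto_iff dist_real_def by auto
      qed simp
      then have "\<forall>\<^sub>F N in sequentially. indicator (tail \<epsilon> n N) \<omega> = (0::real)"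
      proof eventually_elim
        case (elim N)
        have "\<omega> \<notin> tail \<epsilon> n N"
        proof
          assume "\<omega> \<in> tail \<epsilon> n N"
          then obtain j where "j < n" "\<epsilon> < \<bar>(\<Sum>k<N. a j k * X k \<omega>) - l j \<omega>\<bar>" by (auto simp: tail_def)
          then show False using elim by force
        qed
        then show ?case by simp
      qed
      then show "(\<lambda>N. indicator (tail \<epsilon> n N) \<omega> :: real) \<longlonglongrightarrow> 0" by (rule tendsto_eventually)
    qed
  qed auto
  then show ?thesis by (simp add: Int_absorb2 sets.sets_into_space)
qed

lemma prob_cyl_le: "prob (cyl b \<delta> n) \<le> prob (tcyl b (\<delta> + \<epsilon>) n N) + prob (tail \<epsilon> n N)"
proof -
  have "cyl b \<delta> n \<subseteq> tcyl b (\<delta> + \<epsilon>) n N \<union> tail \<epsilon> n N"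
  proof
    fix \<omega> assume \<omega>: "\<omega> \<in> cyl b \<delta> n"
    show "\<omega> \<in> tcyl b (\<delta> + \<epsilon>) n N \<union> tail \<epsilon> n N"
    proof (cases "\<omega> \<in> tail \<epsilon> n N")
      case False
      have "\<bar>(\<Sum>k<N. a j k * X k \<omega>) - b j\<bar> \<le> \<delta> + \<epsilon>" if "j < n" for j
      proof -
        have "\<bar>(\<Sum>k<N. a j k * X k \<omega>) - l j \<omega>\<bar> \<le> \<epsilon>"
        proof (rule ccontr)
          assume "\<not> ?thesis"
          then have "\<omega> \<in> tail \<epsilon> n N" using that \<omega> by (auto simp: tail_def cyl_def intro!: exI[of _ j])
          then show False using False by simp
        qed
        moreover have "\<bar>l j \<omega> - b j\<bar> \<le> \<delta>" using \<omega> that by (simp add: cyl_def)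
        ultimately show ?thesis by linarith
      qed
      then show ?thesis using \<omega> by (simp add: cyl_def tcyl_def)
    qed simp
  qed
  then have "prob (cyl b \<delta> n) \<le> prob (tcyl b (\<delta> + \<epsilon>) n N \<union> tail \<epsilon> n N)" by (intro finite_measure_mono) auto
  also have "\<dots> \<le> prob (tcyl b (\<delta> + \<epsilon>) n N) + prob (tail \<epsilon> n N)" by (intro measure_Un_le) auto
  finally show ?thesis .
qed

lemma prob_tcyl_le: "prob (tcyl b \<delta> n N) \<le> prob (cyl b (\<delta> + \<epsilon>) n) + prob (tail \<epsilon> n N)"
proof -
  have "tcyl b \<delta> n N \<subseteq> cyl b (\<delta> + \<epsilon>) n \<union> tail \<epsilon> n N"
  proof
    fix \<omega> assume \<omega>: "\<omega> \<in> tcyl b \<delta> n N"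
    show "\<omega> \<in> cyl b (\<delta> + \<epsilon>) n \<union> tail \<epsilon> n N"
    proof (cases "\<omega> \<in> tail \<epsilon> n N")
      case False
      have "\<bar>l j \<omega> - b j\<bar> \<le> \<delta> + \<epsilon>" if "j < n" for j
      proof -
        have "\<bar>(\<Sum>k<N. a j k * X k \<omega>) - l j \<omega>\<bar> \<le> \<epsilon>"
        proof (rule ccontr)
          assume "\<not> ?thesis"
          then have "\<omega> \<in> tail \<epsilon> n N" using that \<omega> by (auto simp: tail_def tcyl_def intro!: exI[of _ j])
          then show False using False by simp
        qed
        moreover have "\<bar>(\<Sum>k<N. a j k * X k \<omega>) - b j\<bar> \<le> \<delta>" using \<omega> that by (simp add: tcyl_def)
        ultimately show ?thesis by linarith
      qed
      then show ?thesis using \<omega> by (simp add: cyl_def tcyl_def)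
    qed simp
  qed
  then have "prob (tcyl b \<delta> n N) \<le> prob (cyl b (\<delta> + \<epsilon>) n \<union> tail \<epsilon> n N)" by (intro finite_measure_mono) auto
  also have "\<dots> \<le> prob (cyl b (\<delta> + \<epsilon>) n) + prob (tail \<epsilon> n N)" by (intro measure_Un_le) auto
  finally show ?thesis .
qed

definition box :: "(nat \<Rightarrow> real) \<Rightarrow> real \<Rightarrow> nat \<Rightarrow> nat \<Rightarrow> (nat \<Rightarrow> real) set" where
  "box b \<delta> n N = {x \<in> extensional {..<N}. \<forall>j<n. \<bar>(\<Sum>k<N. a j k * x k) - b j\<bar> \<le> \<delta>}"

lemma sets_box: "box b \<delta> n N \<in> sets (PiM {..<N} (\<lambda>k. gauss (\<sigma> k)))"
proof -
  let ?P = "PiM {..<N} (\<lambda>k. gauss (\<sigma> k))"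
  have coord: "(\<lambda>x. x k) \<in> borel_measurable ?P" if "k \<in> {..<N}" for k
    using measurable_component_singleton[OF that, of "\<lambda>k. gauss (\<sigma> k)"]
    by (subst (asm) measurable_cong_sets[OF refl sets_gauss])
  have "(\<lambda>x. \<bar>(\<Sum>k<N. a j k * x k) - b j\<bar>) \<in> borel_measurable ?P" for j
    by (intro borel_measurable_abs borel_measurable_diff borel_measurable_sum borel_measurable_times
        borel_measurable_const coord)
  then have "{x \<in> space ?P. \<bar>(\<Sum>k<N. a j k * x k) - b j\<bar> \<le> \<delta>} \<in> sets ?P" for j
    by (intro borel_measurable_le borel_measurable_const)
  then have "{x \<in> space ?P. \<forall>j\<in>{..<n}. \<bar>(\<Sum>k<N. a j k * x k) - b j\<bar> \<le> \<delta>} \<in> sets ?P"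
    by (intro sets.sets_Collect_finite_All) auto
  then show ?thesis by (simp only: box_def space_PiM_gauss lessThan_iff Ball_def)
qed

lemma prob_tcyl: "prob (tcyl b \<delta> n N) = measure (PiM {..<N} (\<lambda>k. gauss (\<sigma> k))) (box b \<delta> n N)"
proof -
  have "measure (distr M (PiM {..<N} (\<lambda>k. gauss (\<sigma> k))) (\<lambda>\<omega>. \<lambda>k\<in>{..<N}. X k \<omega>)) (box b \<delta> n N)
      = prob ((\<lambda>\<omega>. \<lambda>k\<in>{..<N}. X k \<omega>) -` box b \<delta> n N \<inter> space M)"
    by (rule measure_distr[OF _ sets_box]) (intro measurable_restrict, simp)
  also have "(\<lambda>\<omega>. \<lambda>k\<in>{..<N}. X k \<omega>) -` box b \<delta> n N \<inter> space M = tcyl b \<delta> n N"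
    by (auto simp: box_def tcyl_def)
  finally show ?thesis unfolding law by simp
qed

text \<open>Half-differences of two points of the box around \<open>b\<close> lie in the centred box, and midpoints in the box
around \<open>b\<close>, where \<open>R\<close> bounds the weighted square sum.\<close>

lemma tcyl_upper:
  assumes R: "\<And>h. \<forall>j<n. \<bar>(\<Sum>k<N. a j k * h k) - b j\<bar> \<le> \<delta> \<Longrightarrow> R \<le> (\<Sum>k<N. (h k / \<sigma> k)\<^sup>2)"
  shows "prob (tcyl b \<delta> n N) \<le> exp (- R / 2) * prob (tcyl (\<lambda>_. 0) \<delta> n N)"
  unfolding prob_tcyl
proof (rule gauss_PiM_explicit_Anderson[OF _ \<sigma>_pos])
  fix x y assume xy: "x \<in> box b \<delta> n N" "y \<in> box b \<delta> n N"
  have half: "\<bar>(s - t) / 2\<bar> \<le> \<delta>" "\<bar>(s + t) / 2\<bar> \<le> \<delta>" if "\<bar>s\<bar> \<le> \<delta>" "\<bar>t\<bar> \<le> \<delta>" for s t :: real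
    using that unfolding abs_le_iff by (auto simp: field_simps)
  have "\<bar>\<Sum>k<N. a j k * ((x k - y k) / 2)\<bar> \<le> \<delta>" if j: "j < n" for j
  proof -
    have "(\<Sum>k<N. a j k * ((x k - y k) / 2)) = (((\<Sum>k<N. a j k * x k) - b j) - ((\<Sum>k<N. a j k * y k) - b j)) / 2"
    proof -
      have "(\<Sum>k<N. a j k * ((x k - y k) / 2)) = ((\<Sum>k<N. a j k * x k) - (\<Sum>k<N. a j k * y k)) / 2"
        unfolding sum_subtractf[symmetric] sum_divide_distrib by (intro sum.cong refl) (simp add: right_diff_distrib)
      then show ?thesis by simp
    qed
    also have "\<bar>\<dots>\<bar> \<le> \<delta>" using xy j by (intro half) (auto simp: box_def)
    finally show ?thesis .
  qed
  then show "(\<lambda>k\<in>{..<N}. (x k - y k) / 2) \<in> box (\<lambda>_. 0) \<delta> n N" by (auto simp: box_def)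
  have "R \<le> (\<Sum>k<N. (((x k + y k) / 2) / \<sigma> k)\<^sup>2)"
  proof (rule R, intro allI impI)
    fix j assume j: "j < n"
    have "(\<Sum>k<N. a j k * ((x k + y k) / 2)) - b j = (((\<Sum>k<N. a j k * x k) - b j) + ((\<Sum>k<N. a j k * y k) - b j)) / 2"
    proof -
      have "(\<Sum>k<N. a j k * ((x k + y k) / 2)) = ((\<Sum>k<N. a j k * x k) + (\<Sum>k<N. a j k * y k)) / 2"
        unfolding sum.distrib[symmetric] sum_divide_distrib by (intro sum.cong refl) (simp add: distrib_left)
      then show ?thesis by (simp add: field_simps)
    qed
    also have "\<bar>\<dots>\<bar> \<le> \<delta>" using xy j by (intro half) (auto simp: box_def)
    finally show "\<bar>(\<Sum>k<N. a j k * ((x k + y k) / 2)) - b j\<bar> \<le> \<delta>" .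
  qed
  then show "R \<le> (\<Sum>k<N. ((x k + y k) / (2 * \<sigma> k))\<^sup>2)" by simp
qed (rule finite_lessThan sets_box)+

lemma tcyl_lower:
  assumes "(\<Sum>k<N. (h k / \<sigma> k)\<^sup>2) \<le> q"
  shows "exp (- q / 2) * prob (tcyl (\<lambda>_. 0) \<delta> n N) \<le> prob (tcyl (\<lambda>j. \<Sum>k<N. a j k * h k) \<delta> n N)"
proof -
  let ?P = "PiM {..<N} (\<lambda>k. gauss (\<sigma> k))"
  have "exp (- q / 2) * prob (tcyl (\<lambda>_. 0) \<delta> n N) \<le> exp (- (\<Sum>k<N. (h k)\<^sup>2 / (\<sigma> k)\<^sup>2) / 2) * prob (tcyl (\<lambda>_. 0) \<delta> n N)"
    using assms by (intro mult_right_mono) (auto simp: power_divide)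
  also have "\<dots> \<le> measure ?P {x \<in> extensional {..<N}. (\<lambda>k\<in>{..<N}. x k - h k) \<in> box (\<lambda>_. 0) \<delta> n N}"
    unfolding prob_tcyl
  proof (rule gauss_PiM_shift_lower[OF _ \<sigma>_pos])
    show "(\<lambda>k\<in>{..<N}. - x k) \<in> box (\<lambda>_. 0) \<delta> n N" if "x \<in> box (\<lambda>_. 0) \<delta> n N" for x
      using that by (simp add: box_def sum_negf)
  qed (simp_all add: sets_box)
  also have "{x \<in> extensional {..<N}. (\<lambda>k\<in>{..<N}. x k - h k) \<in> box (\<lambda>_. 0) \<delta> n N} = box (\<lambda>j. \<Sum>k<N. a j k * h k) \<delta> n N"
    by (auto simp: box_def right_diff_distrib sum_subtractf)
  finally show ?thesis unfolding prob_tcyl .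
qed

lemma prob_cyl_Lim: "(\<lambda>n. prob (cyl b (\<delta> + c / (real n + 1)) n)) \<longlonglongrightarrow> prob {\<omega>\<in>space M. \<forall>j. \<bar>l j \<omega> - b j\<bar> \<le> \<delta>}"
  if c: "0 \<le> c"
proof -
  have mono: "c / (real n + 1) \<le> c / (real m + 1)" if "m \<le> n" for m n
    using that c by (intro divide_left_mono) auto
  have "decseq (\<lambda>n. cyl b (\<delta> + c / (real n + 1)) n)"
  proof (rule decseq_SucI)
    fix n show "cyl b (\<delta> + c / (real (Suc n) + 1)) (Suc n) \<subseteq> cyl b (\<delta> + c / (real n + 1)) n"
    proof
      fix \<omega> assume \<omega>: "\<omega> \<in> cyl b (\<delta> + c / (real (Suc n) + 1)) (Suc n)"
      have "\<bar>l j \<omega> - b j\<bar> \<le> \<delta> + c / (real n + 1)" if "j < n" for j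
      proof -
        have "\<bar>l j \<omega> - b j\<bar> \<le> \<delta> + c / (real (Suc n) + 1)" using \<omega> that by (simp add: cyl_def)
        then show ?thesis using mono[of n "Suc n"] by linarith
      qed
      then show "\<omega> \<in> cyl b (\<delta> + c / (real n + 1)) n" using \<omega> by (simp add: cyl_def)
    qed
  qed
  then have "(\<lambda>n. prob (cyl b (\<delta> + c / (real n + 1)) n)) \<longlonglongrightarrow> prob (\<Inter>n. cyl b (\<delta> + c / (real n + 1)) n)"
    by (intro finite_Lim_measure_decseq) auto
  also have "(\<Inter>n. cyl b (\<delta> + c / (real n + 1)) n) = {\<omega>\<in>space M. \<forall>j. \<bar>l j \<omega> - b j\<bar> \<le> \<delta>}"
  proof (intro equalityI subsetI)
    fix \<omega> assume \<omega>: "\<omega> \<in> (\<Inter>n. cyl b (\<delta> + c / (real n + 1)) n)"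
    then have sp: "\<omega> \<in> space M" by (auto simp: cyl_def)
    have "\<bar>l j \<omega> - b j\<bar> \<le> \<delta>" for j
    proof (rule LIMSEQ_le_const)
      have "(\<lambda>n. \<delta> + c * (1 / real (Suc n))) \<longlonglongrightarrow> \<delta> + c * 0"
        by (intro tendsto_intros) (use LIMSEQ_inverse_real_of_nat in \<open>simp add: inverse_eq_divide\<close>)
      then show "(\<lambda>n. \<delta> + c / (real n + 1)) \<longlonglongrightarrow> \<delta>" by (simp add: add.commute)
      show "\<exists>n0. \<forall>n\<ge>n0. \<bar>l j \<omega> - b j\<bar> \<le> \<delta> + c / (real n + 1)"
        using \<omega> by (intro exI[of _ "Suc j"]) (auto simp: cyl_def)
    qed
    then show "\<omega> \<in> {\<omega>\<in>space M. \<forall>j. \<bar>l j \<omega> - b j\<bar> \<le> \<delta>}" using sp by auto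
  next
    fix \<omega> assume "\<omega> \<in> {\<omega>\<in>space M. \<forall>j. \<bar>l j \<omega> - b j\<bar> \<le> \<delta>}"
    then show "\<omega> \<in> (\<Inter>n. cyl b (\<delta> + c / (real n + 1)) n)"
      using c by (auto simp: cyl_def intro!: add_increasing2)
  qed
  finally show ?thesis .
qed

text \<open>If no finite combination \<open>h\<close> of small norm satisfies the first \<open>n0\<close> constraints up to \<open>\<epsilon>\<close>, then the
intersection of slabs around \<open>b\<close> is light. The finite-dimensional inequality holds for every number
\<open>n \<ge> n0\<close> of slabs and every truncation \<open>N\<close>; letting \<open>N\<close> and then \<open>n\<close> go to infinity costs a slack in
the radius, which vanishes in the limit because the slabs are closed.\<close>

lemma prob_ball_upper:
  assumes \<epsilon>: "0 < \<epsilon>"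
    and R: "\<And>N h. \<forall>j<n0. \<bar>(\<Sum>k<N. a j k * h k) - b j\<bar> \<le> \<delta> + \<epsilon> \<Longrightarrow> R \<le> (\<Sum>k<N. (h k / \<sigma> k)\<^sup>2)"
  shows "prob {\<omega>\<in>space M. \<forall>j. \<bar>l j \<omega> - b j\<bar> \<le> \<delta>} \<le> exp (- R / 2) * prob {\<omega>\<in>space M. \<forall>j. \<bar>l j \<omega>\<bar> \<le> \<delta>}"
proof -
  have step: "prob (cyl b \<delta> n) \<le> exp (- R / 2) * prob (cyl (\<lambda>_. 0) (\<delta> + (2 * \<epsilon>) / (real n + 1)) n)" if n: "n0 \<le> n" for n
  proof -
    \<comment> \<open>The slack shrinks with \<open>n\<close>, so that a single limit removes both the slack and the restriction to \<open>n\<close> slabs.\<close>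
    define \<theta> where "\<theta> = \<epsilon> / (real n + 1)"
    have \<theta>: "0 < \<theta>" "\<theta> \<le> \<epsilon>" using \<epsilon> by (auto simp: \<theta>_def field_simps)
    show ?thesis
    proof (rule LIMSEQ_le_const)
      show "(\<lambda>N. exp (- R / 2) * (prob (cyl (\<lambda>_. 0) (\<delta> + (2 * \<epsilon>) / (real n + 1)) n) + prob (tail \<theta> n N)) + prob (tail \<theta> n N))
        \<longlonglongrightarrow> exp (- R / 2) * prob (cyl (\<lambda>_. 0) (\<delta> + (2 * \<epsilon>) / (real n + 1)) n)"
        using tendsto_add[OF tendsto_mult[OF tendsto_const tendsto_add[OF tendsto_const prob_tail[OF \<theta>(1)]]] prob_tail[OF \<theta>(1)]]
        by simp
      show "\<exists>N0. \<forall>N\<ge>N0. prob (cyl b \<delta> n) \<le> exp (- R / 2) * (prob (cyl (\<lambda>_. 0) (\<delta> + (2 * \<epsilon>) / (real n + 1)) n) + prob (tail \<theta> n N)) + prob (tail \<theta> n N)"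
      proof (intro exI allI impI)
        fix N :: nat
        have "prob (cyl b \<delta> n) \<le> prob (tcyl b (\<delta> + \<theta>) n N) + prob (tail \<theta> n N)" by (rule prob_cyl_le)
        also have "prob (tcyl b (\<delta> + \<theta>) n N) \<le> exp (- R / 2) * prob (tcyl (\<lambda>_. 0) (\<delta> + \<theta>) n N)"
        proof (intro tcyl_upper R allI impI)
          fix h j assume h: "\<forall>j<n. \<bar>(\<Sum>k<N. a j k * h k) - b j\<bar> \<le> \<delta> + \<theta>" and "j < n0"
          then have "\<bar>(\<Sum>k<N. a j k * h k) - b j\<bar> \<le> \<delta> + \<theta>" using n by simp
          then show "\<bar>(\<Sum>k<N. a j k * h k) - b j\<bar> \<le> \<delta> + \<epsilon>" using \<theta> by linarith
        qed
        also have "prob (tcyl (\<lambda>_. 0) (\<delta> + \<theta>) n N) \<le> prob (cyl (\<lambda>_. 0) (\<delta> + \<theta> + \<theta>) n) + prob (tail \<theta> n N)"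
          by (rule prob_tcyl_le)
        finally show "prob (cyl b \<delta> n) \<le> exp (- R / 2) * (prob (cyl (\<lambda>_. 0) (\<delta> + (2 * \<epsilon>) / (real n + 1)) n) + prob (tail \<theta> n N)) + prob (tail \<theta> n N)"
          by (simp add: \<theta>_def add.assoc add_divide_distrib[symmetric])
      qed
    qed
  qed
  have "prob {\<omega>\<in>space M. \<forall>j. \<bar>l j \<omega> - b j\<bar> \<le> \<delta>} \<le> exp (- R / 2) * prob {\<omega>\<in>space M. \<forall>j. \<bar>l j \<omega> - (\<lambda>_. 0) j\<bar> \<le> \<delta>}"
  proof (rule LIMSEQ_le)
    show "(\<lambda>n. prob (cyl b (\<delta> + 0 / (real n + 1)) n)) \<longlonglongrightarrow> prob {\<omega>\<in>space M. \<forall>j. \<bar>l j \<omega> - b j\<bar> \<le> \<delta>}"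
      by (rule prob_cyl_Lim) simp
    show "(\<lambda>n. exp (- R / 2) * prob (cyl (\<lambda>_. 0) (\<delta> + (2 * \<epsilon>) / (real n + 1)) n)) \<longlonglongrightarrow> exp (- R / 2) * prob {\<omega>\<in>space M. \<forall>j. \<bar>l j \<omega> - (\<lambda>_. 0) j\<bar> \<le> \<delta>}"
      using \<epsilon> by (intro tendsto_mult tendsto_const prob_cyl_Lim) simp
  qed (use step in auto)
  then show ?thesis by simp
qed

text \<open>The centre \<open>b\<close> is the image of a square-summable shift \<open>h\<close>. Truncations of \<open>h\<close> are admissible
finite-dimensional shifts, and their images converge to \<open>b\<close> in each of finitely many slabs.\<close>

lemma prob_ball_lower:
  assumes h: "\<And>j. (\<lambda>k. a j k * h k) sums b j" and q: "\<And>N. (\<Sum>k<N. (h k / \<sigma> k)\<^sup>2) \<le> q"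
  shows "exp (- q / 2) * prob {\<omega>\<in>space M. \<forall>j. \<bar>l j \<omega>\<bar> \<le> \<delta>} \<le> prob {\<omega>\<in>space M. \<forall>j. \<bar>l j \<omega> - b j\<bar> \<le> \<delta>}"
proof -
  have step: "exp (- q / 2) * prob (cyl (\<lambda>_. 0) \<delta> n) \<le> prob (cyl b (\<delta> + 3 / (real n + 1)) n)" for n
  proof -
    define \<theta> where "\<theta> = 1 / (real n + 1)"
    have \<theta>: "0 < \<theta>" by (auto simp: \<theta>_def field_simps)
    show ?thesis
    proof (rule LIMSEQ_le_const)
      show "(\<lambda>N. prob (cyl b (\<delta> + 3 / (real n + 1)) n) + prob (tail \<theta> n N) + exp (- q / 2) * prob (tail \<theta> n N))
        \<longlonglongrightarrow> prob (cyl b (\<delta> + 3 / (real n + 1)) n)"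
        using tendsto_add[OF tendsto_add[OF tendsto_const prob_tail[OF \<theta>]] tendsto_mult[OF tendsto_const prob_tail[OF \<theta>]]]
        by simp
      have "\<forall>\<^sub>F N in sequentially. \<forall>j\<in>{..<n}. \<bar>(\<Sum>k<N. a j k * h k) - b j\<bar> < \<theta>"
      proof (rule eventually_ball_finite)
        show "\<forall>j\<in>{..<n}. \<forall>\<^sub>F N in sequentially. \<bar>(\<Sum>k<N. a j k * h k) - b j\<bar> < \<theta>"
          using h \<theta> unfolding sums_def tendsto_iff dist_real_def by auto
      qed simp
      then obtain N0 where N0: "\<And>N j. N0 \<le> N \<Longrightarrow> j < n \<Longrightarrow> \<bar>(\<Sum>k<N. a j k * h k) - b j\<bar> < \<theta>"
        by (auto simp: eventually_sequentially)
      show "\<exists>N0. \<forall>N\<ge>N0. exp (- q / 2) * prob (cyl (\<lambda>_. 0) \<delta> n) \<le>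
        prob (cyl b (\<delta> + 3 / (real n + 1)) n) + prob (tail \<theta> n N) + exp (- q / 2) * prob (tail \<theta> n N)"
      proof (intro exI allI impI)
        fix N assume N: "N0 \<le> N"
        have "exp (- q / 2) * prob (cyl (\<lambda>_. 0) \<delta> n) \<le> exp (- q / 2) * (prob (tcyl (\<lambda>_. 0) (\<delta> + \<theta>) n N) + prob (tail \<theta> n N))"
          by (intro mult_left_mono prob_cyl_le) simp
        also have "\<dots> = exp (- q / 2) * prob (tcyl (\<lambda>_. 0) (\<delta> + \<theta>) n N) + exp (- q / 2) * prob (tail \<theta> n N)"
          by (rule distrib_left)
        also have "exp (- q / 2) * prob (tcyl (\<lambda>_. 0) (\<delta> + \<theta>) n N) \<le> prob (tcyl (\<lambda>j. \<Sum>k<N. a j k * h k) (\<delta> + \<theta>) n N)"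
          by (rule tcyl_lower[OF q])
        also have "\<dots> \<le> prob (tcyl b (\<delta> + \<theta> + \<theta>) n N)"
        proof (rule finite_measure_mono)
          show "tcyl (\<lambda>j. \<Sum>k<N. a j k * h k) (\<delta> + \<theta>) n N \<subseteq> tcyl b (\<delta> + \<theta> + \<theta>) n N"
          proof
            fix \<omega> assume \<omega>: "\<omega> \<in> tcyl (\<lambda>j. \<Sum>k<N. a j k * h k) (\<delta> + \<theta>) n N"
            have "\<bar>(\<Sum>k<N. a j k * X k \<omega>) - b j\<bar> \<le> \<delta> + \<theta> + \<theta>" if "j < n" for j
            proof -
              have "\<bar>(\<Sum>k<N. a j k * X k \<omega>) - (\<Sum>k<N. a j k * h k)\<bar> \<le> \<delta> + \<theta>"
                using \<omega> that by (simp add: tcyl_def)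
              then show ?thesis using N0[OF N that] by linarith
            qed
            then show "\<omega> \<in> tcyl b (\<delta> + \<theta> + \<theta>) n N" using \<omega> by (simp add: tcyl_def)
          qed
        qed simp
        also have "\<dots> \<le> prob (cyl b (\<delta> + \<theta> + \<theta> + \<theta>) n) + prob (tail \<theta> n N)" by (rule prob_tcyl_le)
        also have "\<delta> + \<theta> + \<theta> + \<theta> = \<delta> + 3 / (real n + 1)" by (simp add: \<theta>_def)
        finally show "exp (- q / 2) * prob (cyl (\<lambda>_. 0) \<delta> n) \<le>
          prob (cyl b (\<delta> + 3 / (real n + 1)) n) + prob (tail \<theta> n N) + exp (- q / 2) * prob (tail \<theta> n N)" by simp
      qed
    qed
  qed
  have "exp (- q / 2) * prob {\<omega>\<in>space M. \<forall>j. \<bar>l j \<omega> - (\<lambda>_. 0) j\<bar> \<le> \<delta>} \<le> prob {\<omega>\<in>space M. \<forall>j. \<bar>l j \<omega> - b j\<bar> \<le> \<delta>}"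
  proof (rule LIMSEQ_le)
    show "(\<lambda>n. exp (- q / 2) * prob (cyl (\<lambda>_. 0) (\<delta> + 0 / (real n + 1)) n)) \<longlonglongrightarrow> exp (- q / 2) * prob {\<omega>\<in>space M. \<forall>j. \<bar>l j \<omega> - (\<lambda>_. 0) j\<bar> \<le> \<delta>}"
      by (intro tendsto_mult tendsto_const prob_cyl_Lim) simp
    show "(\<lambda>n. prob (cyl b (\<delta> + 3 / (real n + 1)) n)) \<longlonglongrightarrow> prob {\<omega>\<in>space M. \<forall>j. \<bar>l j \<omega> - b j\<bar> \<le> \<delta>}"
      by (rule prob_cyl_Lim) simp
  qed (use step in auto)
  then show ?thesis by simp
qed

end

section \<open>Square-integrable functions and diagonal operators\<close>

definition square_integrable :: "'a measure \<Rightarrow> ('a \<Rightarrow> real) set" where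
  "square_integrable M = {f \<in> borel_measurable M. integrable M (\<lambda>x. (f x)\<^sup>2)}"

lemma square_integrableD:
  assumes "f \<in> square_integrable M"
  shows "f \<in> borel_measurable M" "integrable M (\<lambda>x. (f x)\<^sup>2)"
  using assms by (auto simp: square_integrable_def)

lemma integrable_mult_square_integrable:
  assumes f: "f \<in> square_integrable M" and g: "g \<in> square_integrable M"
  shows "integrable M (\<lambda>x. f x * g x)"
proof (rule Bochner_Integration.integrable_bound)
  note [measurable] = square_integrableD(1)[OF f] square_integrableD(1)[OF g]
  show "integrable M (\<lambda>x. (f x)\<^sup>2 + (g x)\<^sup>2)" using f g by (auto simp: square_integrable_def)
  show "(\<lambda>x. f x * g x) \<in> borel_measurable M" by measurable
  have "\<bar>a * b\<bar> \<le> a\<^sup>2 + b\<^sup>2" for a b :: real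
    using zero_le_power2[of "a - b"] zero_le_power2[of "a + b"] zero_le_power2[of a] zero_le_power2[of b]
    by (auto simp: power2_eq_square algebra_simps abs_le_iff)
  then show "AE x in M. norm (f x * g x) \<le> norm ((f x)\<^sup>2 + (g x)\<^sup>2)" by simp
qed

lemma square_integrable_lincomb:
  assumes f: "f \<in> square_integrable M" and g: "g \<in> square_integrable M"
  shows "(\<lambda>x. a * f x + b * g x) \<in> square_integrable M"
proof -
  note [measurable] = square_integrableD(1)[OF f] square_integrableD(1)[OF g]
  have "integrable M (\<lambda>x. a\<^sup>2 * (f x)\<^sup>2 + 2 * a * b * (f x * g x) + b\<^sup>2 * (g x)\<^sup>2)"
    using integrable_mult_square_integrable[OF f g] f g by (auto simp: square_integrable_def)
  then have "integrable M (\<lambda>x. (a * f x + b * g x)\<^sup>2)"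
    by (rule Bochner_Integration.integrable_cong[THEN iffD1, rotated 2]) (auto simp: power2_eq_square algebra_simps)
  then show ?thesis by (simp add: square_integrable_def)
qed

lemma square_integrable_diff:
  "f \<in> square_integrable M \<Longrightarrow> g \<in> square_integrable M \<Longrightarrow> (\<lambda>x. f x - g x) \<in> square_integrable M"
  using square_integrable_lincomb[of f M g 1 "-1"] by simp

lemma square_integrable_zero: "(\<lambda>x. 0) \<in> square_integrable M"
  by (simp add: square_integrable_def)

lemma square_integrable_sum:
  assumes "\<And>k. k \<in> I \<Longrightarrow> f k \<in> square_integrable M"
  shows "(\<lambda>x. \<Sum>k\<in>I. a k * f k x) \<in> square_integrable M"
  using assms
proof (induction I rule: infinite_finite_induct)
  case (insert i I)
  then have "(\<lambda>x. a i * f i x + 1 * (\<Sum>k\<in>I. a k * f k x)) \<in> square_integrable M"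
    by (intro square_integrable_lincomb) auto
  then show ?case using insert by simp
qed (simp_all add: square_integrable_zero)

lemma Cauchy_Schwarz_square_integrable:
  assumes f: "f \<in> square_integrable M" and g: "g \<in> square_integrable M"
  shows "(LINT x|M. f x * g x)\<^sup>2 \<le> (LINT x|M. (f x)\<^sup>2) * (LINT x|M. (g x)\<^sup>2)"
proof -
  note [measurable] = square_integrableD(1)[OF f] square_integrableD(1)[OF g]
  note I = integrable_mult_square_integrable[OF f g] square_integrableD(2)[OF f] square_integrableD(2)[OF g]
  define A B C where "A = (LINT x|M. (f x)\<^sup>2)" and "B = (LINT x|M. f x * g x)" and "C = (LINT x|M. (g x)\<^sup>2)"
  have C0: "0 \<le> C" by (simp add: C_def)
  show ?thesis
  proof (cases "C = 0")
    case True
    then have "AE x in M. (g x)\<^sup>2 = 0" using integral_nonneg_eq_0_iff_AE[OF I(3)] by (simp add: C_def)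
    then have "(LINT x|M. f x * g x) = 0" by (intro integral_eq_zero_AE) (auto elim: eventually_mono)
    then show ?thesis using True by (simp add: C_def)
  next
    case False
    then have C: "0 < C" using C0 by simp
    have "0 \<le> (LINT x|M. (C * f x - B * g x)\<^sup>2)" by simp
    also have "\<dots> = (LINT x|M. C\<^sup>2 * (f x)\<^sup>2 - 2 * C * B * (f x * g x) + B\<^sup>2 * (g x)\<^sup>2)"
      by (intro Bochner_Integration.integral_cong) (auto simp: power2_eq_square algebra_simps)
    also have "\<dots> = C\<^sup>2 * A - 2 * C * B * B + B\<^sup>2 * C" using I by (simp add: A_def B_def C_def)
    also have "\<dots> = C * (A * C - B\<^sup>2)" by (simp add: power2_eq_square algebra_simps)
    finally have "0 \<le> A * C - B\<^sup>2" using C by (simp add: zero_le_mult_iff)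
    then show ?thesis by (simp add: A_def B_def C_def)
  qed
qed

text \<open>Finiteness of the measure makes square-integrable functions integrable, which gives the almost
everywhere convergence in the Riesz--Fischer theorem.\<close>

locale orthonormal_basis = finite_measure M for M :: "'a measure" +
  fixes e :: "nat \<Rightarrow> 'a \<Rightarrow> real"
  assumes e: "e k \<in> square_integrable M"
    and orthonormal: "(LINT x|M. e j x * e k x) = (if j = k then 1 else 0)"
    and complete: "f \<in> square_integrable M \<Longrightarrow> (\<forall>k. (LINT x|M. f x * e k x) = 0) \<Longrightarrow> AE x in M. f x = 0"
begin

abbreviation coef :: "('a \<Rightarrow> real) \<Rightarrow> nat \<Rightarrow> real" where "coef f k \<equiv> (LINT x|M. f x * e k x)"

definition series :: "(nat \<Rightarrow> real) \<Rightarrow> nat \<Rightarrow> 'a \<Rightarrow> real" where "series a n x = (\<Sum>k<n. a k * e k x)"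

lemma series_square_integrable: "series a n \<in> square_integrable M"
  unfolding series_def[abs_def] by (rule square_integrable_sum[OF e])

lemma inner_series:
  assumes "f \<in> square_integrable M"
  shows "(LINT x|M. f x * series a n x) = (\<Sum>k<n. a k * coef f k)"
proof -
  have "(LINT x|M. f x * series a n x) = (LINT x|M. (\<Sum>k<n. a k * (f x * e k x)))"
    by (simp add: series_def sum_distrib_left mult_ac)
  also have "\<dots> = (\<Sum>k<n. a k * coef f k)"
    using integrable_mult_square_integrable[OF assms e] by simp
  finally show ?thesis .
qed

lemma coef_series: "coef (series a n) j = (if j < n then a j else 0)"
proof -
  have "coef (series a n) j = (LINT x|M. e j x * series a n x)" by (simp add: mult.commute)
  also have "\<dots> = (\<Sum>k<n. a k * (if j = k then 1 else 0))" by (simp add: inner_series[OF e] orthonormal)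
  finally show ?thesis by (simp add: if_distrib cong: if_cong)
qed

lemma integral_square_series_diff:
  assumes "m \<le> n"
  shows "(LINT x|M. (series a n x - series a m x)\<^sup>2) = (\<Sum>k=m..<n. (a k)\<^sup>2)"
proof -
  have "series a n x - series a m x = series (\<lambda>k. if m \<le> k then a k else 0) n x" for x
  proof -
    have "series a n x = series a m x + (\<Sum>k=m..<n. a k * e k x)"
      unfolding series_def using assms by (metis atLeast0LessThan sum.atLeastLessThan_concat zero_le)
    moreover have "(\<Sum>k<n. (if m \<le> k then a k else 0) * e k x) = (\<Sum>k=m..<n. a k * e k x)"
      by (rule sum.mono_neutral_cong_right) auto
    ultimately show ?thesis by (simp add: series_def)
  qed
  then have "(LINT x|M. (series a n x - series a m x)\<^sup>2)
     = (LINT x|M. series (\<lambda>k. if m \<le> k then a k else 0) n x * series (\<lambda>k. if m \<le> k then a k else 0) n x)"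
    by (simp add: power2_eq_square)
  also have "\<dots> = (\<Sum>k<n. (if m \<le> k then a k else 0) * (if m \<le> k then a k else 0))"
    by (simp add: inner_series[OF series_square_integrable] coef_series)
  also have "\<dots> = (\<Sum>k=m..<n. (a k)\<^sup>2)"
    by (rule sum.mono_neutral_cong_right) (auto simp: power2_eq_square)
  finally show ?thesis .
qed

lemma Bessel:
  assumes f: "f \<in> square_integrable M"
  shows "(\<Sum>k<n. (coef f k)\<^sup>2) \<le> (LINT x|M. (f x)\<^sup>2)"
proof -
  let ?s = "series (coef f) n"
  note I = integrable_mult_square_integrable[OF f series_square_integrable, of "coef f" n]
    square_integrableD(2)[OF f] square_integrableD(2)[OF series_square_integrable, of "coef f" n]
  have "0 \<le> (LINT x|M. (f x - ?s x)\<^sup>2)" by simp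
  also have "\<dots> = (LINT x|M. (f x)\<^sup>2 - 2 * (f x * ?s x) + (?s x)\<^sup>2)"
    by (intro Bochner_Integration.integral_cong) (auto simp: power2_eq_square algebra_simps)
  also have "\<dots> = (LINT x|M. (f x)\<^sup>2) - 2 * (LINT x|M. f x * ?s x) + (LINT x|M. (?s x)\<^sup>2)" using I by simp
  also have "(LINT x|M. (?s x)\<^sup>2) = (\<Sum>k<n. (coef f k)\<^sup>2)"
    using integral_square_series_diff[of 0 n "coef f"] by (simp add: series_def atLeast0LessThan)
  also have "(LINT x|M. f x * ?s x) = (\<Sum>k<n. (coef f k)\<^sup>2)"
    by (simp add: inner_series[OF f] power2_eq_square)
  finally show ?thesis by simp
qed

lemma coef_of_limit:
  assumes g: "g \<in> square_integrable M" and lim: "(\<lambda>n. LINT x|M. (g x - series a n x)\<^sup>2) \<longlonglongrightarrow> 0"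
  shows "coef g j = a j"
proof -
  have "(\<lambda>n. (coef g j - a j)\<^sup>2) \<longlonglongrightarrow> 0"
  proof (rule tendsto_sandwich[OF _ _ tendsto_const lim])
    show "\<forall>\<^sub>F n in sequentially. (coef g j - a j)\<^sup>2 \<le> (LINT x|M. (g x - series a n x)\<^sup>2)"
      using eventually_gt_at_top[of j]
    proof eventually_elim
      case (elim n)
      have d: "(\<lambda>x. g x - series a n x) \<in> square_integrable M"
        by (rule square_integrable_diff[OF g series_square_integrable])
      have "coef g j - a j = coef g j - coef (series a n) j" using elim by (simp add: coef_series)
      also have "\<dots> = (LINT x|M. (g x - series a n x) * e j x)"
        using integrable_mult_square_integrable[OF g e] integrable_mult_square_integrable[OF series_square_integrable e]
        by (simp add: left_diff_distrib)
      finally show ?case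
        using Cauchy_Schwarz_square_integrable[OF d e, of j] orthonormal[of j j] by (simp add: power2_eq_square)
    qed
  qed simp
  then show ?thesis by (simp add: LIMSEQ_const_iff)
qed

text \<open>A subsequence of the partial sums has increments that are summable in mean, so it converges almost
everywhere; Fatou's lemma identifies the pointwise limit as the limit in mean square of the whole
sequence.\<close>

lemma Riesz_Fischer:
  assumes sm: "summable (\<lambda>k. (a k)\<^sup>2)"
  shows "\<exists>g\<in>square_integrable M. (\<lambda>n. LINT x|M. (g x - series a n x)\<^sup>2) \<longlonglongrightarrow> 0"
proof -
  note [measurable] = square_integrableD(1)[OF series_square_integrable]
  define tl where "tl n = (\<Sum>k. (a k)\<^sup>2) - (\<Sum>k<n. (a k)\<^sup>2)" for n
  have tl0: "tl \<longlonglongrightarrow> 0"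
    unfolding tl_def using tendsto_diff[OF tendsto_const summable_LIMSEQ[OF sm], of "\<Sum>k. (a k)\<^sup>2"] by simp
  have diff: "(LINT x|M. (series a n x - series a m x)\<^sup>2) \<le> tl m" if "m \<le> n" for m n
  proof -
    have "(\<Sum>k<n. (a k)\<^sup>2) = (\<Sum>k<m. (a k)\<^sup>2) + (\<Sum>k=m..<n. (a k)\<^sup>2)"
      using that by (metis atLeast0LessThan sum.atLeastLessThan_concat zero_le)
    moreover have "(\<Sum>k<n. (a k)\<^sup>2) \<le> (\<Sum>k. (a k)\<^sup>2)" using sm by (intro sum_le_suminf) auto
    ultimately show ?thesis using integral_square_series_diff[OF that] by (simp add: tl_def)
  qed
  have "\<exists>N. \<forall>n\<ge>N. tl n \<le> (1/4)^i" for i :: nat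
  proof -
    have "\<forall>\<^sub>F n in sequentially. tl n < (1/4)^i" by (rule order_tendstoD(2)[OF tl0]) simp
    then have "\<forall>\<^sub>F n in sequentially. tl n \<le> (1/4)^i" by (rule eventually_mono) simp
    then show ?thesis by (simp add: eventually_sequentially)
  qed
  then obtain N where N: "\<And>i n. N i \<le> n \<Longrightarrow> tl n \<le> (1/4)^i" by metis
  \<comment> \<open>An increasing sequence that dominates both \<open>i\<close> and \<open>N i\<close>.\<close>
  define r where "r i = i + (\<Sum>j\<le>i. N j)" for i
  have r: "i \<le> r i" "N i \<le> r i" "r i \<le> r (Suc i)" for i
  proof -
    have "N i \<le> (\<Sum>j\<le>i. N j)" by (intro member_le_sum) auto
    then show "i \<le> r i" "N i \<le> r i" "r i \<le> r (Suc i)" by (auto simp: r_def)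
  qed
  define d where "d i x = \<bar>series a (r (Suc i)) x - series a (r i) x\<bar>" for i x
  have [measurable]: "d i \<in> borel_measurable M" for i unfolding d_def by measurable
  have sq1: "(\<lambda>x. 1) \<in> square_integrable M" by (simp add: square_integrable_def)
  have dsq: "d i \<in> square_integrable M" for i
    using square_integrableD(2)[OF square_integrable_diff[OF series_square_integrable series_square_integrable]]
    by (simp add: square_integrable_def) (simp add: d_def)
  have dint: "integrable M (d i)" for i using integrable_mult_square_integrable[OF dsq sq1] by simp
  define K where "K = sqrt (measure M (space M))"
  have dle: "(LINT x|M. d i x) \<le> K * (1/2)^i" for i
  proof (rule power2_le_imp_le)
    have "(LINT x|M. d i x)\<^sup>2 \<le> (LINT x|M. (d i x)\<^sup>2) * measure M (space M)"
      using Cauchy_Schwarz_square_integrable[OF dsq sq1, of i] by simp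
    also have "\<dots> \<le> (1/4)^i * measure M (space M)"
      using order_trans[OF diff[OF r(3)] N[OF r(2)]] by (intro mult_right_mono) (auto simp: d_def)
    also have "\<dots> = (K * (1/2)^i)\<^sup>2"
    proof -
      have "((1/2::real)^i)\<^sup>2 = ((1/2)\<^sup>2)^i" by (simp only: power_mult[symmetric] mult.commute)
      then have "((1/2::real)^i)\<^sup>2 = (1/4)^i" by (simp add: power2_eq_square)
      then show ?thesis by (simp only: K_def power_mult_distrib) simp
    qed
    finally show "(LINT x|M. d i x)\<^sup>2 \<le> (K * (1/2)^i)\<^sup>2" .
  qed (simp add: K_def)
  have "(\<integral>\<^sup>+x. (\<Sum>i. ennreal (d i x)) \<partial>M) = (\<Sum>i. \<integral>\<^sup>+x. ennreal (d i x) \<partial>M)"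
    by (rule nn_integral_suminf) measurable
  also have "\<dots> = (\<Sum>i. ennreal (LINT x|M. d i x))"
    by (intro suminf_cong nn_integral_eq_integral dint) (simp add: d_def)
  also have "\<dots> \<le> (\<Sum>i. ennreal (K * (1/2)^i))" by (intro suminf_le ennreal_leI dle) auto
  also have "\<dots> = ennreal (\<Sum>i. K * (1/2)^i)"
    by (intro suminf_ennreal2 summable_mult summable_geometric) (simp_all add: K_def)
  also have "\<dots> < top" by simp
  finally have "AE x in M. (\<Sum>i. ennreal (d i x)) \<noteq> \<infinity>" by (intro nn_integral_PInf_AE) auto
  then have cv: "AE x in M. (\<lambda>i. series a (r i) x) \<longlonglongrightarrow> lim (\<lambda>i. series a (r i) x)"
  proof eventually_elim
    case (elim x)
    then have "summable (\<lambda>i. d i x)" by (intro summable_suminf_not_top) (auto simp: d_def)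
    then have "summable (\<lambda>i. series a (r (Suc i)) x - series a (r i) x)"
      unfolding d_def by (rule summable_rabs_cancel)
    then have "convergent (\<lambda>n. (\<Sum>i<n. series a (r (Suc i)) x - series a (r i) x))" by (simp add: summable_iff_convergent)
    moreover have "(\<Sum>i<n. series a (r (Suc i)) x - series a (r i) x) = series a (r n) x - series a (r 0) x" for n
      by (rule sum_lessThan_telescope)
    ultimately have "convergent (\<lambda>n. series a (r n) x - series a (r 0) x)" by (simp only:)
    then have "convergent (\<lambda>n. series a (r n) x)" by (simp add: convergent_diff_const_right_iff)
    then show ?case by (simp add: convergent_LIMSEQ_iff)
  qed
  define g where "g x = lim (\<lambda>i. series a (r i) x)" for x
  have [measurable]: "g \<in> borel_measurable M" unfolding g_def by (rule borel_measurable_lim_metric) measurable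
  have nn: "(\<integral>\<^sup>+x. ennreal ((g x - series a n x)\<^sup>2) \<partial>M) \<le> ennreal (tl n)" for n
  proof -
    have "(\<integral>\<^sup>+x. ennreal ((g x - series a n x)\<^sup>2) \<partial>M)
       = (\<integral>\<^sup>+x. liminf (\<lambda>i. ennreal ((series a (r i) x - series a n x)\<^sup>2)) \<partial>M)"
    proof (rule nn_integral_cong_AE, use cv in eventually_elim)
      case (elim x)
      have "(\<lambda>i. ennreal ((series a (r i) x - series a n x)\<^sup>2)) \<longlonglongrightarrow> ennreal ((g x - series a n x)\<^sup>2)"
        unfolding g_def by (intro tendsto_intros elim)
      then show ?case by (rule lim_imp_Liminf[symmetric, rotated]) simp
    qed
    also have "\<dots> \<le> liminf (\<lambda>i. \<integral>\<^sup>+x. ennreal ((series a (r i) x - series a n x)\<^sup>2) \<partial>M)"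
      by (rule nn_integral_liminf) measurable
    also have "\<dots> \<le> ennreal (tl n)"
    proof (rule Liminf_le)
      show "\<forall>\<^sub>F i in sequentially. (\<integral>\<^sup>+x. ennreal ((series a (r i) x - series a n x)\<^sup>2) \<partial>M) \<le> ennreal (tl n)"
        using eventually_ge_at_top[of n]
      proof eventually_elim
        case (elim i)
        have "(\<integral>\<^sup>+x. ennreal ((series a (r i) x - series a n x)\<^sup>2) \<partial>M) = ennreal (LINT x|M. (series a (r i) x - series a n x)\<^sup>2)"
          by (intro nn_integral_eq_integral square_integrableD(2) square_integrable_diff series_square_integrable) auto
        then show ?case using diff[of n "r i"] elim r(1)[of i] by (auto intro: ennreal_leI)
      qed
    qed simp
    finally show ?thesis .
  qed
  have gi: "integrable M (\<lambda>x. (g x - series a n x)\<^sup>2)" for n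
    using nn[of n] by (intro integrableI_bounded) (auto intro: le_less_trans)
  have gsq: "g \<in> square_integrable M" using gi[of 0] by (simp add: square_integrable_def series_def)
  moreover have "(\<lambda>n. LINT x|M. (g x - series a n x)\<^sup>2) \<longlonglongrightarrow> 0"
  proof (rule tendsto_sandwich[OF _ _ tendsto_const tl0])
    have t0: "0 \<le> tl n" for n using diff[of n n] by simp
    have "(LINT x|M. (g x - series a n x)\<^sup>2) \<le> tl n" for n
    proof -
      have "ennreal (LINT x|M. (g x - series a n x)\<^sup>2) \<le> ennreal (tl n)"
        using nn[of n] by (subst nn_integral_eq_integral[symmetric]) (auto simp: gi)
      then show ?thesis using t0[of n] by (simp add: ennreal_le_iff)
    qed
    then show "\<forall>\<^sub>F n in sequentially. (LINT x|M. (g x - series a n x)\<^sup>2) \<le> tl n" by simp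
  qed simp
  ultimately show ?thesis by blast
qed

lemma coef_inject:
  assumes f: "f \<in> square_integrable M" and g: "g \<in> square_integrable M" and eq: "\<And>k. coef f k = coef g k"
  shows "AE x in M. f x = g x"
proof -
  have "AE x in M. f x - g x = 0"
  proof (rule complete[OF square_integrable_diff[OF f g]], rule allI)
    fix k show "(LINT x|M. (f x - g x) * e k x) = 0"
      using integrable_mult_square_integrable[OF f e] integrable_mult_square_integrable[OF g e] eq[of k]
      by (simp add: left_diff_distrib)
  qed
  then show ?thesis by eventually_elim simp
qed

lemma summable_coef: "f \<in> square_integrable M \<Longrightarrow> summable (\<lambda>k. (coef f k)\<^sup>2)"
  using Bessel by (intro summableI_nonneg_bounded[where x="LINT x|M. (f x)\<^sup>2"]) auto

lemma series_coef_tendsto: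
  assumes f: "f \<in> square_integrable M"
  shows "(\<lambda>n. LINT x|M. (f x - series (coef f) n x)\<^sup>2) \<longlonglongrightarrow> 0"
proof -
  obtain g where g: "g \<in> square_integrable M" "(\<lambda>n. LINT x|M. (g x - series (coef f) n x)\<^sup>2) \<longlonglongrightarrow> 0"
    using Riesz_Fischer[OF summable_coef[OF f]] by auto
  note [measurable] = square_integrableD(1)[OF f] square_integrableD(1)[OF g(1)] square_integrableD(1)[OF series_square_integrable]
  have "AE x in M. f x = g x" using coef_of_limit[OF g] by (intro coef_inject f g(1)) simp
  then have "(LINT x|M. (f x - series (coef f) n x)\<^sup>2) = (LINT x|M. (g x - series (coef f) n x)\<^sup>2)" for n
    by (intro integral_cong_AE) auto
  then show ?thesis using g(2) by simp
qed

text \<open>By completeness \<open>f\<close> agrees almost everywhere with the Riesz--Fischer limit of its own expansion;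
Cauchy--Schwarz transfers the convergence to inner products with \<open>g\<close>.\<close>

lemma Parseval:
  assumes f: "f \<in> square_integrable M" and g: "g \<in> square_integrable M"
  shows "(\<lambda>k. coef g k * coef f k) sums (LINT x|M. g x * f x)"
proof -
  have "(\<lambda>n. (LINT x|M. (f x - series (coef f) n x)\<^sup>2) * (LINT x|M. (g x)\<^sup>2)) \<longlonglongrightarrow> 0 * (LINT x|M. (g x)\<^sup>2)"
    by (intro tendsto_mult series_coef_tendsto f tendsto_const)
  then have lim: "(\<lambda>n. (LINT x|M. (f x - series (coef f) n x)\<^sup>2) * (LINT x|M. (g x)\<^sup>2)) \<longlonglongrightarrow> 0" by simp
  have "(\<lambda>n. ((\<Sum>k<n. coef g k * coef f k) - (LINT x|M. g x * f x))\<^sup>2) \<longlonglongrightarrow> 0"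
  proof (rule tendsto_sandwich[OF _ _ tendsto_const lim])
    have "((\<Sum>k<n. coef g k * coef f k) - (LINT x|M. g x * f x))\<^sup>2 \<le>
      (LINT x|M. (f x - series (coef f) n x)\<^sup>2) * (LINT x|M. (g x)\<^sup>2)" for n
    proof -
      have d: "(\<lambda>x. f x - series (coef f) n x) \<in> square_integrable M"
        by (rule square_integrable_diff[OF f series_square_integrable])
      have "(LINT x|M. (f x - series (coef f) n x) * g x) = (LINT x|M. g x * f x - g x * series (coef f) n x)"
        by (simp add: algebra_simps)
      also have "\<dots> = (LINT x|M. g x * f x) - (LINT x|M. g x * series (coef f) n x)"
        by (intro Bochner_Integration.integral_diff integrable_mult_square_integrable f g series_square_integrable)
      also have "\<dots> = (LINT x|M. g x * f x) - (\<Sum>k<n. coef g k * coef f k)"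
        by (simp add: inner_series[OF g] mult.commute)
      finally show ?thesis using Cauchy_Schwarz_square_integrable[OF d g] by (simp add: power2_commute)
    qed
    then show "\<forall>\<^sub>F n in sequentially. ((\<Sum>k<n. coef g k * coef f k) - (LINT x|M. g x * f x))\<^sup>2 \<le>
      (LINT x|M. (f x - series (coef f) n x)\<^sup>2) * (LINT x|M. (g x)\<^sup>2)" by simp
  qed simp
  then have "(\<lambda>n. (\<Sum>k<n. coef g k * coef f k) - (LINT x|M. g x * f x)) \<longlonglongrightarrow> 0" by simp
  then show ?thesis unfolding sums_def by (rule LIM_zero_cancel)
qed

end

lemma L2_eq: "L2 L = square_integrable (lebesgue_on {0<..<L})"
  by (simp add: L2_def square_integrable_def)

lemma finite_measure_lebesgue_on_Ioo: "finite_measure (lebesgue_on {a<..<b::real})"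
  by (rule finite_measure_lebesgue_on) (simp add: lmeasurable_interval)

lemma orthonormal_basis_of_L2:
  assumes "orthonormal_basis_L2 L e"
  shows "orthonormal_basis (lebesgue_on {0<..<L}) e"
proof -
  interpret finite_measure "lebesgue_on {0<..<L}" by (rule finite_measure_lebesgue_on_Ioo)
  show ?thesis
    by standard (use assms in \<open>auto simp: orthonormal_basis_L2_def L2_inner_def L2_eq\<close>)
qed

context
  fixes L :: real and e :: "nat \<Rightarrow> real \<Rightarrow> real"
  assumes onb: "orthonormal_basis_L2 L e"
begin

interpretation orthonormal_basis "lebesgue_on {0<..<L}" e
  by (rule orthonormal_basis_of_L2[OF onb])

text \<open>The summability is exactly what makes the choice in \<open>diag_op\<close> succeed. It holds for every
\<open>f\<close> in the span of finitely many basis functions, whatever the multipliers.\<close>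

lemma diag_op_coef:
  assumes f: "f \<in> L2 L" and sm: "summable (\<lambda>k. (c k * L2_inner L f (e k))\<^sup>2)"
  shows "diag_op L e c f \<in> L2 L" "L2_inner L (diag_op L e c f) (e k) = c k * L2_inner L f (e k)"
proof -
  let ?a = "\<lambda>k. c k * L2_inner L f (e k)"
  have ex: "\<exists>g. g \<in> L2 L \<and> (\<lambda>n. LINT x|lebesgue_on {0<..<L}. (g x - (\<Sum>k<n. c k * L2_inner L f (e k) * e k x))\<^sup>2) \<longlonglongrightarrow> 0"
    using Riesz_Fischer[OF sm] unfolding L2_eq series_def by blast
  have 1: "diag_op L e c f \<in> L2 L \<and> (\<lambda>n. LINT x|lebesgue_on {0<..<L}. (diag_op L e c f x - series ?a n x)\<^sup>2) \<longlonglongrightarrow> 0"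
    unfolding diag_op_def series_def by (rule someI_ex[OF ex])
  then show "diag_op L e c f \<in> L2 L" by simp
  show "L2_inner L (diag_op L e c f) (e k) = c k * L2_inner L f (e k)"
    using 1 coef_of_limit[of "diag_op L e c f" ?a k] unfolding L2_inner_def L2_eq by auto
qed

lemma diag_op_coef_bounded:
  assumes c: "\<And>k. (c k)\<^sup>2 \<le> K" and f: "f \<in> L2 L"
  shows "diag_op L e c f \<in> L2 L" "L2_inner L (diag_op L e c f) (e k) = c k * L2_inner L f (e k)"
proof -
  have "summable (\<lambda>k. (c k * L2_inner L f (e k))\<^sup>2)"
  proof (rule summable_comparison_test'[where N=0])
    show "summable (\<lambda>k. K * (L2_inner L f (e k))\<^sup>2)"
      using summable_coef[of f] f unfolding L2_eq L2_inner_def by (intro summable_mult) auto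
    show "norm ((c k * L2_inner L f (e k))\<^sup>2) \<le> K * (L2_inner L f (e k))\<^sup>2" for k
      using c[of k] by (simp add: power_mult_distrib mult_right_mono)
  qed
  from diag_op_coef[OF f this] show "diag_op L e c f \<in> L2 L" "L2_inner L (diag_op L e c f) (e k) = c k * L2_inner L f (e k)"
    by auto
qed

text \<open>The range of an injective diagonal operator, and the norm transported to it, in terms of
coefficients: \<open>R g = h\<close> forces the coefficients of \<open>g\<close>, and Riesz--Fischer provides \<open>g\<close> when they are
square summable.\<close>

lemma cameron_martin_iff:
  assumes c: "\<And>k. (c k)\<^sup>2 \<le> K" "\<And>k. 0 < c k" and h: "h \<in> L2 L"
  shows "h \<in> cameron_martin L (diag_op L e c) \<longleftrightarrow> summable (\<lambda>k. (L2_inner L h (e k) / c k)\<^sup>2)"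
    and "h \<in> cameron_martin L (diag_op L e c) \<Longrightarrow>
      (cm_norm L (diag_op L e c) h)\<^sup>2 = (\<Sum>k. (L2_inner L h (e k) / c k)\<^sup>2)"
proof -
  note dc = diag_op_coef_bounded[where c=c, OF c(1)]
  have coef: "L2_inner L g (e k) = L2_inner L h (e k) / c k"
    if g: "g \<in> L2 L" and ae: "AE x in lebesgue_on {0<..<L}. diag_op L e c g x = h x" for g k
  proof -
    note [measurable] = square_integrableD(1)[OF e] h[unfolded L2_eq, THEN square_integrableD(1)]
      dc(1)[OF g, unfolded L2_eq, THEN square_integrableD(1)]
    have "c k * L2_inner L g (e k) = L2_inner L (diag_op L e c g) (e k)"
      by (rule dc(2)[OF g, symmetric])
    also have "\<dots> = L2_inner L h (e k)" unfolding L2_inner_def using ae by (intro integral_cong_AE) auto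
    finally show ?thesis using c(2)[of k] by (simp add: field_simps)
  qed
  have par: "(\<lambda>k. (L2_inner L g (e k))\<^sup>2) sums L2_inner L g g" if "g \<in> L2 L" for g
    using Parseval[of g g] that by (simp add: L2_eq L2_inner_def power2_eq_square)
  show "h \<in> cameron_martin L (diag_op L e c) \<longleftrightarrow> summable (\<lambda>k. (L2_inner L h (e k) / c k)\<^sup>2)"
  proof
    assume "h \<in> cameron_martin L (diag_op L e c)"
    then obtain g where g: "g \<in> L2 L" "AE x in lebesgue_on {0<..<L}. diag_op L e c g x = h x"
      by (auto simp: cameron_martin_def)
    show "summable (\<lambda>k. (L2_inner L h (e k) / c k)\<^sup>2)"
      using par[OF g(1)] coef[OF g] by (simp add: sums_iff)
  next
    assume sm: "summable (\<lambda>k. (L2_inner L h (e k) / c k)\<^sup>2)"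
    obtain g where g: "g \<in> square_integrable (lebesgue_on {0<..<L})"
      "(\<lambda>n. LINT x|lebesgue_on {0<..<L}. (g x - series (\<lambda>k. L2_inner L h (e k) / c k) n x)\<^sup>2) \<longlonglongrightarrow> 0"
      using Riesz_Fischer[OF sm] by auto
    have g2: "g \<in> L2 L" using g by (simp add: L2_eq)
    have gc: "L2_inner L g (e k) = L2_inner L h (e k) / c k" for k using coef_of_limit[OF g] by (simp add: L2_inner_def)
    have "AE x in lebesgue_on {0<..<L}. diag_op L e c g x = h x"
    proof (rule coef_inject)
      show "diag_op L e c g \<in> square_integrable (lebesgue_on {0<..<L})" "h \<in> square_integrable (lebesgue_on {0<..<L})"
        using dc(1)[OF g2] h by (auto simp: L2_eq)
      show "coef (diag_op L e c g) k = coef h k" for k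
        using dc(2)[OF g2, of k] gc[of k] c(2)[of k] by (simp add: L2_inner_def)
    qed
    then show "h \<in> cameron_martin L (diag_op L e c)" using g2 by (auto simp: cameron_martin_def)
  qed
  assume "h \<in> cameron_martin L (diag_op L e c)"
  then have ex: "\<exists>g. g \<in> L2 L \<and> (AE x in lebesgue_on {0<..<L}. diag_op L e c g x = h x)"
    by (auto simp: cameron_martin_def)
  let ?g = "op_inverse L (diag_op L e c) h"
  have g: "?g \<in> L2 L" "AE x in lebesgue_on {0<..<L}. diag_op L e c ?g x = h x"
    using someI_ex[OF ex] by (auto simp: op_inverse_def)
  have "(cm_norm L (diag_op L e c) h)\<^sup>2 = L2_inner L ?g ?g"
    by (simp add: cm_norm_def cm_inner_def L2_inner_def)
  also have "\<dots> = (\<Sum>k. (L2_inner L h (e k) / c k)\<^sup>2)"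
    using par[OF g(1)] coef[OF g] by (simp add: sums_iff)
  finally show "(cm_norm L (diag_op L e c) h)\<^sup>2 = (\<Sum>k. (L2_inner L h (e k) / c k)\<^sup>2)" .
qed

end

section \<open>Small balls and Onsager--Machlup minimisers\<close>

text \<open>The function \<open>I\<close> plays the role of half the squared Cameron--Martin norm: when the centre of a ball is
moved from \<open>u0\<close> to \<open>h\<close>, the mass shrinks by the factor \<open>exp (- I h)\<close> at worst.\<close>

locale rate_function_base = prob_space \<mu> for \<mu> :: "'a measure" +
  fixes X :: "'a metric" and u0 :: 'a and I :: "'a \<Rightarrow> ereal"
  assumes sets_\<mu>: "sets \<mu> = sets (sigma (mspace X) {V. openin (mtopology_of X) V})"
    and complete: "mcomplete_of X"
    and u0: "u0 \<in> mspace X" "I u0 = 0"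
    and I_nonneg: "\<And>u. 0 \<le> I u"
    and lower: "\<And>h r \<delta>. h \<in> mspace X \<Longrightarrow> I h = ereal r \<Longrightarrow> 0 < \<delta> \<Longrightarrow>
      exp (- r) * measure \<mu> (mball_of X u0 \<delta>) \<le> measure \<mu> (mball_of X h \<delta>)"
    and ball_pos: "\<And>\<delta>. 0 < \<delta> \<Longrightarrow> 0 < measure \<mu> (mball_of X u0 \<delta>)"
    and lsc: "\<And>v u R. (\<And>n::nat. v n \<in> mspace X) \<Longrightarrow> u \<in> mspace X \<Longrightarrow> (\<lambda>n. mdist X (v n) u) \<longlonglongrightarrow> 0 \<Longrightarrow>
      (\<And>n. I (v n) \<le> ereal R) \<Longrightarrow> I u \<le> ereal R"
begin

interpretation X: Metric_space "mspace X" "mdist X"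
  by (rule Metric_space_mspace_mdist)

lemma mball_of_eq: "mball_of X u \<delta> = X.mball u \<delta>"
  by (simp add: mball_of_def)

lemma mtopology_of_eq: "mtopology_of X = X.mtopology"
  by (simp add: mtopology_of_def)

lemma space_\<mu>: "space \<mu> = mspace X"
proof -
  have "{V. openin (mtopology_of X) V} \<subseteq> Pow (mspace X)"
    using openin_subset[of "mtopology_of X"] by auto
  then show ?thesis using sets_eq_imp_space_eq[OF sets_\<mu>] by (simp add: space_measure_of)
qed

lemma sets_open: "openin (mtopology_of X) V \<Longrightarrow> V \<in> sets \<mu>"
  unfolding sets_\<mu> using openin_subset[of "mtopology_of X"] by (subst sets_measure_of) (auto intro: sigma_sets.Basic)

lemma sets_ball[measurable]: "mball_of X u \<delta> \<in> sets \<mu>"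
  by (rule sets_open) (simp add: mball_of_eq mtopology_of_eq)

lemma sublevel_separated_card:
  assumes K: "finite K" "K \<subseteq> {v\<in>mspace X. I v \<le> ereal R}" and \<epsilon>: "0 < \<epsilon>"
    and sep: "\<And>x y. x \<in> K \<Longrightarrow> y \<in> K \<Longrightarrow> x \<noteq> y \<Longrightarrow> \<epsilon> \<le> mdist X x y"
  shows "real (card K) * (exp (- R) * measure \<mu> (mball_of X u0 (\<epsilon> / 2))) \<le> 1"
proof -
  have disj: "disjoint_family_on (\<lambda>x. mball_of X x (\<epsilon> / 2)) K"
    unfolding disjoint_family_on_def
  proof (intro ballI impI)
    fix x y assume xy: "x \<in> K" "y \<in> K" "x \<noteq> y"
    show "mball_of X x (\<epsilon> / 2) \<inter> mball_of X y (\<epsilon> / 2) = {}"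
    proof (rule ccontr)
      assume "\<not> ?thesis"
      then obtain z where z: "z \<in> mball_of X x (\<epsilon> / 2)" "z \<in> mball_of X y (\<epsilon> / 2)" by blast
      then have "mdist X x y < \<epsilon>"
        using X.triangle[of x z y] X.commute[of z y] by simp
      then show False using sep[OF xy] by simp
    qed
  qed
  have "real (card K) * (exp (- R) * measure \<mu> (mball_of X u0 (\<epsilon> / 2))) = (\<Sum>x\<in>K. exp (- R) * measure \<mu> (mball_of X u0 (\<epsilon> / 2)))"
    by simp
  also have "\<dots> \<le> (\<Sum>x\<in>K. measure \<mu> (mball_of X x (\<epsilon> / 2)))"
  proof (rule sum_mono)
    fix x assume "x \<in> K"
    then have x: "x \<in> mspace X" "I x \<le> ereal R" using K by auto
    then obtain r where r: "I x = ereal r" using I_nonneg[of x] by (cases "I x") auto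
    have "exp (- R) * measure \<mu> (mball_of X u0 (\<epsilon> / 2)) \<le> exp (- r) * measure \<mu> (mball_of X u0 (\<epsilon> / 2))"
      using x r by (intro mult_right_mono) auto
    also have "\<dots> \<le> measure \<mu> (mball_of X x (\<epsilon> / 2))" using \<epsilon> by (intro lower x r) auto
    finally show "exp (- R) * measure \<mu> (mball_of X u0 (\<epsilon> / 2)) \<le> measure \<mu> (mball_of X x (\<epsilon> / 2))" .
  qed
  also have "\<dots> = measure \<mu> (\<Union>x\<in>K. mball_of X x (\<epsilon> / 2))"
    using K disj by (intro finite_measure_finite_Union[symmetric]) auto
  also have "\<dots> \<le> 1" by simp
  finally show ?thesis .
qed

text \<open>Balls of radius \<open>\<epsilon> / 2\<close> around \<open>\<epsilon>\<close>-separated points of the sublevel set are disjoint and each has at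
least a fixed positive mass, so there are boundedly many such points. A separated set of maximal
cardinality is an \<open>\<epsilon>\<close>-net.\<close>

lemma sublevel_totally_bounded: "X.mtotally_bounded {v\<in>mspace X. I v \<le> ereal R}"
  unfolding X.mtotally_bounded_def
proof (intro allI impI)
  fix \<epsilon> :: real assume \<epsilon>: "0 < \<epsilon>"
  let ?S = "{v\<in>mspace X. I v \<le> ereal R}"
  let ?P = "\<lambda>K. finite K \<and> K \<subseteq> ?S \<and> (\<forall>x\<in>K. \<forall>y\<in>K. x \<noteq> y \<longrightarrow> \<epsilon> \<le> mdist X x y)"
  let ?c = "exp (- R) * measure \<mu> (mball_of X u0 (\<epsilon> / 2))"
  have c: "0 < ?c" using ball_pos[of "\<epsilon> / 2"] \<epsilon> by simp
  have "card K < Suc (nat \<lceil>1 / ?c\<rceil>)" if "?P K" for K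
  proof -
    have "real (card K) * ?c \<le> 1" by (rule sublevel_separated_card) (use that \<epsilon> in auto)
    then have "real (card K) \<le> 1 / ?c" by (simp only: pos_le_divide_eq[OF c])
    also have "\<dots> \<le> real (nat \<lceil>1 / ?c\<rceil>)" by (rule real_nat_ceiling_ge)
    finally show ?thesis by (simp only: of_nat_le_iff less_Suc_eq_le)
  qed
  moreover have "?P {}" by simp
  ultimately have "\<exists>K. ?P K \<and> (\<forall>K'. ?P K' \<longrightarrow> card K' \<le> card K)"
    by (intro ex_has_greatest_nat[where P="?P" and f=card and b="Suc (nat \<lceil>1 / ?c\<rceil>)" and k="{}"]) simp_all
  then obtain K where K: "?P K" and max: "\<And>K'. ?P K' \<Longrightarrow> card K' \<le> card K"
    by (elim exE conjE) simp
  have "?S \<subseteq> (\<Union>x\<in>K. X.mball x \<epsilon>)"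
  proof
    fix s assume s: "s \<in> ?S"
    show "s \<in> (\<Union>x\<in>K. X.mball x \<epsilon>)"
    proof (rule ccontr)
      assume n: "s \<notin> (\<Union>x\<in>K. X.mball x \<epsilon>)"
      then have far: "\<epsilon> \<le> mdist X x s" if "x \<in> K" for x using s K that by (auto simp: not_less)
      then have "s \<notin> K" using X.mdist_zero[of s] s \<epsilon> by force
      moreover have "?P (insert s K)"
        using K s far by (auto simp: X.commute)
      ultimately show False using max[of "insert s K"] K by simp
    qed
  qed
  moreover have "finite K" "K \<subseteq> ?S" using K by simp_all
  ultimately show "\<exists>K. finite K \<and> K \<subseteq> ?S \<and> ?S \<subseteq> (\<Union>x\<in>K. X.mball x \<epsilon>)"
    by (intro exI[of _ K] conjI)
qed

lemma sublevel_convergent_subseq: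
  assumes v: "\<And>n::nat. v n \<in> mspace X" "\<And>n. I (v n) \<le> ereal R"
  obtains r u where "strict_mono r" "u \<in> mspace X" "(\<lambda>n. mdist X (v (r n)) u) \<longlonglongrightarrow> 0"
proof -
  obtain r where r: "strict_mono r" "X.MCauchy (v \<circ> r)"
    using sublevel_totally_bounded[of R] v unfolding X.mtotally_bounded_sequentially by blast
  have "X.mcomplete" using complete by (simp add: mcomplete_of_def)
  then obtain u where "limitin X.mtopology (v \<circ> r) u sequentially" using r(2) by (auto simp: X.mcomplete_def)
  then have "u \<in> mspace X" "(\<lambda>n. mdist X (v (r n)) u) \<longlonglongrightarrow> 0"
    by (auto simp: X.limitin_metric_dist_null o_def)
  with r(1) show ?thesis using that by blast
qed

lemma lsc_limit:
  assumes v: "\<And>n::nat. v n \<in> mspace X" and u: "u \<in> mspace X" "(\<lambda>n. mdist X (v n) u) \<longlonglongrightarrow> 0"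
    and le: "\<And>n. I (v n) \<le> ereal (s n)" and s: "s \<longlonglongrightarrow> t"
  shows "I u \<le> ereal t"
proof (rule ereal_le_epsilon2)
  fix \<epsilon> :: real assume "0 < \<epsilon>"
  then have "\<forall>\<^sub>F n in sequentially. s n < t + \<epsilon>" using order_tendstoD(2)[OF s, of "t + \<epsilon>"] by simp
  then obtain N where N: "\<And>n. N \<le> n \<Longrightarrow> s n < t + \<epsilon>" by (auto simp: eventually_sequentially)
  have "I u \<le> ereal (t + \<epsilon>)"
  proof (rule lsc[where v="\<lambda>n. v (n + N)"])
    show "(\<lambda>n. mdist X (v (n + N)) u) \<longlonglongrightarrow> 0" using u(2) by (rule LIMSEQ_ignore_initial_segment)
    show "I (v (n + N)) \<le> ereal (t + \<epsilon>)" for n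
      using le[of "n + N"] N[of "n + N"] by (auto intro: order_trans less_imp_le)
  qed (use v u in auto)
  then show "I u \<le> ereal t + ereal \<epsilon>" by simp
qed

end

text \<open>The matching upper estimate: a ball can only be as heavy as a point of it (or of its boundary) with
small \<open>I\<close> permits.\<close>

locale rate_function_setting = rate_function_base +
  assumes centre_maximal: "\<And>z \<delta>. z \<in> mspace X \<Longrightarrow> 0 < \<delta> \<Longrightarrow>
      measure \<mu> (mball_of X z \<delta>) \<le> measure \<mu> (mball_of X u0 \<delta>)"
    and upper: "\<And>z \<delta> R. z \<in> mspace X \<Longrightarrow> 0 < \<delta> \<Longrightarrow> 0 \<le> R \<Longrightarrow>
      exp (- R) * measure \<mu> (mball_of X u0 \<delta>) < measure \<mu> (mball_of X z \<delta>) \<Longrightarrow>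
      \<exists>v\<in>mspace X. mdist X z v \<le> \<delta> \<and> I v \<le> ereal R"

text \<open>The measure \<open>\<nu>\<close> is a reweighting of \<open>\<mu>\<close>, and \<open>J\<close> the candidate for the negative logarithm of its
density with respect to a fictitious uniform measure.\<close>

locale onsager_machlup_setting = rate_function_setting +
  fixes \<Phi> :: "'a \<Rightarrow> real" and c :: real
  assumes \<Phi>_cont: "continuous_map (mtopology_of X) euclidean \<Phi>"
    and \<Phi>_nonneg: "\<And>u. 0 \<le> \<Phi> u"
    and c: "0 < c"
begin

interpretation X: Metric_space "mspace X" "mdist X"
  by (rule Metric_space_mspace_mdist)

definition \<nu> :: "'a measure" where "\<nu> = density \<mu> (\<lambda>u. ennreal (c * exp (- \<Phi> u)))"

definition J :: "'a \<Rightarrow> ereal" where "J u = ereal (\<Phi> u) + I u"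

lemma \<Phi>_measurable[measurable]: "\<Phi> \<in> borel_measurable \<mu>"
proof (rule borel_measurableI)
  fix S :: "real set" assume "open S"
  then have "openin (mtopology_of X) {x \<in> topspace (mtopology_of X). \<Phi> x \<in> S}"
    using \<Phi>_cont by (auto simp: continuous_map_def)
  moreover have "{x \<in> topspace (mtopology_of X). \<Phi> x \<in> S} = \<Phi> -` S \<inter> space \<mu>"
    by (auto simp: space_\<mu>)
  ultimately show "\<Phi> -` S \<inter> space \<mu> \<in> sets \<mu>" using sets_open by metis
qed

lemma \<Phi>_seq:
  assumes "\<And>n::nat. v n \<in> mspace X" "u \<in> mspace X" "(\<lambda>n. mdist X (v n) u) \<longlonglongrightarrow> 0"
  shows "(\<lambda>n. \<Phi> (v n)) \<longlonglongrightarrow> \<Phi> u"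
proof -
  have "limitin (mtopology_of X) v u sequentially"
    using assms by (simp add: X.limitin_metric_dist_null mtopology_of_def)
  from continuous_map_limit[OF \<Phi>_cont this] show ?thesis by (simp add: o_def)
qed

lemma \<Phi>_near:
  assumes u: "u \<in> mspace X" and \<eta>: "0 < \<eta>"
  obtains d where "0 < d" "\<And>w. w \<in> mball_of X u d \<Longrightarrow> \<Phi> w < \<Phi> u + \<eta>"
proof -
  have "openin (mtopology_of X) {x \<in> topspace (mtopology_of X). \<Phi> x \<in> {..<\<Phi> u + \<eta>}}"
  proof -
    have "openin (mtopology_of X) {x \<in> topspace (mtopology_of X). \<Phi> x \<in> U}" if "open U" for U
      using \<Phi>_cont that by (auto simp: continuous_map_def)
    from this[OF open_lessThan] show ?thesis .
  qed
  then obtain r where "0 < r" "X.mball u r \<subseteq> {x \<in> topspace (mtopology_of X). \<Phi> x \<in> {..<\<Phi> u + \<eta>}}"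
    using u \<eta> unfolding mtopology_of_eq X.openin_mtopology by (auto simp: mtopology_of_eq)
  then show ?thesis by (intro that[of r]) (auto simp: mball_of_eq)
qed

lemma finite_measure_\<nu>: "finite_measure \<nu>"
proof
  have "emeasure \<nu> (space \<nu>) = (\<integral>\<^sup>+u. ennreal (c * exp (- \<Phi> u)) \<partial>\<mu>)"
    by (simp add: \<nu>_def emeasure_density cong: nn_integral_cong)
  also have "\<dots> \<le> (\<integral>\<^sup>+u. ennreal c \<partial>\<mu>)"
    using c \<Phi>_nonneg by (intro nn_integral_mono ennreal_leI) simp
  also have "\<dots> < \<infinity>" by (simp add: emeasure_space_1)
  finally show "emeasure \<nu> (space \<nu>) \<noteq> \<infinity>" by simp
qed

lemma measure_\<nu>_le:
  assumes A[measurable]: "A \<in> sets \<mu>" and a: "\<And>u. u \<in> A \<Longrightarrow> a \<le> \<Phi> u"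
  shows "measure \<nu> A \<le> c * exp (- a) * measure \<mu> A"
proof -
  interpret n: finite_measure \<nu> by (rule finite_measure_\<nu>)
  have "emeasure \<nu> A = (\<integral>\<^sup>+u. ennreal (c * exp (- \<Phi> u)) * indicator A u \<partial>\<mu>)"
    by (simp add: \<nu>_def emeasure_density)
  also have "\<dots> \<le> (\<integral>\<^sup>+u. ennreal (c * exp (- a)) * indicator A u \<partial>\<mu>)"
    using a c by (intro nn_integral_mono) (auto simp: indicator_def intro!: ennreal_leI)
  also have "\<dots> = ennreal (c * exp (- a) * measure \<mu> A)"
    using c by (simp add: nn_integral_cmult emeasure_eq_measure ennreal_mult')
  finally show ?thesis using c by (simp add: n.emeasure_eq_measure ennreal_le_iff)
qed

lemma measure_\<nu>_ge:
  assumes A[measurable]: "A \<in> sets \<mu>" and a: "\<And>u. u \<in> A \<Longrightarrow> \<Phi> u \<le> a"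
  shows "c * exp (- a) * measure \<mu> A \<le> measure \<nu> A"
proof -
  interpret n: finite_measure \<nu> by (rule finite_measure_\<nu>)
  have "ennreal (c * exp (- a) * measure \<mu> A) = (\<integral>\<^sup>+u. ennreal (c * exp (- a)) * indicator A u \<partial>\<mu>)"
    using c by (simp add: nn_integral_cmult emeasure_eq_measure ennreal_mult')
  also have "\<dots> \<le> (\<integral>\<^sup>+u. ennreal (c * exp (- \<Phi> u)) * indicator A u \<partial>\<mu>)"
    using a c by (intro nn_integral_mono) (auto simp: indicator_def intro!: ennreal_leI)
  also have "\<dots> = emeasure \<nu> A" by (simp add: \<nu>_def emeasure_density)
  finally show ?thesis by (simp add: n.emeasure_eq_measure ennreal_le_iff)
qed

text \<open>Since \<open>\<Phi>\<close> is nonnegative, \<open>I\<close> is bounded along a minimising sequence, which therefore has a convergent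
subsequence; \<open>J\<close> is lower semicontinuous.\<close>

lemma minimiser_exists: "\<exists>u. is_arg_min J (\<lambda>v. v \<in> mspace X) u"
proof -
  define m where "m = (INF v\<in>mspace X. J v)"
  have J0: "0 \<le> J u" for u unfolding J_def using \<Phi>_nonneg[of u] I_nonneg[of u] by simp
  have "m \<le> J u0" unfolding m_def using u0 by (intro INF_lower)
  moreover have "0 \<le> m" unfolding m_def using J0 by (intro INF_greatest)
  ultimately obtain m' where m': "m = ereal m'" using u0 by (cases m) (auto simp: J_def)
  have "\<exists>v\<in>mspace X. J v < ereal (m' + 1 / (real n + 1))" for n
  proof -
    have "m < ereal (m' + 1 / (real n + 1))" by (simp add: m')
    then show ?thesis unfolding m_def by (simp add: INF_less_iff)
  qed
  then obtain v where v: "\<And>n. v n \<in> mspace X" "\<And>n. J (v n) < ereal (m' + 1 / (real n + 1))" by metis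
  have Iv: "I (v n) \<le> ereal (m' + 1 / (real n + 1) - \<Phi> (v n))" for n
    using v(2)[of n] unfolding J_def by (cases "I (v n)") auto
  have "I (v n) \<le> ereal (m' + 1)" for n
  proof -
    have "1 / (real n + 1) \<le> 1" by simp
    then have "m' + 1 / (real n + 1) - \<Phi> (v n) \<le> m' + 1" using \<Phi>_nonneg[of "v n"] by linarith
    then have "ereal (m' + 1 / (real n + 1) - \<Phi> (v n)) \<le> ereal (m' + 1)" by simp
    with Iv[of n] show ?thesis by (rule order_trans)
  qed
  then obtain r u where r: "strict_mono r" and u: "u \<in> mspace X" "(\<lambda>n. mdist X (v (r n)) u) \<longlonglongrightarrow> 0"
    using sublevel_convergent_subseq[of v "m' + 1"] v(1) by blast
  have "(\<lambda>n. 1 / (real n + 1)) \<longlonglongrightarrow> 0"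
    using LIMSEQ_inverse_real_of_nat by (simp add: inverse_eq_divide add.commute)
  then have "(\<lambda>n. 1 / (real (r n) + 1)) \<longlonglongrightarrow> 0" using LIMSEQ_subseq_LIMSEQ[OF _ r] by (simp add: o_def)
  then have "(\<lambda>n. m' + 1 / (real (r n) + 1) - \<Phi> (v (r n))) \<longlonglongrightarrow> m' + 0 - \<Phi> u"
    by (intro tendsto_intros \<Phi>_seq u v)
  then have "I u \<le> ereal (m' + 0 - \<Phi> u)"
    by (rule lsc_limit[where v="\<lambda>n. v (r n)", OF v(1) u Iv])
  then have "J u \<le> m" unfolding J_def m' by (cases "I u") auto
  moreover have "m \<le> J w" if "w \<in> mspace X" for w unfolding m_def using that by (rule INF_lower)
  ultimately have "J u \<le> J w" if "w \<in> mspace X" for w using that order_trans by blast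
  then show ?thesis using u by (auto simp: is_arg_min_def not_less)
qed

text \<open>Centres of balls that carry at least a fixed proportion of the reference mass accumulate at a point
\<open>v\<close> whose \<open>J\<close> is as small as the proportion demands. The proportion splits into a factor \<open>\<rho> n\<close> from
the mass of the ball under \<open>\<mu>\<close>, which bounds \<open>I\<close> at a nearby point \<open>v n\<close>, and a factor from the
weight, which bounds \<open>\<Phi>\<close> at a nearby point \<open>w n\<close>. Compactness and semicontinuity bring both bounds
to the common limit.\<close>

lemma concentration_limit:
  assumes \<delta>: "\<And>n::nat. 0 < \<delta> n" "\<delta> \<longlonglongrightarrow> 0" and z: "\<And>n. z n \<in> mspace X" and \<theta>: "0 < \<theta>"
    and ge: "\<And>n. c * \<theta> * measure \<mu> (mball_of X u0 (\<delta> n)) \<le> measure \<nu> (mball_of X (z n) (\<delta> n))"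
  obtains v r where "v \<in> mspace X" "strict_mono r" "(\<lambda>n. mdist X (z (r n)) v) \<longlonglongrightarrow> 0" "J v \<le> ereal (- ln \<theta>)"
proof -
  define N where "N n = measure \<mu> (mball_of X u0 (\<delta> n))" for n
  define b where "b n = measure \<mu> (mball_of X (z n) (\<delta> n))" for n
  define \<epsilon> where "\<epsilon> n = 1 / (real n + 1)" for n :: nat
  have \<epsilon>: "0 < \<epsilon> n" "\<epsilon> n \<le> 1" for n by (auto simp: \<epsilon>_def)
  have N: "0 < N n" for n unfolding N_def by (rule ball_pos[OF \<delta>(1)])
  have "c * \<theta> * N n \<le> c * b n" for n
    using ge[of n] measure_\<nu>_le[of "mball_of X (z n) (\<delta> n)" 0] \<Phi>_nonneg by (simp add: N_def b_def)
  then have bN: "\<theta> * N n \<le> b n" for n using c by (simp add: mult.assoc)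
  define \<rho> where "\<rho> n = b n / N n" for n
  have b_eq: "b n = \<rho> n * N n" for n using N[of n] by (simp add: \<rho>_def)
  have \<rho>: "\<theta> \<le> \<rho> n" "\<rho> n \<le> 1" "0 < \<rho> n" for n
  proof -
    show 1: "\<theta> \<le> \<rho> n" using bN[of n] N[of n] by (simp add: \<rho>_def field_simps)
    show "\<rho> n \<le> 1" using centre_maximal[OF z \<delta>(1), of n n] N[of n] by (simp add: \<rho>_def N_def b_def)
    show "0 < \<rho> n" using 1 \<theta> by simp
  qed
  \<comment> \<open>The summand \<open>\<epsilon> n\<close> provides the strict inequality in \<open>upper\<close>.\<close>
  have "\<exists>v\<in>mspace X. mdist X (z n) v \<le> \<delta> n \<and> I v \<le> ereal (- ln (\<rho> n) + \<epsilon> n)" for n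
  proof (rule upper[OF z \<delta>(1)])
    have "ln (\<rho> n) \<le> 0" using \<rho>[of n] by simp
    then show "0 \<le> - ln (\<rho> n) + \<epsilon> n" using \<epsilon>(1)[of n] by linarith
    have "exp (- (- ln (\<rho> n) + \<epsilon> n)) = \<rho> n * exp (- \<epsilon> n)" using \<rho>(3)[of n] by (simp add: exp_diff exp_minus field_simps)
    also have "\<dots> < \<rho> n * 1" using \<rho>(3)[of n] \<epsilon>(1)[of n] by (intro mult_strict_left_mono) auto
    finally have "exp (- (- ln (\<rho> n) + \<epsilon> n)) * N n < \<rho> n * N n" using N[of n] by simp
    then show "exp (- (- ln (\<rho> n) + \<epsilon> n)) * measure \<mu> (mball_of X u0 (\<delta> n)) < measure \<mu> (mball_of X (z n) (\<delta> n))"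
      unfolding b_eq[symmetric] by (simp add: N_def b_def)
  qed
  then obtain v where v: "\<And>n. v n \<in> mspace X" "\<And>n. mdist X (z n) (v n) \<le> \<delta> n" "\<And>n. I (v n) \<le> ereal (- ln (\<rho> n) + \<epsilon> n)"
    by metis
  \<comment> \<open>If \<open>\<Phi>\<close> were larger throughout the ball, the ball would be too light under \<open>\<nu>\<close>.\<close>
  have "\<exists>w\<in>mball_of X (z n) (\<delta> n). \<Phi> w \<le> ln (\<rho> n) - ln \<theta> + \<epsilon> n" for n
  proof (rule ccontr)
    assume "\<not> ?thesis"
    then have "measure \<nu> (mball_of X (z n) (\<delta> n)) \<le> c * exp (- (ln (\<rho> n) - ln \<theta> + \<epsilon> n)) * b n"
      unfolding b_def by (intro measure_\<nu>_le) (auto simp: not_le less_imp_le)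
    also have "exp (- (ln (\<rho> n) - ln \<theta> + \<epsilon> n)) = \<theta> / \<rho> n * exp (- \<epsilon> n)"
      using \<rho>(3)[of n] \<theta> by (simp add: exp_diff exp_minus exp_add field_simps)
    also have "c * (\<theta> / \<rho> n * exp (- \<epsilon> n)) * b n = (c * \<theta> * N n) * exp (- \<epsilon> n)"
      using \<rho>(3)[of n] by (simp add: b_eq)
    also have "\<dots> < c * \<theta> * N n" using \<epsilon>(1)[of n] c \<theta> N[of n] by simp
    finally show False using ge[of n] by (simp add: N_def)
  qed
  then obtain w where w: "\<And>n. w n \<in> mball_of X (z n) (\<delta> n)" "\<And>n. \<Phi> (w n) \<le> ln (\<rho> n) - ln \<theta> + \<epsilon> n" by metis
  have wX: "w n \<in> mspace X" for n using w(1)[of n] by simp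
  have "I (v n) \<le> ereal (- ln \<theta> + 1)" for n
  proof -
    have "ln \<theta> \<le> ln (\<rho> n)" using \<rho>[of n] \<theta> by simp
    then have "- ln (\<rho> n) + \<epsilon> n \<le> - ln \<theta> + 1" using \<epsilon>(2)[of n] by linarith
    then show ?thesis using v(3)[of n] by (auto intro: order_trans)
  qed
  then obtain r u where r: "strict_mono r" and u: "u \<in> mspace X" "(\<lambda>n. mdist X (v (r n)) u) \<longlonglongrightarrow> 0"
    using sublevel_convergent_subseq[of v] v(1) by blast
  have \<delta>r: "(\<lambda>n. \<delta> (r n)) \<longlonglongrightarrow> 0" using LIMSEQ_subseq_LIMSEQ[OF \<delta>(2) r] by (simp add: o_def)
  have zu: "(\<lambda>n. mdist X (z (r n)) u) \<longlonglongrightarrow> 0"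
  proof (rule tendsto_sandwich[OF _ _ tendsto_const])
    show "\<forall>\<^sub>F n in sequentially. mdist X (z (r n)) u \<le> \<delta> (r n) + mdist X (v (r n)) u"
    proof (intro always_eventually allI)
      fix n
      show "mdist X (z (r n)) u \<le> \<delta> (r n) + mdist X (v (r n)) u"
        using X.triangle[OF z v(1) u(1), of "r n" "r n"] v(2)[of "r n"] by linarith
    qed
    show "(\<lambda>n. \<delta> (r n) + mdist X (v (r n)) u) \<longlonglongrightarrow> 0" using tendsto_add[OF \<delta>r u(2)] by simp
  qed simp
  have wu: "(\<lambda>n. mdist X (w (r n)) u) \<longlonglongrightarrow> 0"
  proof (rule tendsto_sandwich[OF _ _ tendsto_const])
    show "\<forall>\<^sub>F n in sequentially. mdist X (w (r n)) u \<le> \<delta> (r n) + mdist X (z (r n)) u"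
    proof (intro always_eventually allI)
      fix n
      have "mdist X (w (r n)) u \<le> mdist X (z (r n)) (w (r n)) + mdist X (z (r n)) u"
        using X.triangle[OF wX z u(1), of "r n" "r n"] X.commute[of "w (r n)" "z (r n)"] by simp
      then show "mdist X (w (r n)) u \<le> \<delta> (r n) + mdist X (z (r n)) u" using w(1)[of "r n"] by simp
    qed
    show "(\<lambda>n. \<delta> (r n) + mdist X (z (r n)) u) \<longlonglongrightarrow> 0" using tendsto_add[OF \<delta>r zu] by simp
  qed simp
  have "\<epsilon> \<longlonglongrightarrow> 0" unfolding \<epsilon>_def using LIMSEQ_inverse_real_of_nat by (simp add: inverse_eq_divide add.commute)
  then have "(\<lambda>n. \<epsilon> (r n)) \<longlonglongrightarrow> 0" using LIMSEQ_subseq_LIMSEQ[OF _ r] by (simp add: o_def)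
  then have "(\<lambda>n. - ln \<theta> - \<Phi> (w (r n)) + 2 * \<epsilon> (r n)) \<longlonglongrightarrow> - ln \<theta> - \<Phi> u + 2 * 0"
    by (intro tendsto_intros \<Phi>_seq u wX wu)
  then have "I u \<le> ereal (- ln \<theta> - \<Phi> u + 2 * 0)"
  proof (rule lsc_limit[rotated -1])
    show "I (v (r n)) \<le> ereal (- ln \<theta> - \<Phi> (w (r n)) + 2 * \<epsilon> (r n))" for n
    proof -
      have "- ln (\<rho> (r n)) + \<epsilon> (r n) \<le> - ln \<theta> - \<Phi> (w (r n)) + 2 * \<epsilon> (r n)" using w(2)[of "r n"] by linarith
      then show ?thesis using v(3)[of "r n"] by (auto intro: order_trans)
    qed
  qed (use v u in auto)
  then have "J u \<le> ereal (- ln \<theta>)" unfolding J_def by (cases "I u") auto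
  with u(1) r zu show ?thesis using that by blast
qed

abbreviation "N \<delta> \<equiv> measure \<mu> (mball_of X u0 \<delta>)"
abbreviation "S \<delta> \<equiv> (SUP z\<in>mspace X. measure \<nu> (mball_of X z \<delta>))"

lemma S_upper: "z \<in> mspace X \<Longrightarrow> measure \<nu> (mball_of X z \<delta>) \<le> S \<delta>"
proof -
  interpret n: finite_measure \<nu> by (rule finite_measure_\<nu>)
  show "z \<in> mspace X \<Longrightarrow> measure \<nu> (mball_of X z \<delta>) \<le> S \<delta>"
    by (intro cSUP_upper bdd_aboveI2[where M="measure \<nu> (space \<nu>)"] n.bounded_measure)
qed

lemma ball_lower:
  assumes u: "u \<in> mspace X" "J u = ereal j" and \<theta>': "\<theta>' < exp (- j)"
  shows "\<forall>\<^sub>F \<delta> in at_right 0. \<theta>' < measure \<nu> (mball_of X u \<delta>) / (c * N \<delta>)"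
proof -
  define \<theta> where "\<theta> = max \<theta>' (exp (- j) / 2)"
  have \<theta>: "0 < \<theta>" "\<theta> < exp (- j)" "\<theta>' \<le> \<theta>" using \<theta>' by (auto simp: \<theta>_def less_max_iff_disj)
  obtain i where i: "I u = ereal i" "j = \<Phi> u + i" using u(2) unfolding J_def by (cases "I u") auto
  define \<eta> where "\<eta> = (- j - ln \<theta>) / 2"
  have "ln \<theta> < ln (exp (- j))" using \<theta> by (subst ln_less_cancel_iff) auto
  then have \<eta>: "0 < \<eta>" by (simp add: \<eta>_def)
  obtain d where d: "0 < d" "\<And>w. w \<in> mball_of X u d \<Longrightarrow> \<Phi> w < \<Phi> u + \<eta>" using \<Phi>_near[OF u(1) \<eta>] by blast
  show ?thesis
    using eventually_at_right_real[OF d(1)]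
  proof eventually_elim
    case (elim \<delta>)
    then have \<delta>: "0 < \<delta>" "\<delta> < d" by auto
    have "- j - 2 * \<eta> = ln \<theta>" by (simp add: \<eta>_def field_simps)
    then have "\<theta> = exp (- j - 2 * \<eta>)" using \<theta> by simp
    also have "\<dots> < exp (- j - \<eta>)" using \<eta> by simp
    also have "\<dots> = exp (- (\<Phi> u + \<eta>)) * exp (- i)" by (simp add: i(2) exp_add[symmetric])
    finally have "\<theta> * (c * N \<delta>) < exp (- (\<Phi> u + \<eta>)) * exp (- i) * (c * N \<delta>)"
      using c ball_pos[OF \<delta>(1)] by (intro mult_strict_right_mono) auto
    also have "\<dots> = c * exp (- (\<Phi> u + \<eta>)) * (exp (- i) * N \<delta>)" by simp
    also have "\<dots> \<le> c * exp (- (\<Phi> u + \<eta>)) * measure \<mu> (mball_of X u \<delta>)"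
      using c lower[OF u(1) i(1) \<delta>(1)] by (intro mult_left_mono) auto
    also have "\<dots> \<le> measure \<nu> (mball_of X u \<delta>)"
    proof (rule measure_\<nu>_ge)
      fix w assume "w \<in> mball_of X u \<delta>"
      then have "w \<in> mball_of X u d" using \<delta> by auto
      then show "\<Phi> w \<le> \<Phi> u + \<eta>" using d(2) by (simp add: less_imp_le)
    qed simp
    finally have "\<theta> < measure \<nu> (mball_of X u \<delta>) / (c * N \<delta>)"
      using c ball_pos[OF \<delta>(1)] by (simp add: pos_less_divide_eq)
    then show ?case using \<theta>(3) by linarith
  qed
qed

text \<open>The lower bound comes from the balls around a minimiser. If the upper bound failed, there would be
ever smaller balls with too much mass, and their centres would accumulate at a point with \<open>J\<close> below
the minimum.\<close>

lemma sup_ball_tendsto: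
  assumes u: "is_arg_min J (\<lambda>v. v \<in> mspace X) u" "J u = ereal m"
  shows "((\<lambda>\<delta>. S \<delta> / (c * N \<delta>)) \<longlongrightarrow> exp (- m)) (at_right 0)"
proof -
  have uX: "u \<in> mspace X" using u by (simp add: is_arg_min_def)
  have pos: "\<forall>\<^sub>F \<delta> in at_right (0::real). 0 < \<delta>" by (rule eventually_at_right_less)
  show ?thesis
  proof (rule order_tendstoI)
  fix \<theta> assume "\<theta> < exp (- m)"
  from ball_lower[OF uX u(2) this] pos show "\<forall>\<^sub>F \<delta> in at_right 0. \<theta> < S \<delta> / (c * N \<delta>)"
  proof eventually_elim
    case (elim \<delta>)
    have "measure \<nu> (mball_of X u \<delta>) / (c * N \<delta>) \<le> S \<delta> / (c * N \<delta>)"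
      using c ball_pos[of \<delta>] elim S_upper[OF uX] by (intro divide_right_mono) auto
    then show ?case using elim by linarith
  qed
next
  fix \<theta> assume \<theta>: "exp (- m) < \<theta>"
  define \<theta>' where "\<theta>' = (exp (- m) + \<theta>) / 2"
  have \<theta>': "exp (- m) < \<theta>'" "\<theta>' < \<theta>" using \<theta> by (auto simp: \<theta>'_def)
  then have \<theta>'0: "0 < \<theta>'" by (meson exp_gt_zero less_trans)
  show "\<forall>\<^sub>F \<delta> in at_right 0. S \<delta> / (c * N \<delta>) < \<theta>"
  proof (rule ccontr)
    assume neg: "\<not> ?thesis"
    have "\<exists>\<delta> z. 0 < \<delta> \<and> \<delta> < 1 / (real n + 1) \<and> z \<in> mspace X \<and> c * \<theta>' * N \<delta> \<le> measure \<nu> (mball_of X z \<delta>)" for n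
    proof (rule ccontr)
      assume no: "\<not> ?thesis"
      have "\<forall>\<^sub>F \<delta> in at_right 0. S \<delta> / (c * N \<delta>) < \<theta>"
        using eventually_at_right_real[of 0 "1 / (real n + 1)"]
      proof (rule eventually_mono)
        fix \<delta> assume "\<delta> \<in> {0<..<1 / (real n + 1)}"
        then have \<delta>: "0 < \<delta>" "\<delta> < 1 / (real n + 1)" by auto
        have "S \<delta> \<le> c * \<theta>' * N \<delta>"
          using no \<delta> uX by (intro cSUP_least) (auto simp: not_le less_imp_le)
        then have "S \<delta> / (c * N \<delta>) \<le> \<theta>'" using c ball_pos[OF \<delta>(1)] by (simp add: pos_divide_le_eq mult_ac)
        then show "S \<delta> / (c * N \<delta>) < \<theta>" using \<theta>' by linarith
      qed simp
      then show False using neg by simp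
    qed
    then obtain \<delta> z where \<delta>: "\<And>n. 0 < \<delta> n" "\<And>n. \<delta> n < 1 / (real n + 1)" and z: "\<And>n. z n \<in> mspace X"
      "\<And>n. c * \<theta>' * N (\<delta> n) \<le> measure \<nu> (mball_of X (z n) (\<delta> n))" by metis
    have "\<delta> \<longlonglongrightarrow> 0"
    proof (rule tendsto_sandwich[OF _ _ tendsto_const])
      show "(\<lambda>n. 1 / (real n + 1)) \<longlonglongrightarrow> 0"
        using LIMSEQ_inverse_real_of_nat by (simp add: inverse_eq_divide add.commute)
    qed (use \<delta> in \<open>auto intro!: always_eventually less_imp_le\<close>)
    from concentration_limit[OF \<delta>(1) this z(1) \<theta>'0 z(2)]
    obtain v where v: "v \<in> mspace X" "J v \<le> ereal (- ln \<theta>')" by blast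
    have "ln (exp (- m)) < ln \<theta>'" using \<theta>' \<theta>'0 by (subst ln_less_cancel_iff) auto
    then have "J v < J u" using v(2) u(2) by (auto intro: le_less_trans)
    then show False using u(1) v(1) by (auto simp: is_arg_min_def)
  qed
  qed
qed

text \<open>The supremum over all balls behaves like \<open>c * exp (- m) * N \<delta>\<close> with \<open>m\<close> the minimum of \<open>J\<close>. So \<open>u\<close> is
a MAP estimator iff the balls around \<open>u\<close> behave in the same way, and by \<open>ball_lower\<close> and
\<open>concentration_limit\<close> for constant centres this happens iff \<open>J u = m\<close>.\<close>

theorem is_MAP_iff: "is_MAP X \<nu> u \<longleftrightarrow> is_arg_min J (\<lambda>v. v \<in> mspace X) u"
proof -
  obtain w where w: "is_arg_min J (\<lambda>v. v \<in> mspace X) w" using minimiser_exists by blast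
  have "J w \<le> J u0" using w u0 by (auto simp: is_arg_min_def not_less)
  moreover have "0 \<le> J w" unfolding J_def using \<Phi>_nonneg[of w] I_nonneg[of w] by simp
  ultimately obtain m where m: "J w = ereal m" using u0 by (cases "J w") (auto simp: J_def)
  note S_lim = sup_ball_tendsto[OF w m]
  have pos: "\<forall>\<^sub>F \<delta> in at_right (0::real). 0 < \<delta>" by (rule eventually_at_right_less)
  show ?thesis
  proof
    assume u: "is_arg_min J (\<lambda>v. v \<in> mspace X) u"
    then have uX: "u \<in> mspace X" by (simp add: is_arg_min_def)
    have "J u \<le> J w" "J w \<le> J u" using u w by (auto simp: is_arg_min_def not_less)
    then have Ju: "J u = ereal m" using m by simp
    have "((\<lambda>\<delta>. measure \<nu> (mball_of X u \<delta>) / (c * N \<delta>)) \<longlongrightarrow> exp (- m)) (at_right 0)"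
    proof (rule order_tendstoI)
      fix \<theta> assume "\<theta> < exp (- m)"
      then show "\<forall>\<^sub>F \<delta> in at_right 0. \<theta> < measure \<nu> (mball_of X u \<delta>) / (c * N \<delta>)" by (rule ball_lower[OF uX Ju])
    next
      fix \<theta> assume "exp (- m) < \<theta>"
      from order_tendstoD(2)[OF S_lim this] pos
      show "\<forall>\<^sub>F \<delta> in at_right 0. measure \<nu> (mball_of X u \<delta>) / (c * N \<delta>) < \<theta>"
      proof eventually_elim
        case (elim \<delta>)
        have "measure \<nu> (mball_of X u \<delta>) / (c * N \<delta>) \<le> S \<delta> / (c * N \<delta>)"
          using c ball_pos[of \<delta>] elim S_upper[OF uX] by (intro divide_right_mono) auto
        then show ?case using elim by linarith
      qed
    qed
    from tendsto_divide[OF this S_lim]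
    have "((\<lambda>\<delta>. measure \<nu> (mball_of X u \<delta>) / (c * N \<delta>) / (S \<delta> / (c * N \<delta>))) \<longlongrightarrow> 1) (at_right 0)" by simp
    then have "((\<lambda>\<delta>. measure \<nu> (mball_of X u \<delta>) / S \<delta>) \<longlongrightarrow> 1) (at_right 0)"
    proof (rule Lim_transform_eventually)
      show "\<forall>\<^sub>F \<delta> in at_right 0. measure \<nu> (mball_of X u \<delta>) / (c * N \<delta>) / (S \<delta> / (c * N \<delta>)) = measure \<nu> (mball_of X u \<delta>) / S \<delta>"
        using pos
      proof eventually_elim
        case (elim \<delta>)
        then have "c * N \<delta> \<noteq> 0" using c ball_pos[of \<delta>] by simp
        then show ?case by simp
      qed
    qed
    then show "is_MAP X \<nu> u" using uX by (simp add: is_MAP_def)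
  next
    assume "is_MAP X \<nu> u"
    then have uX: "u \<in> mspace X" and lim: "((\<lambda>\<delta>. measure \<nu> (mball_of X u \<delta>) / S \<delta>) \<longlongrightarrow> 1) (at_right 0)"
      by (auto simp: is_MAP_def)
    have lim2: "((\<lambda>\<delta>. measure \<nu> (mball_of X u \<delta>) / S \<delta> * (S \<delta> / (c * N \<delta>))) \<longlongrightarrow> exp (- m)) (at_right 0)"
      using tendsto_mult[OF lim S_lim] by simp
    have "J u \<le> ereal m"
    proof (rule ereal_le_epsilon2)
      fix \<epsilon> :: real assume \<epsilon>: "0 < \<epsilon>"
      have "\<forall>\<^sub>F \<delta> in at_right 0. exp (- m - \<epsilon>) < measure \<nu> (mball_of X u \<delta>) / S \<delta> * (S \<delta> / (c * N \<delta>))"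
        using \<epsilon> by (intro order_tendstoD(1)[OF lim2]) simp
      then obtain d where d: "0 < d" "\<And>\<delta>. 0 < \<delta> \<Longrightarrow> \<delta> < d \<Longrightarrow> exp (- m - \<epsilon>) < measure \<nu> (mball_of X u \<delta>) / S \<delta> * (S \<delta> / (c * N \<delta>))"
        unfolding eventually_at_right_field by auto
      have ge: "c * exp (- m - \<epsilon>) * N \<delta> \<le> measure \<nu> (mball_of X u \<delta>)" if \<delta>: "0 < \<delta>" "\<delta> < d" for \<delta>
      proof -
        have "S \<delta> \<noteq> 0"
        proof
          assume "S \<delta> = 0"
          then show False using d(2)[OF \<delta>] by simp
        qed
        then have "exp (- m - \<epsilon>) < measure \<nu> (mball_of X u \<delta>) / (c * N \<delta>)" using d(2)[OF \<delta>] by simp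
        then show ?thesis using c ball_pos[OF \<delta>(1)] by (simp add: pos_less_divide_eq mult_ac)
      qed
      \<comment> \<open>The offset 2 keeps the radii strictly below \<open>d\<close>.\<close>
      define \<delta> where "\<delta> n = d / (real n + 2)" for n
      have \<delta>: "0 < \<delta> n" "\<delta> n < d" for n
        using d(1) by (auto simp: \<delta>_def field_simps add_pos_nonneg)
      have "(\<lambda>n. d * inverse (real (Suc (Suc n)))) \<longlonglongrightarrow> d * 0"
        by (intro tendsto_mult tendsto_const LIMSEQ_Suc[OF LIMSEQ_inverse_real_of_nat])
      then have "\<delta> \<longlonglongrightarrow> 0" by (simp add: \<delta>_def[abs_def] divide_inverse add.commute)
      from concentration_limit[OF \<delta>(1) this uX exp_gt_zero ge[OF \<delta>]]
      obtain v where v: "v \<in> mspace X" "(\<lambda>n::nat. mdist X u v) \<longlonglongrightarrow> 0" "J v \<le> ereal (- ln (exp (- m - \<epsilon>)))" by blast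
      have "mdist X u v = 0" using v(2) by (simp add: LIMSEQ_const_iff)
      then have "v = u" using uX v(1) by simp
      then show "J u \<le> ereal m + ereal \<epsilon>" using v(3) by (simp add: add.commute)
    qed
    then show "is_arg_min J (\<lambda>v. v \<in> mspace X) u"
      unfolding is_arg_min_def
    proof (intro conjI uX notI)
      assume "\<exists>v. v \<in> mspace X \<and> J v < J u"
      then obtain v where v: "v \<in> mspace X" "J v < J u" by blast
      have "J v < J w" using v(2) \<open>J u \<le> ereal m\<close> m by simp
      then show False using w v(1) by (auto simp: is_arg_min_def)
    qed
  qed
qed

end

section \<open>Continuity of the observation operator\<close>

text \<open>Completeness of Lebesgue measure makes \<open>f\<close> measurable, so that the two Bochner integrals agree without
any prior knowledge about \<open>f\<close>.\<close>

lemma integral_lebesgue_AE_borel: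
  fixes f g :: "'a::euclidean_space \<Rightarrow> real"
  assumes g: "g \<in> borel_measurable lborel" and ae: "AE x in lborel. f x = g x"
  shows "f \<in> borel_measurable lebesgue" "integral\<^sup>L lebesgue f = integral\<^sup>L lborel g"
proof -
  have ae': "AE x in lebesgue. f x = g x" by (rule AE_completion[OF ae])
  have gm: "g \<in> borel_measurable lebesgue" by (rule measurable_completion[OF g])
  show fm: "f \<in> borel_measurable lebesgue"
  proof (rule measurableI)
    fix B :: "real set" assume B: "B \<in> sets borel"
    have gB: "g -` B \<inter> space lebesgue \<in> sets lebesgue" using gm B by (rule measurable_sets)
    show "f -` B \<inter> space lebesgue \<in> sets lebesgue"
    proof (rule completion.in_sets_AE)
      show "AE x in lebesgue. (x \<in> g -` B \<inter> space lebesgue) = (x \<in> f -` B \<inter> space lebesgue)"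
        using ae' by eventually_elim auto
    qed (use gB in auto)
  qed simp
  have "integral\<^sup>L lebesgue f = integral\<^sup>L lebesgue g" by (rule integral_cong_AE[OF fm gm ae'])
  also have "\<dots> = integral\<^sup>L lborel g" using g by (rule integral_completion)
  finally show "integral\<^sup>L lebesgue f = integral\<^sup>L lborel g" .
qed

lemma integral_lebesgue_on_AE_borel:
  fixes f g :: "real \<Rightarrow> real"
  assumes S: "S \<in> sets borel" and g: "g \<in> borel_measurable borel"
    and ae: "AE x in lborel. x \<in> S \<longrightarrow> f x = g x"
  shows "integral\<^sup>L (lebesgue_on S) f = (LINT x|lborel. indicator S x * g x)"
proof -
  have "integral\<^sup>L (lebesgue_on S) f = (LINT x|lebesgue. indicator S x *\<^sub>R f x)"
    by (rule integral_restrict_space) (use S in auto)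
  also have "\<dots> = (LINT x|lborel. indicator S x * g x)"
  proof (rule integral_lebesgue_AE_borel)
    show "AE x in lborel. indicator S x *\<^sub>R f x = indicator S x * g x"
      using ae by eventually_elim (auto simp: indicator_def)
  qed (use S g in measurable)
  finally show ?thesis .
qed

text \<open>A Lebesgue measurable function on the plane may have nonmeasurable sections. Replacing it by an
almost everywhere equal Borel function changes almost every section only on a null set, so the
iterated integrals of the observation operator stay the same.\<close>

lemma Linf_borel_version:
  fixes H :: "real \<times> real \<Rightarrow> real"
  assumes H: "H \<in> Linf (A \<times> B)" and A: "A \<in> sets borel" and B: "B \<in> sets borel"
  obtains H' C where "H' \<in> borel_measurable borel" "\<And>z. \<bar>H' z\<bar> \<le> C"
    "AE t in lborel. AE x in lborel. x \<in> A \<longrightarrow> t \<in> B \<longrightarrow> H (x, t) = H' (x, t)"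
proof -
  have S: "A \<times> B \<in> sets lebesgue"
  proof -
    have "A \<times> B \<in> sets (borel \<Otimes>\<^sub>M borel)" using A B by (rule pair_measureI)
    then have "A \<times> B \<in> sets (borel :: (real \<times> real) measure)" unfolding borel_prod .
    then show ?thesis by simp
  qed
  obtain C0 where Hm: "H \<in> borel_measurable (lebesgue_on (A \<times> B))" and C0: "AE z in lebesgue_on (A \<times> B). \<bar>H z\<bar> \<le> C0"
    using H by (auto simp: Linf_def)
  define C where "C = max C0 0"
  let ?H0 = "\<lambda>z. if z \<in> A \<times> B then H z else 0"
  have "?H0 \<in> borel_measurable lebesgue" by (rule borel_measurable_if_I[OF Hm S])
  then obtain H1 where H1: "H1 \<in> borel_measurable lborel" "AE z in lborel. ?H0 z = H1 z"
    using completion_ex_borel_measurable_real by blast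
  have "AE z in lebesgue. z \<in> A \<times> B \<longrightarrow> \<bar>H z\<bar> \<le> C0"
    using C0 S by (subst (asm) AE_restrict_space_iff) auto
  then have bd: "AE z in lborel. z \<in> A \<times> B \<longrightarrow> \<bar>H z\<bar> \<le> C0" by (simp add: AE_completion_iff)
  define H' where "H' z = max (- C) (min C (H1 z))" for z
  have H'm: "H' \<in> borel_measurable borel" using H1(1) unfolding H'_def by measurable
  have H'C: "\<bar>H' z\<bar> \<le> C" for z by (auto simp: H'_def C_def)
  have "AE z in lborel. z \<in> A \<times> B \<longrightarrow> H z = H' z"
    using H1(2) bd by eventually_elim (auto simp: H'_def C_def)
  then obtain N where N: "{z \<in> space lborel. \<not> (z \<in> A \<times> B \<longrightarrow> H z = H' z)} \<subseteq> N" "N \<in> null_sets (lborel :: (real \<times> real) measure)"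
    by (auto simp: eventually_ae_filter)
  have "AE z in lborel \<Otimes>\<^sub>M lborel. z \<notin> N" by (subst lborel_prod) (rule AE_not_in[OF N(2)])
  then have "AE x in lborel. AE t in lborel. (x, t) \<notin> N" by (rule lborel_pair.AE_pair)
  moreover have "{z \<in> space (lborel \<Otimes>\<^sub>M lborel). (fst z, snd z) \<notin> N} \<in> sets (lborel \<Otimes>\<^sub>M lborel)"
  proof -
    have "N \<in> sets (lborel \<Otimes>\<^sub>M lborel)" by (subst lborel_prod) (rule null_setsD2[OF N(2)])
    then have "space (lborel \<Otimes>\<^sub>M lborel) - N \<in> sets (lborel \<Otimes>\<^sub>M lborel)" by blast
    moreover have "space (lborel \<Otimes>\<^sub>M lborel) - N = {z \<in> space (lborel \<Otimes>\<^sub>M lborel). (fst z, snd z) \<notin> N}" by auto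
    ultimately show ?thesis by simp
  qed
  ultimately have "AE t in lborel. AE x in lborel. (x, t) \<notin> N"
    using lborel_pair.AE_commute[of "\<lambda>x t. (x, t) \<notin> N"] by (simp add: case_prod_beta)
  then have "AE t in lborel. AE x in lborel. x \<in> A \<longrightarrow> t \<in> B \<longrightarrow> H (x, t) = H' (x, t)"
    by (rule eventually_mono) (rule eventually_mono, assumption, use N(1) in auto)
  with H'm H'C show ?thesis using that by blast
qed

lemma Fint_0: "Fint u 0 = 0" by (simp add: Fint_def)

lemma Wint_0: "Wint u 0 = 0" by (simp add: Wint_def)

context
  fixes L :: real and u :: "real \<Rightarrow> real"
  assumes L: "0 < L" and u: "continuous_on {0..L} u"
begin

lemma exp_integrable: "0 \<le> x \<Longrightarrow> y \<le> L \<Longrightarrow> (\<lambda>z. exp (- u z)) integrable_on {x..y}"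
  by (intro integrable_continuous_real continuous_intros continuous_on_subset[OF u]) auto

lemma Fint_diff:
  assumes "0 \<le> x" "x \<le> y" "y \<le> L"
  shows "Fint u y - Fint u x = integral {x..y} (\<lambda>z. exp (- u z))"
  using Henstock_Kurzweil_Integration.integral_combine[of 0 x y "\<lambda>z. exp (- u z)"] exp_integrable[of 0 y] assms
  by (simp add: Fint_def)

lemma Fint_strict_mono:
  assumes "0 \<le> x" "x < y" "y \<le> L" shows "Fint u x < Fint u y"
proof -
  have "0 < integral {x..y} (\<lambda>z. exp (- u z))"
  proof -
    have c: "continuous_on {x..y} (\<lambda>z. exp (- u z))"
      using assms by (intro continuous_intros continuous_on_subset[OF u]) auto
    obtain w where w: "w \<in> {x..y}" "\<And>z. z \<in> {x..y} \<Longrightarrow> exp (- u w) \<le> exp (- u z)"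
      using continuous_attains_inf[OF compact_Icc _ c] assms by auto
    have "exp (- u w) * (y - x) = integral {x..y} (\<lambda>z. exp (- u w))" using assms by simp
    also have "\<dots> \<le> integral {x..y} (\<lambda>z. exp (- u z))"
      using assms w by (intro integral_le exp_integrable) auto
    finally show ?thesis using assms by (smt (verit) exp_gt_zero mult_pos_pos)
  qed
  then show ?thesis using Fint_diff[of x y] assms by simp
qed

lemma Fint_continuous: "continuous_on {0..L} (Fint u)"
  unfolding Fint_def[abs_def] by (rule indefinite_integral_continuous_1[OF exp_integrable]) (use L in auto)

lemma Fint_integrable: "0 \<le> x \<Longrightarrow> y \<le> L \<Longrightarrow> Fint u integrable_on {x..y}"
  by (intro integrable_continuous_real continuous_on_subset[OF Fint_continuous]) auto

lemma Fint_nonneg: "0 \<le> x \<Longrightarrow> x \<le> L \<Longrightarrow> 0 \<le> Fint u x"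
  unfolding Fint_def using exp_integrable[of 0 x] by (intro integral_nonneg) auto

lemma Wint_strict_mono:
  assumes "0 \<le> x" "x < y" "y \<le> L" shows "Wint u x < Wint u y"
proof -
  define m where "m = (x + y) / 2"
  have m: "x < m" "m < y" "0 < m" using assms by (auto simp: m_def)
  have "Wint u y - Wint u m = integral {m..y} (Fint u)"
    using Henstock_Kurzweil_Integration.integral_combine[of 0 m y "Fint u"] Fint_integrable[of 0 y] assms m
    by (simp add: Wint_def)
  moreover have "Wint u m - Wint u x = integral {x..m} (Fint u)"
    using Henstock_Kurzweil_Integration.integral_combine[of 0 x m "Fint u"] Fint_integrable[of 0 m] assms m
    by (simp add: Wint_def)
  moreover have "0 \<le> integral {x..m} (Fint u)"
    using assms m by (intro integral_nonneg Fint_integrable Fint_nonneg) auto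
  moreover have "Fint u m * (y - m) \<le> integral {m..y} (Fint u)"
  proof -
    have "Fint u m * (y - m) = integral {m..y} (\<lambda>z. Fint u m)" using m by simp
    also have "\<dots> \<le> integral {m..y} (Fint u)"
    proof (intro integral_le Fint_integrable)
      fix z assume "z \<in> {m..y}"
      then show "Fint u m \<le> Fint u z" using Fint_strict_mono[of m z] m assms by (cases "z = m") auto
    qed (use assms m in auto)
    finally show ?thesis .
  qed
  moreover have "0 < Fint u m * (y - m)" using Fint_strict_mono[of 0 m] m assms by (simp add: Fint_0)
  ultimately show ?thesis by linarith
qed

lemma Wint_continuous: "continuous_on {0..L} (Wint u)"
  unfolding Wint_def[abs_def] by (rule indefinite_integral_continuous_1[OF Fint_integrable]) (use L in auto)

lemma Wint_inj: "inj_on (Wint u) {0..L}"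
proof (rule linorder_inj_onI')
  fix x y assume "x \<in> {0..L}" "y \<in> {0..L}" "x < y"
  then show "Wint u x \<noteq> Wint u y" using Wint_strict_mono[of x y] by auto
qed

lemma Wint_less_iff:
  assumes "x \<in> {0..L}" "y \<in> {0..L}" shows "Wint u x < Wint u y \<longleftrightarrow> x < y"
  using Wint_strict_mono[of x y] Wint_strict_mono[of y x] assms by (cases x y rule: linorder_cases) auto

lemma Wint_image: "Wint u ` {0..L} = {0..Wint u L}"
proof
  show "Wint u ` {0..L} \<subseteq> {0..Wint u L}"
    using Wint_less_iff[of _ 0] Wint_less_iff[of L] L by (auto simp: not_less[symmetric] Wint_0)
  show "{0..Wint u L} \<subseteq> Wint u ` {0..L}"
  proof
    fix c assume "c \<in> {0..Wint u L}"
    then obtain x where "0 \<le> x" "x \<le> L" "Wint u x = c"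
      using IVT'[of "Wint u" 0 c L] Wint_continuous L by (auto simp: Wint_0)
    then show "c \<in> Wint u ` {0..L}" by auto
  qed
qed

definition inv_W :: "real \<Rightarrow> real" where "inv_W = inv_into {0..L} (Wint u)"

lemma inv_W: assumes "c \<in> {0..Wint u L}" shows "inv_W c \<in> {0..L}" "Wint u (inv_W c) = c"
  using assms unfolding Wint_image[symmetric] inv_W_def by (rule inv_into_into, rule f_inv_into_f)

lemma inv_W_continuous: "continuous_on {0..Wint u L} inv_W"
  unfolding Wint_image[symmetric]
proof (rule continuous_on_inv[OF Wint_continuous compact_Icc])
  show "\<forall>x\<in>{0..L}. inv_W (Wint u x) = x" unfolding inv_W_def using Wint_inj by (simp add: inv_into_f_f)
qed

context
  fixes muf phi pI p0 :: real
  assumes par: "0 < muf" "0 < phi" "p0 < pI"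
begin

text \<open>One formula covers both cases of the definition, since \<open>inv_W\<close> maps \<open>Wint u L\<close> to \<open>L\<close>. It exhibits
the front as a continuous function of time.\<close>

lemma front_eq:
  assumes "0 < t"
  shows "front L muf phi pI p0 u t = inv_W (min ((pI - p0) / (muf * phi) * t) (Wint u L))"
proof -
  have "(t < fill_time L muf phi pI p0 u) = ((pI - p0) / (muf * phi) * t < Wint u L)"
    unfolding fill_time_def using par by (simp add: field_simps)
  moreover have "inv_W (Wint u L) = L" unfolding inv_W_def using Wint_inj L by (intro inv_into_f_f) auto
  ultimately show ?thesis by (auto simp: front_def inv_W_def min_def)
qed

lemma Wint_L_pos: "0 < Wint u L" using Wint_strict_mono[of 0 L] L by (simp add: Wint_0)

lemma front_range:
  assumes "0 < t"
  shows "front L muf phi pI p0 u t \<in> {0<..L}"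
    "Wint u (front L muf phi pI p0 u t) = min ((pI - p0) / (muf * phi) * t) (Wint u L)"
proof -
  let ?c = "min ((pI - p0) / (muf * phi) * t) (Wint u L)"
  have c: "?c \<in> {0..Wint u L}" "0 < ?c" using par assms Wint_L_pos by auto
  show W: "Wint u (front L muf phi pI p0 u t) = ?c" unfolding front_eq[OF assms] by (rule inv_W(2)[OF c(1)])
  have "front L muf phi pI p0 u t \<in> {0..L}" unfolding front_eq[OF assms] by (rule inv_W(1)[OF c(1)])
  moreover have "front L muf phi pI p0 u t \<noteq> 0" using W c(2) Wint_0 by auto
  ultimately show "front L muf phi pI p0 u t \<in> {0<..L}" by auto
qed

lemma pressure_range:
  assumes "0 < t"
  shows "p0 \<le> pressure L muf phi pI p0 u x t" "pressure L muf phi pI p0 u x t \<le> pI"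
proof -
  let ?s = "front L muf phi pI p0 u t"
  note s = front_range(1)[OF assms]
  have "0 \<le> Fint u x / Fint u ?s" "Fint u x / Fint u ?s \<le> 1" if "x \<in> {0<..<?s}"
    using that s Fint_strict_mono[of 0 x] Fint_strict_mono[of x ?s] by (auto simp: Fint_0 divide_le_eq_1)
  note ratio = this
  have "p0 \<le> pI - (pI - p0) * (Fint u x / Fint u ?s) \<and> pI - (pI - p0) * (Fint u x / Fint u ?s) \<le> pI"
    if x: "x \<in> {0<..<?s}"
  proof -
    have "(pI - p0) * (Fint u x / Fint u ?s) \<le> (pI - p0) * 1" "0 \<le> (pI - p0) * (Fint u x / Fint u ?s)"
      using ratio[OF x] par by (intro mult_left_mono mult_nonneg_nonneg; simp)+
    moreover have "p0 \<le> pI - w \<and> pI - w \<le> pI" if "w \<le> (pI - p0) * 1" "0 \<le> w" for w using that by auto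
    ultimately show ?thesis by blast
  qed
  then show "p0 \<le> pressure L muf phi pI p0 u x t" "pressure L muf phi pI p0 u x t \<le> pI"
    using par unfolding pressure_def by (cases "x \<in> {0<..<?s}"; simp only: if_True if_False; simp)+
qed

text \<open>Clamping the arguments of the front and of \<open>Fint\<close> to the intervals on which they are continuous
yields a jointly Borel function that agrees with the pressure for positive times.\<close>

lemma pressure_borel_version:
  obtains p where "(\<lambda>(x, t). p x t) \<in> borel_measurable (borel \<Otimes>\<^sub>M borel)"
    "\<And>x t. 0 < t \<Longrightarrow> p x t = pressure L muf phi pI p0 u x t"
proof
  define a where "a = (pI - p0) / (muf * phi)"
  have a: "0 < a" using par by (simp add: a_def)
  define s where "s t = inv_W (min (a * max t 0) (Wint u L))" for t
  define F where "F x = Fint u (max 0 (min x L))" for x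
  have "continuous_on UNIV s" unfolding s_def
    using a Wint_L_pos by (intro continuous_on_compose2[OF inv_W_continuous] continuous_intros) auto
  then have s[measurable]: "s \<in> borel_measurable borel" by (rule borel_measurable_continuous_onI)
  have "continuous_on UNIV F" unfolding F_def
    using L by (intro continuous_on_compose2[OF Fint_continuous] continuous_intros) auto
  then have F[measurable]: "F \<in> borel_measurable borel" by (rule borel_measurable_continuous_onI)
  define p where "p x t = (if 0 < x \<and> x < s t then pI - (pI - p0) * (F x / F (s t)) else p0)" for x t
  show "(\<lambda>(x, t). p x t) \<in> borel_measurable (borel \<Otimes>\<^sub>M borel)" unfolding p_def by measurable
  fix x t :: real assume t: "0 < t"
  have st: "s t = front L muf phi pI p0 u t" using t by (simp add: s_def front_eq a_def)
  have sr: "0 < s t" "s t \<le> L" using front_range(1)[OF t] st by auto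
  then have "F (s t) = Fint u (s t)" by (simp add: F_def)
  moreover have "F x = Fint u x" if "0 < x" "x < s t" using that sr by (simp add: F_def)
  ultimately show "p x t = pressure L muf phi pI p0 u x t" by (auto simp: p_def pressure_def st)
qed

end

end

context
  fixes L M :: real and v :: "nat \<Rightarrow> real \<Rightarrow> real" and u :: "real \<Rightarrow> real"
  assumes L: "0 < L" and v: "\<And>n. continuous_on {0..L} (v n)" and u: "continuous_on {0..L} u"
    and conv: "\<And>x. x \<in> {0..L} \<Longrightarrow> (\<lambda>n. v n x) \<longlonglongrightarrow> u x"
    and bound: "\<And>n x. x \<in> {0..L} \<Longrightarrow> \<bar>v n x\<bar> \<le> M"
begin

lemma Fint_lipschitz:
  assumes "0 \<le> x" "x \<le> y" "y \<le> L"
  shows "Fint (v n) y - Fint (v n) x \<le> exp M * (y - x)"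
proof -
  have "Fint (v n) y - Fint (v n) x = integral {x..y} (\<lambda>z. exp (- v n z))"
    by (rule Fint_diff[OF L v assms])
  also have "\<dots> \<le> integral {x..y} (\<lambda>z. exp M)"
  proof (intro integral_le exp_integrable[OF L v])
    fix z assume "z \<in> {x..y}"
    then show "exp (- v n z) \<le> exp M" using bound[of z n] assms by auto
  qed (use assms in auto)
  also have "\<dots> = exp M * (y - x)" using assms by simp
  finally show ?thesis .
qed

lemma Fint_tendsto:
  assumes x: "x \<in> {0..L}" shows "(\<lambda>n. Fint (v n) x) \<longlonglongrightarrow> Fint u x"
  unfolding Fint_def
proof (rule dominated_convergence(2))
  show "(\<lambda>z. exp (- v n z)) integrable_on {0..x}" for n using x by (intro exp_integrable[OF L v]) auto
  show "(\<lambda>z. exp M) integrable_on {0..x}" by (rule integrable_const_ivl)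
  show "norm (exp (- v n z)) \<le> exp M" if "z \<in> {0..x}" for n z using bound[of z n] x that by auto
  show "(\<lambda>n. exp (- v n z)) \<longlonglongrightarrow> exp (- u z)" if "z \<in> {0..x}" for z
    using x that by (intro tendsto_intros conv) auto
qed

lemma Wint_tendsto:
  assumes x: "x \<in> {0..L}" shows "(\<lambda>n. Wint (v n) x) \<longlonglongrightarrow> Wint u x"
  unfolding Wint_def
proof (rule dominated_convergence(2))
  show "Fint (v n) integrable_on {0..x}" for n using x by (intro Fint_integrable[OF L v]) auto
  show "(\<lambda>z. exp M * L) integrable_on {0..x}" by (rule integrable_const_ivl)
  show "norm (Fint (v n) z) \<le> exp M * L" if z: "z \<in> {0..x}" for n z
  proof -
    have "0 \<le> Fint (v n) z" using z x by (intro Fint_nonneg[OF L v]) auto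
    moreover have "Fint (v n) z \<le> exp M * z" using Fint_lipschitz[of 0 z n] z x by (simp add: Fint_0)
    moreover have "exp M * z \<le> exp M * L" using z x by simp
    ultimately show ?thesis unfolding real_norm_def by linarith
  qed
  show "(\<lambda>n. Fint (v n) z) \<longlonglongrightarrow> Fint u z" if "z \<in> {0..x}" for z
    using x that by (intro Fint_tendsto) auto
qed

context
  fixes muf phi pI p0 :: real
  assumes par: "0 < muf" "0 < phi" "p0 < pI"
begin

text \<open>Comparing \<open>Wint (v n) b\<close> with the value of \<open>Wint (v n)\<close> at its front decides on which side of \<open>b\<close> the
front lies. Both values converge, to values that differ if \<open>b\<close> is not the limiting front; pointwise
convergence of the strictly increasing functions is enough.\<close>

lemma front_tendsto:
  assumes t: "0 < t"
  shows "(\<lambda>n. front L muf phi pI p0 (v n) t) \<longlonglongrightarrow> front L muf phi pI p0 u t"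
proof -
  let ?a = "(pI - p0) / (muf * phi)"
  let ?s = "\<lambda>u. front L muf phi pI p0 u t"
  note sv = front_range[OF L v par t] and su = front_range[OF L u par t]
  have c: "(\<lambda>n. Wint (v n) (?s (v n))) \<longlonglongrightarrow> Wint u (?s u)"
    unfolding sv(2) su(2) using L by (intro tendsto_intros Wint_tendsto) auto
  show ?thesis
  proof (rule order_tendstoI)
    fix b assume b: "b < ?s u"
    show "\<forall>\<^sub>F n in sequentially. b < ?s (v n)"
    proof (cases "b < 0")
      case True
      have "b < ?s (v n)" for n using sv(1)[of n] True by auto
      then show ?thesis by simp
    next
      case False
      then have bL: "b \<in> {0..L}" using b su(1) by auto
      then have "Wint u b < Wint u (?s u)" using b su(1) by (subst Wint_less_iff[OF L u]) auto
      then have "\<forall>\<^sub>F n in sequentially. 0 < Wint (v n) (?s (v n)) - Wint (v n) b"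
        using bL by (intro order_tendstoD(1)[OF tendsto_diff[OF c Wint_tendsto]]) auto
      then show ?thesis
      proof (rule eventually_mono)
        fix n assume "0 < Wint (v n) (?s (v n)) - Wint (v n) b"
        then show "b < ?s (v n)" using sv(1)[of n] bL Wint_less_iff[OF L v, of b "?s (v n)" n] by auto
      qed
    qed
  next
    fix b assume b: "?s u < b"
    show "\<forall>\<^sub>F n in sequentially. ?s (v n) < b"
    proof (cases "L < b")
      case True
      have "?s (v n) < b" for n using sv(1)[of n] True by auto
      then show ?thesis by simp
    next
      case False
      then have bL: "b \<in> {0..L}" using b su(1) by auto
      then have "Wint u (?s u) < Wint u b" using b su(1) by (subst Wint_less_iff[OF L u]) auto
      then have "\<forall>\<^sub>F n in sequentially. 0 < Wint (v n) b - Wint (v n) (?s (v n))"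
        using bL by (intro order_tendstoD(1)[OF tendsto_diff[OF Wint_tendsto c]]) auto
      then show ?thesis
      proof (rule eventually_mono)
        fix n assume "0 < Wint (v n) b - Wint (v n) (?s (v n))"
        then show "?s (v n) < b" using sv(1)[of n] bL Wint_less_iff[OF L v, of "?s (v n)" b n] by auto
      qed
    qed
  qed
qed

lemma Fint_front_tendsto:
  assumes t: "0 < t"
  shows "(\<lambda>n. Fint (v n) (front L muf phi pI p0 (v n) t)) \<longlonglongrightarrow> Fint u (front L muf phi pI p0 u t)"
proof -
  let ?s = "\<lambda>u. front L muf phi pI p0 u t"
  note sv = front_range(1)[OF L v par t] and su = front_range(1)[OF L u par t]
  have "(\<lambda>n. Fint (v n) (?s (v n)) - Fint (v n) (?s u)) \<longlonglongrightarrow> 0"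
  proof (rule tendsto_rabs_zero_cancel, rule tendsto_sandwich[OF _ _ tendsto_const])
    show "(\<lambda>n. exp M * \<bar>?s (v n) - ?s u\<bar>) \<longlonglongrightarrow> 0"
      using tendsto_mult[OF tendsto_const tendsto_rabs[OF tendsto_diff[OF front_tendsto[OF t] tendsto_const]], of "exp M" "?s u"] by simp
    have "\<bar>Fint (v n) (?s (v n)) - Fint (v n) (?s u)\<bar> \<le> exp M * \<bar>?s (v n) - ?s u\<bar>" for n
    proof (cases "?s u \<le> ?s (v n)")
      case True
      then have "Fint (v n) (?s u) \<le> Fint (v n) (?s (v n))"
        using sv[of n] su Fint_strict_mono[OF L v, of "?s u" "?s (v n)" n] by (cases "?s u = ?s (v n)") auto
      then show ?thesis using Fint_lipschitz[of "?s u" "?s (v n)" n] sv[of n] su True by simp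
    next
      case False
      then have "Fint (v n) (?s (v n)) \<le> Fint (v n) (?s u)"
        using sv[of n] su Fint_strict_mono[OF L v, of "?s (v n)" "?s u" n] by auto
      then show ?thesis using Fint_lipschitz[of "?s (v n)" "?s u" n] sv[of n] su False by simp
    qed
    then show "\<forall>\<^sub>F n in sequentially. \<bar>Fint (v n) (?s (v n)) - Fint (v n) (?s u)\<bar> \<le> exp M * \<bar>?s (v n) - ?s u\<bar>" by simp
  qed simp
  from tendsto_add[OF this Fint_tendsto[of "?s u"]] su show ?thesis by auto
qed

lemma pressure_tendsto:
  assumes t: "0 < t" and x: "0 < x" "x < L" "x \<noteq> front L muf phi pI p0 u t"
  shows "(\<lambda>n. pressure L muf phi pI p0 (v n) x t) \<longlonglongrightarrow> pressure L muf phi pI p0 u x t"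
proof -
  let ?s = "\<lambda>u. front L muf phi pI p0 u t"
  note su = front_range(1)[OF L u par t]
  show ?thesis
  proof (cases "x < ?s u")
    case True
    have Fpos: "Fint u (?s u) \<noteq> 0" using Fint_strict_mono[OF L u, of 0 "?s u"] su by (simp add: Fint_0)
    have "(\<lambda>n. pI - (pI - p0) * (Fint (v n) x / Fint (v n) (?s (v n)))) \<longlonglongrightarrow> pI - (pI - p0) * (Fint u x / Fint u (?s u))"
      using x by (intro tendsto_intros Fint_tendsto Fint_front_tendsto t Fpos) auto
    moreover have "pressure L muf phi pI p0 u x t = pI - (pI - p0) * (Fint u x / Fint u (?s u))"
      using True x by (simp add: pressure_def)
    moreover have "\<forall>\<^sub>F n in sequentially. pI - (pI - p0) * (Fint (v n) x / Fint (v n) (?s (v n))) = pressure L muf phi pI p0 (v n) x t"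
      using order_tendstoD(1)[OF front_tendsto[OF t] True] by eventually_elim (use x in \<open>simp add: pressure_def\<close>)
    ultimately show ?thesis by (simp only: ) (rule Lim_transform_eventually)
  next
    case False
    then have "?s u < x" using x by simp
    have "\<forall>\<^sub>F n in sequentially. pressure L muf phi pI p0 (v n) x t = p0"
      using order_tendstoD(2)[OF front_tendsto[OF t] \<open>?s u < x\<close>] by eventually_elim (simp add: pressure_def)
    moreover have "pressure L muf phi pI p0 u x t = p0" using False by (simp add: pressure_def)
    ultimately show ?thesis by (simp add: tendsto_eventually)
  qed
qed

text \<open>Dominated convergence, first in space for each fixed time, where the single point at the front is
discarded, and then in time.\<close>

lemma obs_op_tendsto:
  fixes H :: "'m::finite \<Rightarrow> real \<times> real \<Rightarrow> real"
  assumes H: "\<And>i. H i \<in> Linf ({0<..<L} \<times> {0<..T})"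
  shows "(\<lambda>n. obs_op L T muf phi pI p0 H (v n)) \<longlonglongrightarrow> obs_op L T muf phi pI p0 H u"
proof (rule vec_tendstoI)
  fix i
  obtain H' C where H'm: "H' \<in> borel_measurable borel" and H'C: "\<And>z. \<bar>H' z\<bar> \<le> C"
    and H': "AE t in lborel. AE x in lborel. x \<in> {0<..<L} \<longrightarrow> t \<in> {0<..T} \<longrightarrow> H i (x, t) = H' (x, t)"
    using Linf_borel_version[OF H[of i]] by auto
  have H'm2[measurable]: "H' \<in> borel_measurable (borel \<Otimes>\<^sub>M borel)" using H'm by (simp add: borel_prod)
  define Pm where "Pm = max \<bar>pI\<bar> \<bar>p0\<bar>"
  have C0: "0 \<le> C" using H'C[of undefined] by linarith
  define inner where "inner p t = (LINT x|lborel. indicator {0<..<L} x * (H' (x, t) * p x t))" for p :: "real \<Rightarrow> real \<Rightarrow> real" and t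
  have comp: "obs_op L T muf phi pI p0 H w $ i = (LINT t|lborel. indicator {0<..T} t * inner p t)"
    if p[measurable]: "(\<lambda>(x, t). p x t) \<in> borel_measurable (borel \<Otimes>\<^sub>M borel)"
      and eq: "\<And>x t. 0 < t \<Longrightarrow> p x t = pressure L muf phi pI p0 w x t" for w p
  proof -
    have m1: "(\<lambda>x. H' (x, t) * p x t) \<in> borel_measurable borel" for t by measurable
    have m2: "inner p \<in> borel_measurable borel" unfolding inner_def by measurable
    have "obs_op L T muf phi pI p0 H w $ i = (LINT t|lebesgue_on {0<..T}. LINT x|lebesgue_on {0<..<L}. H i (x, t) * pressure L muf phi pI p0 w x t)"
      by (simp add: obs_op_def)
    also have "\<dots> = (LINT t|lborel. indicator {0<..T} t * inner p t)"
    proof (rule integral_lebesgue_on_AE_borel[OF _ m2])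
      show "AE t in lborel. t \<in> {0<..T} \<longrightarrow> (LINT x|lebesgue_on {0<..<L}. H i (x, t) * pressure L muf phi pI p0 w x t) = inner p t"
        using H'
      proof eventually_elim
        case (elim t)
        show ?case unfolding inner_def
        proof (intro impI integral_lebesgue_on_AE_borel[OF _ m1])
          assume t: "t \<in> {0<..T}"
          show "AE x in lborel. x \<in> {0<..<L} \<longrightarrow> H i (x, t) * pressure L muf phi pI p0 w x t = H' (x, t) * p x t"
            using elim by eventually_elim (use t eq in auto)
        qed simp
      qed
    qed simp
    finally show ?thesis .
  qed
  have "\<exists>p. (\<lambda>(x, t). p x t) \<in> borel_measurable (borel \<Otimes>\<^sub>M borel) \<and> (\<forall>x t. 0 < t \<longrightarrow> p x t = pressure L muf phi pI p0 (v n) x t)" for n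
    using pressure_borel_version[OF L v par] by metis
  then obtain q where q: "\<And>n. (\<lambda>(x, t). q n x t) \<in> borel_measurable (borel \<Otimes>\<^sub>M borel)"
    "\<And>n x t. 0 < t \<Longrightarrow> q n x t = pressure L muf phi pI p0 (v n) x t" by metis
  obtain p where p: "(\<lambda>(x, t). p x t) \<in> borel_measurable (borel \<Otimes>\<^sub>M borel)"
    "\<And>x t. 0 < t \<Longrightarrow> p x t = pressure L muf phi pI p0 u x t"
    using pressure_borel_version[OF L u par] by metis
  note [measurable] = q(1) p(1)
  have Pm: "\<bar>pressure L muf phi pI p0 w x t\<bar> \<le> Pm" if "0 < t" "continuous_on {0..L} w" for w x t
    using pressure_range[OF L that(2) par that(1), of x] by (auto simp: Pm_def)
  have bd: "\<bar>H' z * w\<bar> \<le> C * Pm" if "\<bar>w\<bar> \<le> Pm" for z w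
    using H'C[of z] that C0 unfolding abs_mult by (intro mult_mono) auto
  have i_ind: "integrable lborel (\<lambda>x. indicator {0<..<L} x * (C * Pm))"
    using L by (intro integrable_mult_left integrable_real_indicator) auto
  have inner_lim: "(\<lambda>n. inner (q n) t) \<longlonglongrightarrow> inner p t" if t: "0 < t" for t
    unfolding inner_def
  proof (rule integral_dominated_convergence[where w="\<lambda>x. indicator {0<..<L} x * (C * Pm)", OF _ _ i_ind])
    show "AE x in lborel. (\<lambda>n. indicator {0<..<L} x * (H' (x, t) * q n x t)) \<longlonglongrightarrow> indicator {0<..<L} x * (H' (x, t) * p x t)"
      using AE_lborel_singleton[of "front L muf phi pI p0 u t"]
    proof eventually_elim
      case (elim x)
      show ?case
      proof (cases "x \<in> {0<..<L}")
        case True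
        then have "(\<lambda>n. q n x t) \<longlonglongrightarrow> p x t"
          using elim pressure_tendsto[OF t] by (simp add: q(2)[OF t] p(2)[OF t])
        then show ?thesis by (intro tendsto_intros)
      qed simp
    qed
    show "AE x in lborel. norm (indicator {0<..<L} x * (H' (x, t) * q n x t)) \<le> indicator {0<..<L} x * (C * Pm)" for n
      using bd Pm[OF t v] by (auto simp: q(2)[OF t] indicator_def)
  qed measurable
  have inner_bd: "\<bar>inner (q n) t\<bar> \<le> L * (C * Pm)" if t: "0 < t" for n t
  proof -
    let ?f = "\<lambda>x. indicator {0<..<L} x * (H' (x, t) * q n x t)"
    have le: "norm (?f x) \<le> indicator {0<..<L} x * (C * Pm)" for x
      using bd Pm[OF t v] by (auto simp: q(2)[OF t] indicator_def)
    have int: "integrable lborel ?f"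
    proof (rule Bochner_Integration.integrable_bound[OF i_ind])
      show "AE x in lborel. norm (?f x) \<le> norm (indicator {0<..<L} x * (C * Pm))"
        using order_trans[OF le abs_ge_self] by (intro AE_I2) simp
    qed measurable
    have "\<bar>inner (q n) t\<bar> \<le> (LINT x|lborel. norm (?f x))"
      unfolding inner_def real_norm_def[symmetric] by (rule integral_norm_bound)
    also have "\<dots> \<le> (LINT x|lborel. indicator {0<..<L} x * (C * Pm))"
      using le by (intro integral_mono integrable_norm int i_ind)
    finally have "\<bar>inner (q n) t\<bar> \<le> (LINT x|lborel. indicator {0<..<L} x * (C * Pm))" .
    then show ?thesis using L by simp
  qed
  have "(\<lambda>n. LINT t|lborel. indicator {0<..T} t * inner (q n) t) \<longlonglongrightarrow> (LINT t|lborel. indicator {0<..T} t * inner p t)"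
  proof (rule integral_dominated_convergence[where w="\<lambda>t. indicator {0<..T} t * (L * (C * Pm))"])
    show "(\<lambda>t. indicator {0<..T} t * inner p t) \<in> borel_measurable lborel"
      "(\<lambda>t. indicator {0<..T} t * inner (q n) t) \<in> borel_measurable lborel" for n unfolding inner_def by measurable
    show "AE t in lborel. (\<lambda>n. indicator {0<..T} t * inner (q n) t) \<longlonglongrightarrow> indicator {0<..T} t * inner p t"
    proof (rule AE_I2)
      fix t show "(\<lambda>n. indicator {0<..T} t * inner (q n) t) \<longlonglongrightarrow> indicator {0<..T} t * inner p t"
        using inner_lim[of t] by (cases "t \<in> {0<..T}") (auto intro!: tendsto_intros)
    qed
    show "AE t in lborel. norm (indicator {0<..T} t * inner (q n) t) \<le> indicator {0<..T} t * (L * (C * Pm))" for n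
      using inner_bd by (intro AE_I2) (auto simp: indicator_def)
    show "integrable lborel (\<lambda>t. indicator {0<..T} t * (L * (C * Pm)))"
      by (intro integrable_mult_left integrable_real_indicator) (cases "0 \<le> T"; simp)+
  qed
  moreover have "(\<lambda>n. obs_op L T muf phi pI p0 H (v n) $ i) \<longlonglongrightarrow> obs_op L T muf phi pI p0 H u $ i"
    if "(\<lambda>n. LINT t|lborel. indicator {0<..T} t * inner (q n) t) \<longlonglongrightarrow> (LINT t|lborel. indicator {0<..T} t * inner p t)"
  proof -
    have "obs_op L T muf phi pI p0 H (v n) $ i = (LINT t|lborel. indicator {0<..T} t * inner (q n) t)" for n
      by (rule comp[OF q(1) q(2)])
    moreover have "obs_op L T muf phi pI p0 H u $ i = (LINT t|lborel. indicator {0<..T} t * inner p t)"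
      by (rule comp[OF p(1) p(2)])
    ultimately show ?thesis using that by (simp only:)
  qed
  ultimately show "(\<lambda>n. obs_op L T muf phi pI p0 H (v n) $ i) \<longlonglongrightarrow> obs_op L T muf phi pI p0 H u $ i" by blast
qed

end

end

section \<open>The space of continuous functions\<close>

lemma mspace_CX: "f \<in> mspace (CX L) \<longleftrightarrow> f \<in> extensional {0..L} \<and> continuous_on {0..L} f"
proof -
  have "compactin (top_of_set {0..L}) (topspace (top_of_set {0..L}))"
    by (simp add: compactin_subtopology)
  then show ?thesis
    by (auto simp: CX_def compactin_mspace_cfunspace intro!: compact_imp_bounded compact_continuous_image)
qed

lemma CX_continuous: "f \<in> mspace (CX L) \<Longrightarrow> continuous_on {0..L} f"
  by (simp add: mspace_CX)

lemma mdist_CX_le: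
  assumes "0 < L" "f \<in> mspace (CX L)" "g \<in> mspace (CX L)"
  shows "mdist (CX L) f g \<le> a \<longleftrightarrow> (\<forall>x\<in>{0..L}. \<bar>f x - g x\<bar> \<le> a)"
  using cfunspace_mdist_le[of f "top_of_set {0..L}" euclidean_metric g a] assms by (simp add: CX_def dist_real_def)

lemma mcomplete_CX: "mcomplete_of (CX L)"
proof -
  have "mcomplete_of (cfunspace (top_of_set {0..L}) (Met_TC.Self :: real metric))"
    by (rule Met_TC.mcomplete_cfunspace) (simp add: mcomplete_iff_complete complete_UNIV)
  then show ?thesis by (simp add: CX_def euclidean_metric_def Metric_space.Self_def[OF Met_TC.Metric_space_axioms])
qed

lemma CX_conv:
  assumes L: "0 < L" and v: "\<And>n::nat. v n \<in> mspace (CX L)" and u: "u \<in> mspace (CX L)"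
    and lim: "(\<lambda>n. mdist (CX L) (v n) u) \<longlonglongrightarrow> 0"
  shows "x \<in> {0..L} \<Longrightarrow> (\<lambda>n. v n x) \<longlonglongrightarrow> u x" "\<exists>M. \<forall>n. \<forall>x\<in>{0..L}. \<bar>v n x\<bar> \<le> M"
proof -
  have le: "\<bar>v n x - u x\<bar> \<le> mdist (CX L) (v n) u" if "x \<in> {0..L}" for n x
    using mdist_CX_le[OF L v u] that by blast
  show "(\<lambda>n. v n x) \<longlonglongrightarrow> u x" if x: "x \<in> {0..L}"
  proof (rule LIM_zero_cancel, rule tendsto_rabs_zero_cancel, rule tendsto_sandwich[OF _ _ tendsto_const lim])
    show "\<forall>\<^sub>F n in sequentially. \<bar>v n x - u x\<bar> \<le> mdist (CX L) (v n) u" using le[OF x] by simp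
  qed simp
  obtain B where B: "\<And>n. norm (mdist (CX L) (v n) u) \<le> B"
    using convergent_imp_Bseq[OF convergentI[OF lim]] by (auto simp: Bseq_def)
  have "bounded (u ` {0..L})"
    using compact_continuous_image[OF CX_continuous[OF u] compact_Icc] compact_imp_bounded by blast
  then obtain C where "\<forall>x\<in>{0..L}. \<bar>u x\<bar> \<le> C" by (auto simp: bounded_iff)
  then have C: "\<bar>u x\<bar> \<le> C" if "x \<in> {0..L}" for x using that by blast
  have "\<bar>v n x\<bar> \<le> B + C" if "x \<in> {0..L}" for n x
    using le[OF that, of n] B[of n] C[OF that] by simp
  then show "\<exists>M. \<forall>n. \<forall>x\<in>{0..L}. \<bar>v n x\<bar> \<le> M" by blast
qed

text \<open>The topology comes from a metric, so preimages of closed sets need to be tested on sequences only.\<close>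

lemma continuous_map_CX_sequentially:
  fixes F :: "(real \<Rightarrow> real) \<Rightarrow> 'b::metric_space"
  assumes F: "\<And>v u. (\<And>n::nat. v n \<in> mspace (CX L)) \<Longrightarrow> u \<in> mspace (CX L) \<Longrightarrow>
    (\<lambda>n. mdist (CX L) (v n) u) \<longlonglongrightarrow> 0 \<Longrightarrow> (\<lambda>n. F (v n)) \<longlonglongrightarrow> F u"
  shows "continuous_map (mtopology_of (CX L)) euclidean F"
proof -
  interpret X: Metric_space "mspace (CX L)" "mdist (CX L)" by (rule Metric_space_mspace_mdist)
  show ?thesis
    unfolding continuous_map_closedin
  proof (intro conjI allI impI)
    fix C :: "'b set" assume "closedin euclidean C"
    then have C: "closed C" by simp
    show "closedin (mtopology_of (CX L)) {x \<in> topspace (mtopology_of (CX L)). F x \<in> C}"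
      unfolding mtopology_of_def X.metric_closedin_iff_sequentially_closed
    proof (intro conjI allI impI)
      fix v u assume *: "range v \<subseteq> {x \<in> topspace X.mtopology. F x \<in> C} \<and> limitin X.mtopology v u sequentially"
      then have v: "v n \<in> mspace (CX L)" "F (v n) \<in> C" for n by auto
      have u: "u \<in> mspace (CX L)" "(\<lambda>n. mdist (CX L) (v n) u) \<longlonglongrightarrow> 0"
        using * by (auto simp: X.limitin_metric_dist_null)
      have "F u \<in> C" by (rule closed_sequentially[OF C v(2) F[OF v(1) u]])
      then show "u \<in> {x \<in> topspace X.mtopology. F x \<in> C}" using u by simp
    qed auto
  qed auto
qed

lemma space_borel_CX: "space (borel_CX L) = mspace (CX L)"
  by (simp add: borel_CX_def space_measure_of_conv)

lemma sets_borel_CX_open: "openin (mtopology_of (CX L)) V \<Longrightarrow> V \<in> sets (borel_CX L)"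
  unfolding borel_CX_def using openin_subset[of "mtopology_of (CX L)"]
  by (subst sets_measure_of) (auto intro: sigma_sets.Basic)

lemma continuous_map_CX_measurable:
  fixes F :: "(real \<Rightarrow> real) \<Rightarrow> 'b::metric_space"
  assumes "continuous_map (mtopology_of (CX L)) euclidean F"
  shows "F \<in> borel_measurable (borel_CX L)"
proof (rule borel_measurableI)
  fix S :: "'b set" assume "open S"
  then have "openin (mtopology_of (CX L)) {x \<in> topspace (mtopology_of (CX L)). F x \<in> S}"
    using assms by (auto simp: continuous_map_def)
  moreover have "{x \<in> topspace (mtopology_of (CX L)). F x \<in> S} = F -` S \<inter> space (borel_CX L)"
    by (auto simp: space_borel_CX)
  ultimately show "F -` S \<inter> space (borel_CX L) \<in> sets (borel_CX L)" using sets_borel_CX_open by metis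
qed

lemma L2_bounded:
  assumes "f \<in> borel_measurable (lebesgue_on {0<..<L})" "\<And>x. x \<in> {0<..<L} \<Longrightarrow> \<bar>f x\<bar> \<le> C"
  shows "f \<in> L2 L"
proof -
  interpret finite_measure "lebesgue_on {0<..<L}" by (rule finite_measure_lebesgue_on_Ioo)
  note [measurable] = assms(1)
  have "integrable (lebesgue_on {0<..<L}) (\<lambda>x. (f x)\<^sup>2)"
  proof (rule integrable_const_bound[of _ "C\<^sup>2"])
    show "AE x in lebesgue_on {0<..<L}. norm ((f x)\<^sup>2) \<le> C\<^sup>2"
    proof (rule AE_I2)
      fix x assume "x \<in> space (lebesgue_on {0<..<L})"
      then have "\<bar>f x\<bar> \<le> C" using assms(2) by simp
      then show "norm ((f x)\<^sup>2) \<le> C\<^sup>2" using power_mono[of "\<bar>f x\<bar>" C 2] by simp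
    qed
  qed measurable
  then show ?thesis using assms(1) by (simp add: L2_def)
qed

lemma continuous_L2:
  assumes f: "continuous_on {0..L} f" shows "f \<in> L2 L"
proof -
  have "bounded (f ` {0..L})" using compact_continuous_image[OF f compact_Icc] compact_imp_bounded by blast
  then obtain C where "\<forall>x\<in>{0..L}. \<bar>f x\<bar> \<le> C" by (auto simp: bounded_iff)
  then have C: "\<bar>f x\<bar> \<le> C" if "x \<in> {0..L}" for x using that by blast
  show ?thesis
  proof (rule L2_bounded[where C=C])
    show "f \<in> borel_measurable (lebesgue_on {0<..<L})"
      by (intro continuous_imp_measurable_on_sets_lebesgue continuous_on_subset[OF f]) auto
  qed (use C in auto)
qed

lemma integrable_L2_mult:
  "f \<in> L2 L \<Longrightarrow> g \<in> L2 L \<Longrightarrow> integrable (lebesgue_on {0<..<L}) (\<lambda>x. f x * g x)"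
  unfolding L2_eq by (rule integrable_mult_square_integrable)

lemma L2_inner_diff:
  assumes "f \<in> L2 L" "g \<in> L2 L" "h \<in> L2 L"
  shows "L2_inner L (\<lambda>x. f x - g x) h = L2_inner L f h - L2_inner L g h"
  using integrable_L2_mult[OF assms(1,3)] integrable_L2_mult[OF assms(2,3)]
  by (simp add: L2_inner_def left_diff_distrib)

lemma L2_inner_commute: "L2_inner L f g = L2_inner L g f"
  by (simp add: L2_inner_def mult.commute)

lemma L2_inner_tendsto:
  assumes L: "0 < L" and v: "\<And>n::nat. v n \<in> mspace (CX L)" and u: "u \<in> mspace (CX L)"
    and lim: "(\<lambda>n. mdist (CX L) (v n) u) \<longlonglongrightarrow> 0" and f: "f \<in> L2 L"
  shows "(\<lambda>n. L2_inner L (v n) f) \<longlonglongrightarrow> L2_inner L u f"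
proof -
  interpret finite_measure "lebesgue_on {0<..<L}" by (rule finite_measure_lebesgue_on_Ioo)
  obtain M where M: "\<And>n x. x \<in> {0..L} \<Longrightarrow> \<bar>v n x\<bar> \<le> M" using CX_conv(2)[OF L v u lim] by blast
  have one: "(\<lambda>x. 1) \<in> L2 L" by (rule continuous_L2) simp
  have fint: "integrable (lebesgue_on {0<..<L}) f" using integrable_L2_mult[OF f one] by simp
  note [measurable] = continuous_L2[OF CX_continuous[OF u], unfolded L2_eq, THEN square_integrableD(1)]
    continuous_L2[OF CX_continuous[OF v], unfolded L2_eq, THEN square_integrableD(1)]
    f[unfolded L2_eq, THEN square_integrableD(1)]
  show ?thesis unfolding L2_inner_def
  proof (rule integral_dominated_convergence[where w="\<lambda>x. M * \<bar>f x\<bar>"])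
    show "integrable (lebesgue_on {0<..<L}) (\<lambda>x. M * \<bar>f x\<bar>)" using fint by simp
    show "AE x in lebesgue_on {0<..<L}. (\<lambda>n. v n x * f x) \<longlonglongrightarrow> u x * f x"
      by (intro AE_I2 tendsto_intros CX_conv(1)[OF L v u lim]) simp
    show "AE x in lebesgue_on {0<..<L}. norm (v n x * f x) \<le> M * \<bar>f x\<bar>" for n
      using M by (intro AE_I2) (auto simp: abs_mult intro!: mult_right_mono)
  qed measurable
qed

text \<open>Normalised indicators: the inner product with \<open>avg (a, b)\<close> is the mean value over the interval.\<close>

definition avg :: "real \<times> real \<Rightarrow> real \<Rightarrow> real" where
  "avg p x = indicator {fst p<..<snd p} x / (snd p - fst p)"

definition rational_subintervals :: "real \<Rightarrow> (real \<times> real) set" where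
  "rational_subintervals L = {(a, b). a \<in> \<rat> \<and> b \<in> \<rat> \<and> 0 \<le> a \<and> a < b \<and> b \<le> L}"

lemma countable_rational_subintervals: "countable (rational_subintervals L)"
  by (rule countable_subset[of _ "\<rat> \<times> \<rat>"]) (auto simp: rational_subintervals_def countable_rat)

lemma rational_subinterval_near:
  assumes L: "0 < L" and x: "x \<in> {0..L}" and d: "0 < d"
  obtains p where "p \<in> rational_subintervals L" "\<And>y. y \<in> {fst p<..<snd p} \<Longrightarrow> \<bar>y - x\<bar> < d"
proof -
  have "max 0 (x - d) < min L (x + d)" using L x d by auto
  from Rats_dense_in_real[OF this] obtain a where a: "a \<in> \<rat>" "max 0 (x - d) < a" "a < min L (x + d)" by blast
  from Rats_dense_in_real[OF a(3)] obtain b where b: "b \<in> \<rat>" "a < b" "b < min L (x + d)" by blast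
  show ?thesis using a b by (intro that[of "(a, b)"]) (auto simp: rational_subintervals_def abs_less_iff)
qed

lemma avg_L2: assumes p: "p \<in> rational_subintervals L" shows "avg p \<in> L2 L"
proof (rule L2_bounded)
  show "avg p \<in> borel_measurable (lebesgue_on {0<..<L})"
    unfolding avg_def[abs_def] by (intro borel_measurable_divide borel_measurable_indicator borel_measurable_const sets_restrict_space_iff[THEN iffD2])
      (use p in \<open>auto simp: rational_subintervals_def\<close>)
  show "\<bar>avg p x\<bar> \<le> 1 / \<bar>snd p - fst p\<bar>" for x by (auto simp: avg_def indicator_def)
qed

lemma L2_inner_avg_const:
  assumes L: "0 < L" and p: "p \<in> rational_subintervals L" shows "L2_inner L (\<lambda>x. c) (avg p) = c"
proof -
  have ab: "0 \<le> fst p" "fst p < snd p" "snd p \<le> L" using p by (auto simp: rational_subintervals_def)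
  have "(LINT x|lebesgue_on {0<..<L}. avg p x) = (LINT x|lebesgue. indicator {0<..<L} x *\<^sub>R avg p x)"
    by (rule integral_restrict_space) simp
  also have "\<dots> = (LINT x|lebesgue. indicator {fst p<..<snd p} x / (snd p - fst p))"
    using ab by (intro Bochner_Integration.integral_cong) (auto simp: avg_def indicator_def)
  also have "\<dots> = measure lebesgue {fst p<..<snd p} / (snd p - fst p)" by simp
  also have "\<dots> = 1" using ab by simp
  finally show ?thesis by (simp add: L2_inner_def)
qed

lemma avg_nonneg: "p \<in> rational_subintervals L \<Longrightarrow> 0 \<le> avg p x"
  by (auto simp: avg_def rational_subintervals_def indicator_def)

lemma L2_inner_avg_mono:
  assumes p: "p \<in> rational_subintervals L" and h: "h \<in> L2 L" "h' \<in> L2 L"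
    and le: "\<And>x. x \<in> {fst p<..<snd p} \<Longrightarrow> h x \<le> h' x"
  shows "L2_inner L h (avg p) \<le> L2_inner L h' (avg p)"
  unfolding L2_inner_def
proof (rule integral_mono)
  show "h x * avg p x \<le> h' x * avg p x" for x
    using le[of x] avg_nonneg[OF p, of x] by (cases "x \<in> {fst p<..<snd p}") (auto simp: avg_def intro: divide_right_mono)
qed (use integrable_L2_mult h avg_L2[OF p] in auto)

text \<open>Mean values are bounded by the supremum; conversely a continuous function that exceeds \<open>\<delta>\<close> somewhere
has a mean value above \<open>\<delta>\<close> over some small rational interval. Thus supremum-norm balls
are described by countably many functionals that make sense in \<open>L\<^sup>2\<close>, which is where the Gaussian law
is specified.\<close>

lemma sup_le_iff_avg:
  assumes L: "0 < L" and h: "continuous_on {0..L} h"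
  shows "(\<forall>x\<in>{0..L}. \<bar>h x\<bar> \<le> \<delta>) \<longleftrightarrow> (\<forall>p\<in>rational_subintervals L. \<bar>L2_inner L h (avg p)\<bar> \<le> \<delta>)"
proof
  assume le: "\<forall>x\<in>{0..L}. \<bar>h x\<bar> \<le> \<delta>"
  show "\<forall>p\<in>rational_subintervals L. \<bar>L2_inner L h (avg p)\<bar> \<le> \<delta>"
  proof
    fix p assume p: "p \<in> rational_subintervals L"
    have sub: "x \<in> {0..L}" if "x \<in> {fst p<..<snd p}" for x using that p by (auto simp: rational_subintervals_def)
    have c: "(\<lambda>x. c) \<in> L2 L" for c by (rule continuous_L2) simp
    have "L2_inner L h (avg p) \<le> L2_inner L (\<lambda>x. \<delta>) (avg p)"
      using le sub by (intro L2_inner_avg_mono p continuous_L2[OF h] c) (auto simp: abs_le_iff)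
    moreover have "L2_inner L (\<lambda>x. - \<delta>) (avg p) \<le> L2_inner L h (avg p)"
    proof (intro L2_inner_avg_mono p continuous_L2[OF h] c)
      fix x assume "x \<in> {fst p<..<snd p}"
      then have "\<bar>h x\<bar> \<le> \<delta>" using le sub by blast
      then show "- \<delta> \<le> h x" by linarith
    qed
    ultimately show "\<bar>L2_inner L h (avg p)\<bar> \<le> \<delta>" by (simp add: L2_inner_avg_const[OF L p] abs_le_iff)
  qed
next
  assume avg: "\<forall>p\<in>rational_subintervals L. \<bar>L2_inner L h (avg p)\<bar> \<le> \<delta>"
  have upper: "g x \<le> \<delta>" if g: "continuous_on {0..L} g" and x: "x \<in> {0..L}"
    and ag: "\<And>p. p \<in> rational_subintervals L \<Longrightarrow> L2_inner L g (avg p) \<le> \<delta>" for g x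
  proof (rule ccontr)
    assume "\<not> g x \<le> \<delta>"
    define \<eta> where "\<eta> = (g x - \<delta>) / 2"
    have \<eta>: "0 < \<eta>" "g x = \<delta> + 2 * \<eta>" using \<open>\<not> g x \<le> \<delta>\<close> by (auto simp: \<eta>_def field_simps)
    obtain d where d: "0 < d" "\<And>y. y \<in> {0..L} \<Longrightarrow> dist y x < d \<Longrightarrow> dist (g y) (g x) < \<eta>"
      using g x \<eta>(1) unfolding continuous_on_iff by blast
    obtain p where p: "p \<in> rational_subintervals L" "\<And>y. y \<in> {fst p<..<snd p} \<Longrightarrow> \<bar>y - x\<bar> < d"
      using rational_subinterval_near[OF L x d(1)] by blast
    have "L2_inner L (\<lambda>x. \<delta> + \<eta>) (avg p) \<le> L2_inner L g (avg p)"
    proof (intro L2_inner_avg_mono p(1) continuous_L2[OF g] continuous_L2 continuous_on_const)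
      fix y assume y: "y \<in> {fst p<..<snd p}"
      then have "y \<in> {0..L}" using p(1) by (auto simp: rational_subintervals_def)
      then have "\<bar>g y - g x\<bar> < \<eta>" using d(2)[of y] p(2)[OF y] by (simp add: dist_real_def)
      then show "\<delta> + \<eta> \<le> g y" using \<eta>(2) by linarith
    qed
    then show False using ag[OF p(1)] \<eta>(1) by (simp add: L2_inner_avg_const[OF L p(1)])
  qed
  show "\<forall>x\<in>{0..L}. \<bar>h x\<bar> \<le> \<delta>"
  proof
    fix x assume x: "x \<in> {0..L}"
    have "h x \<le> \<delta>" using avg by (intro upper[OF h x]) (auto simp: abs_le_iff)
    moreover have "- h x \<le> \<delta>"
    proof (rule upper[OF _ x])
      show "continuous_on {0..L} (\<lambda>x. - h x)" by (intro continuous_intros h)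
      show "L2_inner L (\<lambda>x. - h x) (avg p) \<le> \<delta>" if "p \<in> rational_subintervals L" for p
        using avg that by (auto simp: L2_inner_def abs_le_iff)
    qed
    ultimately show "\<bar>h x\<bar> \<le> \<delta>" by linarith
  qed
qed

definition test_fun :: "real \<Rightarrow> nat \<Rightarrow> real \<Rightarrow> real" where
  "test_fun L j = avg (from_nat_into (rational_subintervals L) j)"

lemma rational_subintervals_nonempty: "0 < L \<Longrightarrow> rational_subintervals L \<noteq> {}"
  using rational_subinterval_near[of L 0 1] by force

lemma test_fun_L2: "0 < L \<Longrightarrow> test_fun L j \<in> L2 L"
  unfolding test_fun_def by (intro avg_L2 from_nat_into rational_subintervals_nonempty)

lemma sup_le_iff_test_fun:
  assumes "0 < L" "continuous_on {0..L} h"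
  shows "(\<forall>x\<in>{0..L}. \<bar>h x\<bar> \<le> \<delta>) \<longleftrightarrow> (\<forall>j. \<bar>L2_inner L h (test_fun L j)\<bar> \<le> \<delta>)"
proof -
  have "rational_subintervals L = range (from_nat_into (rational_subintervals L))"
    by (rule range_from_nat_into[symmetric, OF rational_subintervals_nonempty[OF assms(1)] countable_rational_subintervals])
  then show ?thesis unfolding sup_le_iff_avg[OF assms] test_fun_def by (metis rangeE rangeI)
qed

text \<open>Each function is determined up to \<open>\<delta>\<close> by the mesh of a grid on which it oscillates little and its
rounded values at the grid points; there are countably many such data.\<close>

lemma CX_countable_cover:
  assumes L: "0 < L" and \<delta>: "0 < \<delta>"
  obtains K where "countable K" "K \<subseteq> mspace (CX L)" "mspace (CX L) \<subseteq> (\<Union>z\<in>K. mball_of (CX L) z \<delta>)"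
proof -
  \<comment> \<open>Functions with the same data differ by at most \<open>3 * \<eta>\<close>: rounding and two oscillations.\<close>
  define \<eta> where "\<eta> = \<delta> / 8"
  have \<eta>: "0 < \<eta>" using \<delta> by (simp add: \<eta>_def)
  have "\<exists>m::nat. 0 < m \<and> (\<forall>x\<in>{0..L}. \<forall>y\<in>{0..L}. \<bar>x - y\<bar> \<le> L / real m \<longrightarrow> \<bar>u x - u y\<bar> \<le> \<eta>)"
    if u: "u \<in> mspace (CX L)" for u
  proof -
    have "uniformly_continuous_on {0..L} u" by (rule compact_uniformly_continuous[OF CX_continuous[OF u] compact_Icc])
    then obtain d where d: "0 < d" "\<And>x y. x \<in> {0..L} \<Longrightarrow> y \<in> {0..L} \<Longrightarrow> dist y x < d \<Longrightarrow> dist (u y) (u x) < \<eta>"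
      using \<eta> unfolding uniformly_continuous_on_def by metis
    obtain m :: nat where m: "L / d < real m" using reals_Archimedean2 by blast
    have m0: "0 < m" using m L d(1) by (metis divide_pos_pos gr0I less_asym of_nat_0)
    have "L / real m < d" using m m0 d(1) by (simp add: field_simps)
    then show ?thesis using m0 d(2) by (intro exI[of _ m]) (force simp: dist_real_def less_imp_le)
  qed
  then obtain m where m: "\<And>u. u \<in> mspace (CX L) \<Longrightarrow> 0 < m u" and
    mosc: "\<And>u x y. u \<in> mspace (CX L) \<Longrightarrow> x \<in> {0..L} \<Longrightarrow> y \<in> {0..L} \<Longrightarrow> \<bar>x - y\<bar> \<le> L / real (m u) \<Longrightarrow> \<bar>u x - u y\<bar> \<le> \<eta>"
    by metis
  define code where "code u = (m u, map (\<lambda>i. \<lfloor>u (real i * L / real (m u)) / \<eta>\<rfloor>) [0..<Suc (m u)])" for u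
  have near: "mdist (CX L) v u < \<delta>" if u: "u \<in> mspace (CX L)" and v: "v \<in> mspace (CX L)" and eq: "code u = code v" for u v
  proof -
    have mm: "m u = m v" using eq by (simp add: code_def)
    have "\<bar>v x - u x\<bar> \<le> 3 * \<eta>" if x: "x \<in> {0..L}" for x
    proof -
      define i where "i = nat \<lfloor>x * real (m u) / L\<rfloor>"
      define y where "y = real i * L / real (m u)"
      have q0: "0 \<le> x * real (m u) / L" using x L by simp
      have i: "real i \<le> x * real (m u) / L" "x * real (m u) / L < real i + 1"
        using q0 by (auto simp: i_def)
      have mp: "0 < real (m u)" using m[OF u] by simp
      have yx: "y \<le> x" "x \<le> y + L / real (m u)" using i mp L by (auto simp: y_def field_simps)
      have y: "y \<in> {0..L}" using yx x L mp by (auto simp: y_def)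
      have im: "i < Suc (m u)"
      proof -
        have "x * real (m u) / L \<le> real (m u)" using x L by (simp add: field_simps mult_right_mono)
        then have "real i \<le> real (m u)" using i by linarith
        then show ?thesis by simp
      qed
      have "\<lfloor>u y / \<eta>\<rfloor> = \<lfloor>v y / \<eta>\<rfloor>"
      proof -
        have "snd (code u) ! i = snd (code v) ! i" using eq by simp
        then show ?thesis using im mm by (simp add: code_def y_def del: upt_Suc)
      qed
      then have "\<bar>u y / \<eta> - v y / \<eta>\<bar> \<le> 1" by linarith
      then have "\<bar>u y - v y\<bar> \<le> \<eta>" using \<eta> by (simp add: diff_divide_distrib[symmetric] abs_divide field_simps)
      moreover have "\<bar>u x - u y\<bar> \<le> \<eta>" using yx by (intro mosc[OF u x y]) auto
      moreover have "\<bar>v x - v y\<bar> \<le> \<eta>" using yx mm by (intro mosc[OF v x y]) auto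
      ultimately show ?thesis by linarith
    qed
    then have "mdist (CX L) v u \<le> 3 * \<eta>" using mdist_CX_le[OF L v u] by blast
    then show ?thesis using \<delta> by (simp add: \<eta>_def)
  qed
  define K where "K = inv_into (mspace (CX L)) code ` (code ` mspace (CX L))"
  show ?thesis
  proof
    show "countable K" unfolding K_def by simp
    show "K \<subseteq> mspace (CX L)" unfolding K_def by (auto intro: inv_into_into)
    show "mspace (CX L) \<subseteq> (\<Union>z\<in>K. mball_of (CX L) z \<delta>)"
    proof
      fix u assume u: "u \<in> mspace (CX L)"
      let ?z = "inv_into (mspace (CX L)) code (code u)"
      have z: "?z \<in> mspace (CX L)" "code ?z = code u" using u inv_into_into[of "code u" code "mspace (CX L)"] f_inv_into_f[of "code u" code "mspace (CX L)"]
        by auto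
      then have "u \<in> mball_of (CX L) ?z \<delta>" using near[OF u z(1)] u by simp
      then show "u \<in> (\<Union>z\<in>K. mball_of (CX L) z \<delta>)" unfolding K_def using u by blast
    qed
  qed
qed

section \<open>Small balls under the Gaussian prior\<close>

text \<open>The characteristic function at 1 of the centred law: the only value needed of the law of a linear
functional, as the functional may be rescaled.\<close>

lemma iexp_normal_law:
  assumes s: "0 < s"
  shows "(CLINT x|density lborel (\<lambda>x. ennreal (normal_density m s x)). iexp (x - m)) = complex_of_real (exp (- s\<^sup>2 / 2))"
proof -
  have "(CLINT x|density lborel (\<lambda>x. ennreal (normal_density m s x)). iexp (x - m)) = (CLINT x|lborel. normal_density m s x *\<^sub>R iexp (x - m))"
    by (subst integral_density) (auto simp: normal_density_nonneg)
  also have "\<dots> = (CLINT x|lborel. normal_density 0 s x *\<^sub>R iexp (1 * x))"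
    by (subst lborel_integral_real_affine[where c=1 and t=m]) (auto simp: normal_density_def)
  also have "\<dots> = char (gauss s) 1"
    unfolding char_def gauss_def by (subst integral_density) (auto simp: normal_density_nonneg)
  also have "\<dots> = complex_of_real (exp (- s\<^sup>2 / 2))" using char_gauss[OF s, of 1] by simp
  finally show ?thesis .
qed

lemma gauss_unit_interval_le:
  assumes s: "0 < s" shows "measure (gauss s) {-1..1} \<le> 2 / sqrt (2 * pi * s\<^sup>2)"
proof -
  interpret prob_space "gauss s" by (rule prob_space_gauss[OF s])
  have "emeasure (gauss s) {-1..1} = (\<integral>\<^sup>+x. ennreal (normal_density 0 s x) * indicator {-1..1} x \<partial>lborel)"
    by (simp add: gauss_def emeasure_density)
  also have "\<dots> \<le> (\<integral>\<^sup>+x. ennreal (1 / sqrt (2 * pi * s\<^sup>2)) * indicator {-1..1::real} x \<partial>lborel)"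
  proof (rule nn_integral_mono)
    fix x
    have "normal_density 0 s x \<le> 1 / sqrt (2 * pi * s\<^sup>2)"
      using s by (simp add: normal_density_def divide_right_mono)
    then have "ennreal (normal_density 0 s x) \<le> ennreal (1 / sqrt (2 * pi * s\<^sup>2))" by (rule ennreal_leI)
    then show "ennreal (normal_density 0 s x) * indicator {-1..1} x \<le> ennreal (1 / sqrt (2 * pi * s\<^sup>2)) * indicator {-1..1} x"
      by (auto simp: indicator_def)
  qed
  also have "\<dots> = ennreal (1 / sqrt (2 * pi * s\<^sup>2)) * 2" by (simp add: nn_integral_cmult)
  also have "\<dots> = ennreal (2 / sqrt (2 * pi * s\<^sup>2))"
    by (simp add: ennreal_mult''[symmetric] flip: ennreal_numeral)
  finally show ?thesis using s by (simp add: emeasure_eq_measure ennreal_le_iff)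
qed

text \<open>A Gaussian measure on the continuous functions whose covariance is diagonal with positive
eigenvalues in a basis of continuous functions. That such a measure exists already forces the
eigenvalues to be bounded (\<open>c_bounded\<close>).\<close>

locale gaussian_prior =
  fixes L :: real and e :: "nat \<Rightarrow> real \<Rightarrow> real" and c :: "nat \<Rightarrow> real" and m :: "real \<Rightarrow> real"
    and \<mu> :: "(real \<Rightarrow> real) measure"
  assumes L: "0 < L" and onb: "orthonormal_basis_L2 L e" and e_cont: "\<And>k. continuous_on {0..L} (e k)"
    and c_pos: "\<And>k. 0 < c k" and m: "m \<in> mspace (CX L)" and gaussian: "gaussian_CX L m (diag_op L e c) \<mu>"
begin

interpretation B: orthonormal_basis "lebesgue_on {0<..<L}" e
  by (rule orthonormal_basis_of_L2[OF onb])

sublocale prob_space \<mu> using gaussian by (simp add: gaussian_CX_def)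

lemma sets_\<mu>: "sets \<mu> = sets (borel_CX L)" using gaussian by (simp add: gaussian_CX_def)

lemma space_\<mu>: "space \<mu> = mspace (CX L)"
  using sets_eq_imp_space_eq[OF sets_\<mu>] by (simp add: space_borel_CX)

definition coord :: "nat \<Rightarrow> (real \<Rightarrow> real) \<Rightarrow> real" where
  "coord k u = L2_inner L (\<lambda>x. u x - m x) (e k)"

lemma e_L2: "e k \<in> L2 L" by (rule continuous_L2[OF e_cont])

lemma CX_L2: "u \<in> mspace (CX L) \<Longrightarrow> u \<in> L2 L" by (rule continuous_L2[OF CX_continuous])

lemma diff_continuous:
  "u \<in> mspace (CX L) \<Longrightarrow> v \<in> mspace (CX L) \<Longrightarrow> continuous_on {0..L} (\<lambda>x. u x - v x)"
  by (intro continuous_on_diff CX_continuous)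

lemma inner_measurable: assumes f: "f \<in> L2 L" shows "(\<lambda>u. L2_inner L u f) \<in> borel_measurable \<mu>"
proof -
  have "(\<lambda>u. L2_inner L u f) \<in> borel_measurable (borel_CX L)"
    by (intro continuous_map_CX_measurable continuous_map_CX_sequentially L2_inner_tendsto[OF L] f)
  then show ?thesis by (simp cong: measurable_cong_sets add: sets_\<mu>)
qed

lemma inner_diff_measurable: assumes f: "f \<in> L2 L" shows "(\<lambda>u. L2_inner L (\<lambda>x. u x - m x) f) \<in> borel_measurable \<mu>"
proof -
  have "L2_inner L (\<lambda>x. u x - m x) f = L2_inner L u f - L2_inner L m f" if "u \<in> space \<mu>" for u
    using that by (intro L2_inner_diff CX_L2 m f) (simp add: space_\<mu>)
  then show ?thesis
    using inner_measurable[OF f] by (simp cong: measurable_cong)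
qed

lemma inner_span_covariance:
  "L2_inner L (B.series t N) (diag_op L e c (B.series t N)) = (\<Sum>k<N. c k * (t k)\<^sup>2)"
proof -
  let ?f = "B.series t N"
  have f: "?f \<in> L2 L" using B.series_square_integrable by (simp add: L2_eq)
  have cf: "L2_inner L ?f (e k) = (if k < N then t k else 0)" for k
    using B.coef_series by (simp add: L2_inner_def)
  have "summable (\<lambda>k. (c k * L2_inner L ?f (e k))\<^sup>2)"
    by (rule summable_finite[of "{..<N}"]) (auto simp: cf)
  note d = diag_op_coef[OF onb f this]
  have "L2_inner L ?f (diag_op L e c ?f) = L2_inner L (diag_op L e c ?f) ?f" by (rule L2_inner_commute)
  also have "\<dots> = (\<Sum>k<N. t k * L2_inner L (diag_op L e c ?f) (e k))"
    using B.inner_series[of "diag_op L e c ?f" t N] d(1) by (simp add: L2_inner_def L2_eq)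
  also have "\<dots> = (\<Sum>k<N. c k * (t k)\<^sup>2)"
    by (intro sum.cong refl) (simp add: d(2) cf power2_eq_square)
  finally show ?thesis .
qed

lemma char_coords:
  "(CLINT u|\<mu>. iexp (\<Sum>k<N. t k * coord k u)) = complex_of_real (exp (- (\<Sum>k<N. (sqrt (c k) * t k)\<^sup>2) / 2))"
proof -
  let ?f = "B.series t N" and ?V = "\<Sum>k<N. c k * (t k)\<^sup>2"
  have f: "?f \<in> L2 L" using B.series_square_integrable by (simp add: L2_eq)
  have V: "(\<Sum>k<N. (sqrt (c k) * t k)\<^sup>2) = ?V"
    using c_pos by (intro sum.cong refl) (simp add: power_mult_distrib less_imp_le)
  have lin: "(\<Sum>k<N. t k * coord k u) = L2_inner L ?f u - L2_inner L ?f m" if "u \<in> space \<mu>" for u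
  proof -
    have u: "u \<in> mspace (CX L)" using that by (simp add: space_\<mu>)
    have "L2_inner L (\<lambda>x. u x - m x) ?f = (\<Sum>k<N. t k * coord k u)"
      unfolding L2_inner_def coord_def using continuous_L2[OF diff_continuous[OF u m]]
      by (intro B.inner_series) (simp add: L2_eq)
    moreover have "L2_inner L (\<lambda>x. u x - m x) ?f = L2_inner L u ?f - L2_inner L m ?f"
      by (intro L2_inner_diff CX_L2 u m f)
    ultimately show ?thesis by (simp add: L2_inner_commute)
  qed
  have "(CLINT u|\<mu>. iexp (\<Sum>k<N. t k * coord k u)) = (CLINT u|\<mu>. iexp (L2_inner L ?f u - L2_inner L ?f m))"
    using lin by (intro Bochner_Integration.integral_cong) auto
  also have "\<dots> = complex_of_real (exp (- ?V / 2))"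
  proof (cases "?V = 0")
    case True
    then have "c k * (t k)\<^sup>2 = 0" if "k < N" for k
      using that c_pos by (subst (asm) sum_nonneg_eq_0_iff) (auto simp: less_imp_le)
    then have t0: "t k = 0" if "k < N" for k using that c_pos[of k] by (metis less_irrefl mult_eq_0_iff power_eq_0_iff)
    have "(CLINT u|\<mu>. iexp (L2_inner L ?f u - L2_inner L ?f m)) = (CLINT u|\<mu>. 1)"
      using t0 by (intro Bochner_Integration.integral_cong) (auto simp: lin[symmetric])
    then show ?thesis using True by (simp add: prob_space)
  next
    case False
    moreover have "0 \<le> ?V" using c_pos by (intro sum_nonneg) (simp add: less_imp_le)
    ultimately have V0: "0 < ?V" by simp
    have meas: "L2_inner L ?f \<in> borel_measurable \<mu>"
      using inner_measurable[OF f] by (simp add: L2_inner_commute[of L ?f, abs_def])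
    have law: "distr \<mu> borel (L2_inner L ?f) = density lborel (\<lambda>x. ennreal (normal_density (L2_inner L ?f m) (sqrt ?V) x))"
      using gaussian f False by (simp add: gaussian_CX_def inner_span_covariance normal_law_def)
    have "(CLINT u|\<mu>. iexp (L2_inner L ?f u - L2_inner L ?f m)) = (CLINT x|distr \<mu> borel (L2_inner L ?f). iexp (x - L2_inner L ?f m))"
      using meas by (subst integral_distr) auto
    also have "\<dots> = complex_of_real (exp (- (sqrt ?V)\<^sup>2 / 2))"
      unfolding law by (rule iexp_normal_law) (use V0 in simp)
    finally show ?thesis using V0 by simp
  qed
  finally show ?thesis by (simp only: V)
qed

text \<open>Independence comes from the variances of finite combinations of basis functions; the pointwise
convergence of the series for the functionals is Parseval's identity, which holds for every
continuous function.\<close>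

lemma series_locale:
  "gaussian_series \<mu> coord (\<lambda>k. sqrt (c k)) (\<lambda>j k. L2_inner L (test_fun L j) (e k)) (\<lambda>j u. L2_inner L (\<lambda>x. u x - m x) (test_fun L j))"
proof
  show [measurable]: "coord k \<in> borel_measurable \<mu>" for k unfolding coord_def by (rule inner_diff_measurable[OF e_L2])
  show "(\<lambda>u. L2_inner L (\<lambda>x. u x - m x) (test_fun L j)) \<in> borel_measurable \<mu>" for j
    by (rule inner_diff_measurable[OF test_fun_L2[OF L]])
  show pos: "0 < sqrt (c k)" for k using c_pos by simp
  show "distr \<mu> (PiM {..<N} (\<lambda>k. gauss (sqrt (c k)))) (\<lambda>\<omega>. \<lambda>k\<in>{..<N}. coord k \<omega>) = PiM {..<N} (\<lambda>k. gauss (sqrt (c k)))" for N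
    by (rule distr_PiM_gauss_of_char[OF _ pos _ char_coords]) auto
  show "(\<lambda>k. L2_inner L (test_fun L j) (e k) * coord k u) sums L2_inner L (\<lambda>x. u x - m x) (test_fun L j)"
    if "u \<in> space \<mu>" for j u
    using B.Parseval[of "\<lambda>x. u x - m x" "test_fun L j"] continuous_L2[OF diff_continuous[OF _ m], of u] test_fun_L2[OF L, of j] that
    by (subst L2_inner_commute) (simp add: L2_inner_def coord_def L2_eq space_\<mu>)
qed

interpretation G: gaussian_series \<mu> coord "\<lambda>k. sqrt (c k)" "\<lambda>j k. L2_inner L (test_fun L j) (e k)"
  "\<lambda>j u. L2_inner L (\<lambda>x. u x - m x) (test_fun L j)"
  by (rule series_locale)

text \<open>By Bessel's inequality the coordinates of each function tend to 0, so a coordinate lies in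
\<open>{- 1..1}\<close> with probability tending to 1. The variance of a normal variable with probability at least
\<open>1 / 2\<close> on \<open>{- 1..1}\<close> is bounded, because its density is.\<close>

lemma c_bounded: "\<exists>K. \<forall>k. c k \<le> K"
proof -
  define A where "A k = {u\<in>space \<mu>. coord k u \<in> {-1..1}}" for k
  have Am[measurable]: "A k \<in> events" for k unfolding A_def by measurable
  have "(\<lambda>k. LINT u|\<mu>. indicator (A k) u) \<longlonglongrightarrow> (LINT u|\<mu>. (1::real))"
  proof (rule integral_dominated_convergence[where w="\<lambda>_. 1"])
    show "AE u in \<mu>. (\<lambda>k. indicator (A k) u :: real) \<longlonglongrightarrow> 1"
    proof (rule AE_I2)
      fix u assume u: "u \<in> space \<mu>"
      have "summable (\<lambda>k. (coord k u)\<^sup>2)"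
        using B.summable_coef[of "\<lambda>x. u x - m x"] continuous_L2[OF diff_continuous[OF _ m], of u] u
        by (simp add: coord_def L2_inner_def L2_eq space_\<mu>)
      then have "(\<lambda>k. (coord k u)\<^sup>2) \<longlonglongrightarrow> 0" by (rule summable_LIMSEQ_zero)
      then have "\<forall>\<^sub>F k in sequentially. (coord k u)\<^sup>2 < 1" by (rule order_tendstoD) simp
      then have "\<forall>\<^sub>F k in sequentially. indicator (A k) u = (1::real)"
      proof eventually_elim
        case (elim k)
        then have "\<bar>coord k u\<bar> < 1" by (simp add: abs_square_less_1)
        then have "u \<in> A k" using u by (auto simp: A_def abs_less_iff)
        then show ?case by simp
      qed
      then show "(\<lambda>k. indicator (A k) u :: real) \<longlonglongrightarrow> 1" by (rule tendsto_eventually)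
    qed
  qed auto
  then have "(\<lambda>k. prob (A k)) \<longlonglongrightarrow> 1" by (simp add: prob_space Int_absorb2 sets.sets_into_space)
  then have "\<forall>\<^sub>F k in sequentially. 1 / 2 < prob (A k)" by (rule order_tendstoD) simp
  then obtain N where N: "\<And>k. N \<le> k \<Longrightarrow> 1 / 2 < prob (A k)" by (auto simp: eventually_sequentially)
  have big: "c k \<le> 16" if "N \<le> k" for k
  proof -
    let ?s = "sqrt (c k)"
    have s: "0 < ?s" using c_pos by simp
    let ?J = "{..<Suc k}"
    have "distr \<mu> borel (coord k) = distr (distr \<mu> (PiM ?J (\<lambda>k. gauss (sqrt (c k)))) (\<lambda>\<omega>. \<lambda>k\<in>?J. coord k \<omega>)) (gauss ?s) (\<lambda>x. x k)"
      by (subst distr_distr) (auto simp: comp_def intro!: distr_cong)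
    also have "\<dots> = gauss ?s" unfolding G.law by (rule distr_PiM_component) (auto simp: prob_space_gauss c_pos)
    finally have "measure (gauss ?s) {-1..1} = measure (distr \<mu> borel (coord k)) {-1..1}" by simp
    also have "\<dots> = prob (A k)" by (subst measure_distr) (auto simp: A_def intro!: arg_cong[where f=prob])
    finally have "prob (A k) = measure (gauss ?s) {-1..1}" by (rule sym)
    also have "\<dots> \<le> 2 / sqrt (2 * pi * ?s\<^sup>2)" by (rule gauss_unit_interval_le[OF s])
    also have "?s\<^sup>2 = c k" using c_pos[of k] by (intro real_sqrt_pow2 less_imp_le)
    finally have "1 / 2 < 2 / sqrt (2 * pi * c k)" using N[OF that] by (rule less_le_trans[rotated])
    moreover have "R < 4" if "1 / 2 < 2 / R" "0 < R" for R :: real using that by (simp add: field_simps)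
    moreover have "0 < sqrt (2 * pi * c k)" using c_pos[of k] by simp
    ultimately have "sqrt (2 * pi * c k) < 4" by blast
    moreover have "sqrt 16 = 4" by (rule real_sqrt_unique) auto
    ultimately have "2 * pi * c k < 16" using real_sqrt_less_iff[of "2 * pi * c k" 16] by simp
    moreover have "1 * c k \<le> (2 * pi) * c k" using pi_ge_two c_pos[of k] by (intro mult_right_mono) auto
    ultimately show ?thesis by simp
  qed
  have "c k \<le> 16 + (\<Sum>j<N. c j)" for k
  proof (cases "k < N")
    case True
    then have "c k \<le> (\<Sum>j<N. c j)" using c_pos by (intro member_le_sum) (auto simp: less_imp_le)
    then show ?thesis by simp
  next
    case False
    moreover have "0 \<le> (\<Sum>j<N. c j)" using c_pos by (intro sum_nonneg) (simp add: less_imp_le)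
    ultimately show ?thesis using big[of k] by simp
  qed
  then show ?thesis by blast
qed

definition rate :: "(real \<Rightarrow> real) \<Rightarrow> ereal" where
  "rate u = (if (\<lambda>x. u x - m x) \<in> cameron_martin L (diag_op L e (\<lambda>k. sqrt (c k)))
     then ereal (1 / 2 * (cm_norm L (diag_op L e (\<lambda>k. sqrt (c k))) (\<lambda>x. u x - m x))\<^sup>2) else \<infinity>)"

lemma rate_nonneg: "0 \<le> rate u" by (simp add: rate_def)

text \<open>Sublevel sets of the rate are given by conditions on finitely many coordinates at a time; lower
semicontinuity is immediate from this form.\<close>

lemma rate_le_iff:
  assumes u: "u \<in> mspace (CX L)"
  shows "rate u \<le> ereal r \<longleftrightarrow> (\<forall>N. (\<Sum>k<N. (coord k u / sqrt (c k))\<^sup>2) \<le> 2 * r)"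
proof -
  let ?h = "\<lambda>x. u x - m x" and ?R = "diag_op L e (\<lambda>k. sqrt (c k))" and ?a = "\<lambda>k. (coord k u / sqrt (c k))\<^sup>2"
  obtain K where K: "\<And>k. c k \<le> K" using c_bounded by blast
  have cK: "(sqrt (c k))\<^sup>2 \<le> K" "0 < sqrt (c k)" for k using K[of k] c_pos[of k] by auto
  have h: "?h \<in> L2 L" by (rule continuous_L2[OF diff_continuous[OF u m]])
  have iff: "?h \<in> cameron_martin L ?R \<longleftrightarrow> summable ?a"
    using cameron_martin_iff(1)[OF onb, of "\<lambda>k. sqrt (c k)", OF cK h] by (simp add: coord_def)
  have norm: "(cm_norm L ?R ?h)\<^sup>2 = (\<Sum>k. ?a k)" if "?h \<in> cameron_martin L ?R"
    using cameron_martin_iff(2)[OF onb, of "\<lambda>k. sqrt (c k)", OF cK h that] by (simp add: coord_def)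
  show ?thesis
  proof
    assume le: "rate u \<le> ereal r"
    then have mem: "?h \<in> cameron_martin L ?R" by (auto simp: rate_def split: if_splits)
    have "(\<Sum>k<N. ?a k) \<le> (\<Sum>k. ?a k)" for N using iff mem by (intro sum_le_suminf) auto
    moreover have "(\<Sum>k. ?a k) \<le> 2 * r" using le mem norm[OF mem] by (simp add: rate_def)
    ultimately show "\<forall>N. (\<Sum>k<N. ?a k) \<le> 2 * r" using order_trans by blast
  next
    assume le: "\<forall>N. (\<Sum>k<N. ?a k) \<le> 2 * r"
    have sm: "summable ?a" by (rule summableI_nonneg_bounded[where x="2 * r"]) (use le in auto)
    have "(\<Sum>k. ?a k) \<le> 2 * r" using le by (intro suminf_le_const sm) auto
    then show "rate u \<le> ereal r" using sm iff norm by (simp add: rate_def)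
  qed
qed

lemma rate_centre: "rate m = 0"
proof -
  have "coord k m = 0" for k by (simp add: coord_def L2_inner_def)
  then have "rate m \<le> ereal 0" unfolding rate_le_iff[OF m] by simp
  then have "rate m \<le> 0" by (simp only: zero_ereal_def)
  then show ?thesis using rate_nonneg[of m] by (rule antisym)
qed

lemma coord_tendsto:
  assumes v: "\<And>n::nat. v n \<in> mspace (CX L)" and u: "u \<in> mspace (CX L)" and lim: "(\<lambda>n. mdist (CX L) (v n) u) \<longlonglongrightarrow> 0"
  shows "(\<lambda>n. coord k (v n)) \<longlonglongrightarrow> coord k u"
proof -
  have "coord k w = L2_inner L w (e k) - L2_inner L m (e k)" if "w \<in> mspace (CX L)" for w
    unfolding coord_def by (intro L2_inner_diff CX_L2 that m e_L2)
  then show ?thesis using v u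
    by (simp add: tendsto_diff L2_inner_tendsto[OF L v u lim e_L2])
qed

lemma rate_lsc:
  assumes v: "\<And>n::nat. v n \<in> mspace (CX L)" and u: "u \<in> mspace (CX L)" and lim: "(\<lambda>n. mdist (CX L) (v n) u) \<longlonglongrightarrow> 0"
    and le: "\<And>n. rate (v n) \<le> ereal r"
  shows "rate u \<le> ereal r"
  unfolding rate_le_iff[OF u]
proof
  fix N
  have "sqrt (c k) \<noteq> 0" for k using c_pos[of k] by simp
  then have "(\<lambda>n. \<Sum>k<N. (coord k (v n) / sqrt (c k))\<^sup>2) \<longlonglongrightarrow> (\<Sum>k<N. (coord k u / sqrt (c k))\<^sup>2)"
    by (intro tendsto_intros coord_tendsto[OF v u lim])
  then show "(\<Sum>k<N. (coord k u / sqrt (c k))\<^sup>2) \<le> 2 * r"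
    by (rule LIMSEQ_le_const2) (use le rate_le_iff[OF v] in blast)
qed

lemma mcball_eq:
  assumes z: "z \<in> mspace (CX L)"
  shows "mcball_of (CX L) z \<delta> = {u\<in>space \<mu>. \<forall>j. \<bar>L2_inner L (\<lambda>x. u x - m x) (test_fun L j) - L2_inner L (\<lambda>x. z x - m x) (test_fun L j)\<bar> \<le> \<delta>}"
proof -
  have "mdist (CX L) z u \<le> \<delta> \<longleftrightarrow> (\<forall>j. \<bar>L2_inner L (\<lambda>x. u x - m x) (test_fun L j) - L2_inner L (\<lambda>x. z x - m x) (test_fun L j)\<bar> \<le> \<delta>)"
    if u: "u \<in> mspace (CX L)" for u
  proof -
    have "mdist (CX L) z u \<le> \<delta> \<longleftrightarrow> (\<forall>x\<in>{0..L}. \<bar>u x - z x\<bar> \<le> \<delta>)"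
      by (simp add: mdist_CX_le[OF L z u] abs_minus_commute)
    also have "\<dots> \<longleftrightarrow> (\<forall>j. \<bar>L2_inner L (\<lambda>x. u x - z x) (test_fun L j)\<bar> \<le> \<delta>)"
      by (rule sup_le_iff_test_fun[OF L diff_continuous[OF u z]])
    finally show ?thesis
      using L2_inner_diff[OF CX_L2[OF u] CX_L2[OF z] test_fun_L2[OF L]]
        L2_inner_diff[OF CX_L2[OF u] CX_L2[OF m] test_fun_L2[OF L]]
        L2_inner_diff[OF CX_L2[OF z] CX_L2[OF m] test_fun_L2[OF L]] by simp
  qed
  then show ?thesis using z by (auto simp: space_\<mu>)
qed

lemma mcball_centre_eq:
  "mcball_of (CX L) m \<delta> = {u\<in>space \<mu>. \<forall>j. \<bar>L2_inner L (\<lambda>x. u x - m x) (test_fun L j)\<bar> \<le> \<delta>}"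
proof -
  have "L2_inner L (\<lambda>x. m x - m x) f = 0" for f by (simp add: L2_inner_def)
  then show ?thesis unfolding mcball_eq[OF m] by simp
qed

lemma sets_mcball[measurable]: "mcball_of (CX L) z \<delta> \<in> events"
proof (cases "z \<in> mspace (CX L)")
  case True
  show ?thesis unfolding mcball_eq[OF True] using G.l_measurable by measurable
next
  case False
  then have "mcball_of (CX L) z \<delta> = {}" by auto
  then show ?thesis by simp
qed

lemma mcball_lower:
  assumes h: "h \<in> mspace (CX L)" and r: "rate h \<le> ereal r"
  shows "exp (- r) * prob (mcball_of (CX L) m \<delta>) \<le> prob (mcball_of (CX L) h \<delta>)"
proof -
  have "exp (- (2 * r) / 2) * prob (mcball_of (CX L) m \<delta>) \<le> prob (mcball_of (CX L) h \<delta>)"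
    unfolding mcball_eq[OF h] mcball_centre_eq
  proof (rule G.prob_ball_lower[where h="\<lambda>k. coord k h"])
    show "(\<lambda>k. L2_inner L (test_fun L j) (e k) * coord k h) sums L2_inner L (\<lambda>x. h x - m x) (test_fun L j)" for j
      by (rule G.conv) (use h in \<open>simp add: space_\<mu>\<close>)
    show "(\<Sum>k<N. (coord k h / sqrt (c k))\<^sup>2) \<le> 2 * r" for N using r rate_le_iff[OF h] by blast
  qed
  then show ?thesis by simp
qed

lemma mcball_upper:
  assumes z: "z \<in> mspace (CX L)" and \<epsilon>: "0 < \<epsilon>"
    and R: "\<And>N h. \<forall>j<n0. \<bar>(\<Sum>k<N. L2_inner L (test_fun L j) (e k) * h k) - L2_inner L (\<lambda>x. z x - m x) (test_fun L j)\<bar> \<le> \<delta> + \<epsilon>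
      \<Longrightarrow> 2 * R \<le> (\<Sum>k<N. (h k / sqrt (c k))\<^sup>2)"
  shows "prob (mcball_of (CX L) z \<delta>) \<le> exp (- R) * prob (mcball_of (CX L) m \<delta>)"
  using G.prob_ball_upper[OF \<epsilon> R] unfolding mcball_eq[OF z] mcball_centre_eq by simp

lemma mcball_le_centre:
  assumes z: "z \<in> mspace (CX L)"
  shows "prob (mcball_of (CX L) z \<delta>) \<le> prob (mcball_of (CX L) m \<delta>)"
  using mcball_upper[OF z, of 1 0 \<delta> 0] by (simp add: sum_nonneg)

lemma sets_mball[measurable]: "mball_of (CX L) z \<delta> \<in> events"
proof -
  interpret X: Metric_space "mspace (CX L)" "mdist (CX L)" by (rule Metric_space_mspace_mdist)
  show ?thesis unfolding sets_\<mu> by (rule sets_borel_CX_open) (simp add: mball_of_def mtopology_of_def)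
qed

lemma mball_Lim:
  assumes \<delta>: "0 < \<delta>"
  shows "(\<lambda>n. prob (mcball_of (CX L) z (\<delta> - \<delta> / (real n + 1)))) \<longlonglongrightarrow> prob (mball_of (CX L) z \<delta>)"
proof -
  let ?B = "\<lambda>n. mcball_of (CX L) z (\<delta> - \<delta> / (real n + 1))"
  have "incseq ?B"
  proof (rule incseq_SucI)
    fix n
    have "\<delta> / (real (Suc n) + 1) \<le> \<delta> / (real n + 1)" using \<delta> by (intro divide_left_mono) auto
    then show "?B n \<le> ?B (Suc n)" by auto
  qed
  then have "(\<lambda>n. prob (?B n)) \<longlonglongrightarrow> prob (\<Union>n. ?B n)" by (intro finite_Lim_measure_incseq) auto
  also have "(\<Union>n. ?B n) = mball_of (CX L) z \<delta>"
  proof (intro equalityI subsetI)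
    fix u assume "u \<in> (\<Union>n. ?B n)"
    then obtain n where u: "z \<in> mspace (CX L)" "u \<in> mspace (CX L)" "mdist (CX L) z u \<le> \<delta> - \<delta> / (real n + 1)" by auto
    moreover have "0 < \<delta> / (real n + 1)" using \<delta> by (intro divide_pos_pos) auto
    ultimately show "u \<in> mball_of (CX L) z \<delta>" by simp
  next
    fix u assume u: "u \<in> mball_of (CX L) z \<delta>"
    then have d: "0 < \<delta> - mdist (CX L) z u" by simp
    obtain n :: nat where n: "\<delta> / (\<delta> - mdist (CX L) z u) < real n" using reals_Archimedean2 by blast
    have "\<delta> < real n * (\<delta> - mdist (CX L) z u)" using n d by (simp add: pos_divide_less_eq)
    also have "\<dots> \<le> (real n + 1) * (\<delta> - mdist (CX L) z u)" using d by (intro mult_right_mono) auto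
    finally have "\<delta> / (real n + 1) \<le> \<delta> - mdist (CX L) z u" by (simp add: divide_le_eq mult.commute)
    then have "u \<in> ?B n" using u by simp
    then show "u \<in> (\<Union>n. ?B n)" by blast
  qed
  finally show ?thesis .
qed

lemma mball_lower:
  assumes h: "h \<in> mspace (CX L)" and r: "rate h \<le> ereal r" and \<delta>: "0 < \<delta>"
  shows "exp (- r) * prob (mball_of (CX L) m \<delta>) \<le> prob (mball_of (CX L) h \<delta>)"
  using mcball_lower[OF h r]
  by (intro LIMSEQ_le[OF tendsto_mult[OF tendsto_const mball_Lim[OF \<delta>]] mball_Lim[OF \<delta>]]) auto

lemma mball_le_centre:
  assumes z: "z \<in> mspace (CX L)" and \<delta>: "0 < \<delta>"
  shows "prob (mball_of (CX L) z \<delta>) \<le> prob (mball_of (CX L) m \<delta>)"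
  using mcball_le_centre[OF z] by (intro LIMSEQ_le[OF mball_Lim[OF \<delta>] mball_Lim[OF \<delta>]]) auto

text \<open>Countably many balls of radius \<open>\<delta>\<close> cover the space, and none of them is heavier than the centred one.\<close>

lemma mball_centre_pos:
  assumes \<delta>: "0 < \<delta>" shows "0 < prob (mball_of (CX L) m \<delta>)"
proof (rule ccontr)
  assume "\<not> ?thesis"
  then have zero: "prob (mball_of (CX L) m \<delta>) = 0" using measure_nonneg[of \<mu> "mball_of (CX L) m \<delta>"] by linarith
  obtain K where K: "countable K" "K \<subseteq> mspace (CX L)" "mspace (CX L) \<subseteq> (\<Union>z\<in>K. mball_of (CX L) z \<delta>)"
    using CX_countable_cover[OF L \<delta>] by blast
  have "mball_of (CX L) z \<delta> \<in> null_sets \<mu>" if "z \<in> K" for z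
  proof -
    have "prob (mball_of (CX L) z \<delta>) \<le> 0" using mball_le_centre[of z \<delta>] K(2) that \<delta> zero by auto
    then have "prob (mball_of (CX L) z \<delta>) = 0" using measure_nonneg[of \<mu> "mball_of (CX L) z \<delta>"] by linarith
    then show ?thesis by (intro null_setsI) (auto simp: emeasure_eq_measure)
  qed
  then have "(\<Union>z\<in>K. mball_of (CX L) z \<delta>) \<in> null_sets \<mu>" using K(1) by (intro null_sets_UN') auto
  from null_sets_subset[OF this, of "space \<mu>"] have "space \<mu> \<in> null_sets \<mu>" using K(3) sets.top[of \<mu>] by (simp add: space_\<mu>)
  then show False using emeasure_space_1 by (simp add: null_sets_def)
qed

sublocale rate_function_base \<mu> "CX L" m rate
proof
  show "sets \<mu> = sets (sigma (mspace (CX L)) {V. openin (mtopology_of (CX L)) V})"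
    by (simp add: sets_\<mu> borel_CX_def)
qed (auto simp: mcomplete_CX m rate_centre rate_nonneg intro: mball_lower mball_centre_pos rate_lsc)

text \<open>For each \<open>n\<close> the first \<open>n\<close> constraints of a slightly smaller closed ball around \<open>z\<close> can be met, up to
\<open>1 / (n + 1)\<close>, by a finite combination of basis functions with rate at most \<open>R\<close>; otherwise
\<open>mcball_upper\<close> would make the ball too light. A subsequence of these combinations converges
uniformly, and the limit satisfies all constraints.\<close>

lemma mball_upper:
  assumes z: "z \<in> mspace (CX L)" and \<delta>: "0 < \<delta>"
    and R: "exp (- R) * prob (mball_of (CX L) m \<delta>) < prob (mball_of (CX L) z \<delta>)"
  shows "\<exists>v\<in>mspace (CX L). mdist (CX L) z v \<le> \<delta> \<and> rate v \<le> ereal R"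
proof -
  have "\<forall>\<^sub>F n in sequentially. exp (- R) * prob (mball_of (CX L) m \<delta>) < prob (mcball_of (CX L) z (\<delta> - \<delta> / (real n + 1)))"
    by (rule order_tendstoD(1)[OF mball_Lim[OF \<delta>] R])
  then obtain n where "exp (- R) * prob (mball_of (CX L) m \<delta>) < prob (mcball_of (CX L) z (\<delta> - \<delta> / (real n + 1)))"
    by (auto simp: eventually_sequentially)
  moreover define \<delta>' where "\<delta>' = \<delta> - \<delta> / (real n + 1)"
  ultimately have big: "exp (- R) * prob (mball_of (CX L) m \<delta>) < prob (mcball_of (CX L) z \<delta>')" by simp
  have "0 < \<delta> / (real n + 1)" using \<delta> by (intro divide_pos_pos) auto
  then have \<delta>': "\<delta>' < \<delta>" by (simp add: \<delta>'_def)
  let ?t = "\<lambda>j. test_fun L j"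
  define Q where "Q n N h \<longleftrightarrow>
      (\<forall>j<n. \<bar>(\<Sum>k<N. L2_inner L (?t j) (e k) * h k) - L2_inner L (\<lambda>x. z x - m x) (?t j)\<bar> \<le> \<delta>' + 1 / (real n + 1))
      \<and> (\<Sum>k<N. (h k / sqrt (c k))\<^sup>2) < 2 * R" for n N h
  have "\<exists>N h. Q n N h" for n
  proof (rule ccontr)
    assume "\<not> ?thesis"
    then have "\<not> Q n N h" for N h by blast
    then have "prob (mcball_of (CX L) z \<delta>') \<le> exp (- R) * prob (mcball_of (CX L) m \<delta>')"
      by (intro mcball_upper[OF z, of "1 / (real n + 1)" n]) (auto simp: not_less Q_def)
    also have "\<dots> \<le> exp (- R) * prob (mball_of (CX L) m \<delta>)"
      using \<delta>' by (intro mult_left_mono finite_measure_mono) auto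
    finally show False using big by simp
  qed
  then obtain N h where Q: "\<And>n. Q n (N n) (h n)" by metis
  have h: "\<And>n j. j < n \<Longrightarrow> \<bar>(\<Sum>k<N n. L2_inner L (?t j) (e k) * h n k) - L2_inner L (\<lambda>x. z x - m x) (?t j)\<bar> \<le> \<delta>' + 1 / (real n + 1)"
    and hR: "\<And>n. (\<Sum>k<N n. (h n k / sqrt (c k))\<^sup>2) < 2 * R"
    using Q unfolding Q_def by blast+
  \<comment> \<open>Restriction makes the combination extensional, hence an element of the space.\<close>
  define v where "v n = restrict (\<lambda>x. m x + B.series (h n) (N n) x) {0..L}" for n
  have v: "v n \<in> mspace (CX L)" for n
  proof -
    have "continuous_on {0..L} (\<lambda>x. m x + B.series (h n) (N n) x)"
      unfolding B.series_def by (intro continuous_intros CX_continuous[OF m] e_cont)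
    then show ?thesis unfolding v_def mspace_CX by (auto intro: continuous_on_eq)
  qed
  have vin: "L2_inner L (\<lambda>x. v n x - m x) f = L2_inner L f (B.series (h n) (N n))" for n f
    unfolding L2_inner_def by (intro Bochner_Integration.integral_cong) (auto simp: v_def)
  have coord_v: "coord k (v n) = (if k < N n then h n k else 0)" for k n
    unfolding coord_def vin using B.coef_series[of "h n" "N n" k] by (simp add: L2_inner_commute[of L "e k"]) (simp add: L2_inner_def)
  have test_v: "L2_inner L (\<lambda>x. v n x - m x) (?t j) = (\<Sum>k<N n. L2_inner L (?t j) (e k) * h n k)" for n j
    unfolding vin using B.inner_series[of "?t j" "h n" "N n"] test_fun_L2[OF L, of j]
    by (simp add: L2_inner_def L2_eq mult.commute)
  have rate_v: "rate (v n) \<le> ereal R" for n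
    unfolding rate_le_iff[OF v]
  proof
    fix M
    have "(\<Sum>k<M. (coord k (v n) / sqrt (c k))\<^sup>2) \<le> (\<Sum>k<N n. (h n k / sqrt (c k))\<^sup>2)"
    proof -
      have "(\<Sum>k<M. (coord k (v n) / sqrt (c k))\<^sup>2) = (\<Sum>k\<in>{..<M} \<inter> {..<N n}. (h n k / sqrt (c k))\<^sup>2)"
        by (rule sum.mono_neutral_cong_right) (auto simp: coord_v)
      also have "\<dots> \<le> (\<Sum>k<N n. (h n k / sqrt (c k))\<^sup>2)" by (rule sum_mono2) auto
      finally show ?thesis .
    qed
    then show "(\<Sum>k<M. (coord k (v n) / sqrt (c k))\<^sup>2) \<le> 2 * R" using hR[of n] by simp
  qed
  obtain r w where r: "strict_mono r" and w: "w \<in> mspace (CX L)" "(\<lambda>n. mdist (CX L) (v (r n)) w) \<longlonglongrightarrow> 0"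
    using sublevel_convergent_subseq[of v R] v rate_v by blast
  have "rate w \<le> ereal R" by (rule rate_lsc[OF v w rate_v])
  moreover have "w \<in> mcball_of (CX L) z \<delta>'"
    unfolding mcball_eq[OF z]
  proof (intro CollectI conjI allI)
    show "w \<in> space \<mu>" using w by (simp add: space_\<mu>)
    fix j
    have dw: "L2_inner L (\<lambda>x. u x - m x) (?t j) = L2_inner L u (?t j) - L2_inner L m (?t j)" if "u \<in> mspace (CX L)" for u
      by (intro L2_inner_diff CX_L2 that m test_fun_L2 L)
    have "(\<lambda>n. L2_inner L (\<lambda>x. v (r n) x - m x) (?t j)) \<longlonglongrightarrow> L2_inner L (\<lambda>x. w x - m x) (?t j)"
      unfolding dw[OF v] dw[OF w(1)] by (intro tendsto_diff tendsto_const L2_inner_tendsto[OF L v w test_fun_L2[OF L]])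
    then have 1: "(\<lambda>n. \<bar>L2_inner L (\<lambda>x. v (r n) x - m x) (?t j) - L2_inner L (\<lambda>x. z x - m x) (?t j)\<bar>)
       \<longlonglongrightarrow> \<bar>L2_inner L (\<lambda>x. w x - m x) (?t j) - L2_inner L (\<lambda>x. z x - m x) (?t j)\<bar>"
      by (intro tendsto_intros)
    have "(\<lambda>n. 1 / (real n + 1)) \<longlonglongrightarrow> 0"
      using LIMSEQ_inverse_real_of_nat by (simp add: inverse_eq_divide add.commute)
    then have "(\<lambda>n. 1 / (real (r n) + 1)) \<longlonglongrightarrow> 0" using LIMSEQ_subseq_LIMSEQ[OF _ r] by (simp add: o_def)
    then have 2: "(\<lambda>n. \<delta>' + 1 / (real (r n) + 1)) \<longlonglongrightarrow> \<delta>'" using tendsto_add[OF tendsto_const, of _ 0 _ \<delta>'] by simp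
    show "\<bar>L2_inner L (\<lambda>x. w x - m x) (?t j) - L2_inner L (\<lambda>x. z x - m x) (?t j)\<bar> \<le> \<delta>'"
    proof (rule LIMSEQ_le[OF 1 2], intro exI[of _ "Suc j"] allI impI)
      fix n assume "Suc j \<le> n"
      then have "j < r n" using seq_suble[OF r, of n] by linarith
      then show "\<bar>L2_inner L (\<lambda>x. v (r n) x - m x) (?t j) - L2_inner L (\<lambda>x. z x - m x) (?t j)\<bar> \<le> \<delta>' + 1 / (real (r n) + 1)"
        unfolding test_v by (rule h)
    qed
  qed
  ultimately show ?thesis using w(1) \<delta>' by (intro bexI[of _ w]) auto
qed

sublocale rate_function_setting \<mu> "CX L" m rate
  by standard (auto intro: mball_le_centre mball_upper)

end

section \<open>The posterior and its MAP estimators\<close>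

lemma quadratic_form_inv_nonneg:
  fixes S :: "real ^ 'm::finite ^ 'm"
  assumes pd: "\<And>v. v \<noteq> 0 \<Longrightarrow> 0 < v \<bullet> (S *v v)"
  shows "0 \<le> v \<bullet> (matrix_inv S *v v)"
proof -
  have "x = 0" if "S *v x = 0" for x using pd[of x] that by auto
  then have "invertible S" by (simp add: invertible_left_inverse matrix_left_invertible_ker)
  then have "S ** matrix_inv S = mat 1" unfolding invertible_def matrix_inv_def by (rule someI2_ex) simp
  moreover define w where "w = matrix_inv S *v v"
  ultimately have vw: "S *v w = v" by (simp add: matrix_vector_mul_assoc)
  have "0 \<le> w \<bullet> (S *v w)" using pd[of w] by (cases "w = 0") (auto simp: less_imp_le)
  then show ?thesis unfolding vw by (simp add: w_def inner_commute)
qed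

lemma misfit_nonneg:
  fixes S :: "real ^ 'm::finite ^ 'm"
  assumes "\<And>v. v \<noteq> 0 \<Longrightarrow> 0 < v \<bullet> (S *v v)"
  shows "0 \<le> misfit S G y u"
  using quadratic_form_inv_nonneg[OF assms] by (simp add: misfit_def)

definition gaussian_const :: "real ^ 'm ^ 'm \<Rightarrow> real" where
  "gaussian_const S = 1 / sqrt ((2 * pi) ^ CARD('m::finite) * det S)"

lemma gaussian_density_misfit: "gaussian_density S (y - G u) = gaussian_const S * exp (- misfit S G y u)"
  by (simp add: gaussian_density_def gaussian_const_def misfit_def)

lemma gaussian_density_eq: "gaussian_density S v = gaussian_const S * exp (- (v \<bullet> (matrix_inv S *v v)) / 2)"
  by (simp add: gaussian_density_def gaussian_const_def)

lemma gaussian_density_measurable: "gaussian_density S \<in> borel_measurable borel"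
proof -
  have "continuous_on UNIV (\<lambda>v. gaussian_const S * exp (- (v \<bullet> (matrix_inv S *v v)) / 2))"
    by (intro continuous_intros linear_continuous_on) (simp_all add: bounded_linear_def matrix_vector_mul_bounded_linear)
  then show ?thesis unfolding gaussian_density_eq[abs_def] by (rule borel_measurable_continuous_onI)
qed

text \<open>If the constant were not positive, the density would vanish as an extended nonnegative function and
could not have total mass 1. This gives positivity of the determinant without linear algebra.\<close>

lemma gaussian_const_pos:
  fixes S :: "real ^ 'm::finite ^ 'm"
  assumes "prob_space P" and d: "distributed P lborel \<eta> (\<lambda>v. ennreal (gaussian_density S v))"
  shows "0 < gaussian_const S"
proof (rule ccontr)
  assume neg: "\<not> ?thesis"
  interpret prob_space P by fact
  have "ennreal (gaussian_density S v) = 0" for v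
    using neg by (intro ennreal_neg) (simp add: gaussian_density_eq mult_le_0_iff)
  then have "distr P lborel \<eta> = density lborel (\<lambda>v. 0)"
    using distributed_distr_eq_density[OF d] by simp
  moreover have "prob_space (distr P lborel \<eta>)"
    using distributed_measurable[OF d] by (rule prob_space_distr)
  ultimately have "prob_space (density (lborel :: (real ^ 'm) measure) (\<lambda>v. 0))" by simp
  then show False using prob_space.emeasure_space_1 by (fastforce simp: emeasure_density)
qed

lemma obs_op_continuous_map:
  assumes L: "0 < L" and par: "0 < muf" "0 < phi" "p0 < pI" and H: "\<And>i. H i \<in> Linf ({0<..<L} \<times> {0<..T})"
  shows "continuous_map (mtopology_of (CX L)) euclidean (obs_op L T muf phi pI p0 H)"
proof (rule continuous_map_CX_sequentially)
  fix v u assume v: "\<And>n::nat. v n \<in> mspace (CX L)" and u: "u \<in> mspace (CX L)" and lim: "(\<lambda>n. mdist (CX L) (v n) u) \<longlonglongrightarrow> 0"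
  obtain M where M: "\<And>n x. x \<in> {0..L} \<Longrightarrow> \<bar>v n x\<bar> \<le> M" using CX_conv(2)[OF L v u lim] by blast
  show "(\<lambda>n. obs_op L T muf phi pI p0 H (v n)) \<longlonglongrightarrow> obs_op L T muf phi pI p0 H u"
    by (rule obs_op_tendsto[OF L CX_continuous[OF v] CX_continuous[OF u] CX_conv(1)[OF L v u lim] M par H])
qed

lemma misfit_continuous_map:
  assumes G: "continuous_map (mtopology_of (CX L)) euclidean G"
  shows "continuous_map (mtopology_of (CX L)) euclidean (misfit S G y)"
proof -
  have "continuous_on UNIV (\<lambda>v. 1 / 2 * ((y - v) \<bullet> (matrix_inv S *v (y - v))))"
    by (intro continuous_intros continuous_on_compose2[OF linear_continuous_on[OF matrix_vector_mul_bounded_linear]]) auto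
  then have "continuous_map euclidean euclidean (\<lambda>v. 1 / 2 * ((y - v) \<bullet> (matrix_inv S *v (y - v))))"
    by (simp add: continuous_map_iff_continuous2)
  from continuous_map_compose[OF G this] show ?thesis by (simp add: misfit_def[abs_def] comp_def)
qed

theorem theorem3p1:
  fixes L T muf phi pI p0 \<sigma> \<kappa> \<nu> :: real
    and A B :: "real ^ 2 ^ 2"
    and e :: "nat \<Rightarrow> real \<Rightarrow> real" and lam :: "nat \<Rightarrow> real"
    and C0 C0_sqrt :: "(real \<Rightarrow> real) \<Rightarrow> real \<Rightarrow> real"
    and ubar :: "real \<Rightarrow> real" and \<mu>0 :: "(real \<Rightarrow> real) measure"
    and H :: "'m::finite \<Rightarrow> real \<times> real \<Rightarrow> real"
    and G :: "(real \<Rightarrow> real) \<Rightarrow> real ^ 'm"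
    and \<Sigma> :: "real ^ 'm ^ 'm"
    and P :: "'w measure" and U :: "'w \<Rightarrow> real \<Rightarrow> real" and \<eta> Y :: "'w \<Rightarrow> real ^ 'm"
  assumes "0 < L" "0 < T" "0 < muf" "0 < phi" "p0 < pI"
    \<comment> \<open>Matern prior, for any self-adjoint boundary conditions with positive \<open>\<kappa>\<^sup>2 I - Laplacian\<close>\<close>
    and "0 < \<sigma>" "0 < \<kappa>" "1 / 2 < \<nu>"
    and "self_adjoint_bc A B"
    and "\<And>k. neg_laplace_eigenfun L A B (e k) (lam k)"
    and "orthonormal_basis_L2 L e"
    and "\<And>k. 0 < \<kappa>\<^sup>2 + lam k"
    and C0: "C0 = matern_cov L e lam \<sigma> \<kappa> \<nu>"
    and C0_sqrt: "C0_sqrt = matern_cov_sqrt L e lam \<sigma> \<kappa> \<nu>"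
    and "ubar \<in> mspace (CX L)" "ubar \<in> cameron_martin L C0_sqrt"
    and "gaussian_CX L ubar C0 \<mu>0"
    \<comment> \<open>observations\<close>
    and "\<And>i. H i \<in> Linf ({0<..<L} \<times> {0<..T})"
    and G: "G = obs_op L T muf phi pI p0 H"
    and "transpose \<Sigma> = \<Sigma>" "\<And>v. v \<noteq> 0 \<Longrightarrow> 0 < v \<bullet> (\<Sigma> *v v)"
    and "prob_space P"
    and "U \<in> measurable P (borel_CX L)" "distr P (borel_CX L) U = \<mu>0"
    and "distributed P lborel \<eta> (\<lambda>v. ennreal (gaussian_density \<Sigma> v))"
    and "prob_space.indep_set P (sets (vimage_algebra (space P) U (borel_CX L)))
           (sets (vimage_algebra (space P) \<eta> borel))"
    and Y: "Y = (\<lambda>\<omega>. G (U \<omega>) + \<eta> \<omega>)"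
  shows "\<exists>\<mu>. regular_cond_distr P (borel_CX L) U borel Y \<mu> \<and>
    (\<forall>y. absolutely_continuous \<mu>0 (\<mu> y) \<and>
         (\<exists>c>0. AE u in \<mu>0. RN_deriv \<mu>0 (\<mu> y) u = ennreal (c * exp (- misfit \<Sigma> G y u))) \<and>
         (\<exists>u. is_MAP (CX L) (\<mu> y) u) \<and>
         (\<forall>u. is_MAP (CX L) (\<mu> y) u \<longleftrightarrow>
              is_arg_min (onsager_machlup L C0_sqrt ubar (misfit \<Sigma> G y)) (\<lambda>v. v \<in> mspace (CX L)) u))"
proof -
  note pd = assms(21)
  have Gc: "continuous_map (mtopology_of (CX L)) euclidean G"
    unfolding G by (rule obs_op_continuous_map) (use assms in auto)
  define c where "c = matern_eigenvalue \<sigma> \<kappa> \<nu> lam"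
  have sqrt_c: "C0_sqrt = diag_op L e (\<lambda>k. sqrt (c k))" by (simp add: C0_sqrt matern_cov_sqrt_def c_def)
  interpret prior: gaussian_prior L e c ubar \<mu>0
  proof
    show "continuous_on {0..L} (e k)" for k
    proof -
      obtain f' where "\<And>x. x \<in> {0..L} \<Longrightarrow> (e k has_real_derivative f' x) (at x within {0..L})"
        using assms(10)[of k] unfolding neg_laplace_eigenfun_def by blast
      then show ?thesis by (rule DERIV_continuous_on)
    qed
    show "0 < c k" for k
      using assms(6) assms(12)[of k] by (simp add: c_def matern_eigenvalue_def)
    show "gaussian_CX L ubar (diag_op L e c) \<mu>0" using assms(17) by (simp add: C0 matern_cov_def c_def)
  qed (use assms in auto)
  interpret P: prob_space P by fact
  have \<kappa>0: "0 < gaussian_const \<Sigma>" by (rule gaussian_const_pos) fact+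
  interpret N: additive_noise P "borel_CX L" U \<eta> G "gaussian_density \<Sigma>" "gaussian_const \<Sigma>"
  proof
    show "G \<in> borel_measurable (borel_CX L)" by (rule continuous_map_CX_measurable[OF Gc])
    show "gaussian_density \<Sigma> v \<le> gaussian_const \<Sigma>" for v
      using \<kappa>0 quadratic_form_inv_nonneg[OF pd, of v] by (simp add: gaussian_density_eq mult_le_cancel_left1)
    show "0 < gaussian_density \<Sigma> v" for v using \<kappa>0 by (simp add: gaussian_density_eq)
  qed (use assms gaussian_density_measurable in auto)
  have prior_eq: "N.prior = \<mu>0" by (simp add: N.prior_def assms)
  show ?thesis
  proof (intro exI[of _ N.posterior] conjI allI)
    show "regular_cond_distr P (borel_CX L) U borel Y N.posterior"
      using N.regular_cond_distr_posterior by (simp add: Y N.Y_def[abs_def])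
    fix y
    define c' where "c' = gaussian_const \<Sigma> / N.evidence y"
    have c': "0 < c'" using \<kappa>0 N.evidence_pos by (simp add: c'_def)
    have Gm: "misfit \<Sigma> G y \<in> borel_measurable \<mu>0"
      using continuous_map_CX_measurable[OF misfit_continuous_map[OF Gc]]
      by (simp cong: measurable_cong_sets add: prior.sets_\<mu>)
    have post: "N.posterior y = density \<mu>0 (\<lambda>u. ennreal (c' * exp (- misfit \<Sigma> G y u)))"
      by (simp add: N.posterior_def prior_eq gaussian_density_misfit c'_def)
    have dm: "(\<lambda>u. ennreal (c' * exp (- misfit \<Sigma> G y u))) \<in> borel_measurable \<mu>0"
      using Gm by measurable
    show "absolutely_continuous \<mu>0 (N.posterior y)"
      unfolding post by (rule absolutely_continuousI_density[OF dm])
    have "AE u in \<mu>0. RN_deriv \<mu>0 (N.posterior y) u = ennreal (c' * exp (- misfit \<Sigma> G y u))"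
      using prior.RN_deriv_unique[OF dm, of "N.posterior y"] post by auto
    then show "\<exists>c>0. AE u in \<mu>0. RN_deriv \<mu>0 (N.posterior y) u = ennreal (c * exp (- misfit \<Sigma> G y u))"
      using c' by blast
    interpret OM: onsager_machlup_setting \<mu>0 "CX L" ubar prior.rate "misfit \<Sigma> G y" c'
      by standard (use misfit_continuous_map[OF Gc] misfit_nonneg[OF pd] c' in auto)
    have nu: "OM.\<nu> = N.posterior y" by (simp add: OM.\<nu>_def post)
    have J: "OM.J = onsager_machlup L C0_sqrt ubar (misfit \<Sigma> G y)"
      by (auto simp: fun_eq_iff OM.J_def prior.rate_def onsager_machlup_def sqrt_c)
    show "is_MAP (CX L) (N.posterior y) u \<longleftrightarrow>
      is_arg_min (onsager_machlup L C0_sqrt ubar (misfit \<Sigma> G y)) (\<lambda>v. v \<in> mspace (CX L)) u" for u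
      using OM.is_MAP_iff[of u] by (simp add: nu J)
    show "\<exists>u. is_MAP (CX L) (N.posterior y) u"
      using OM.minimiser_exists OM.is_MAP_iff by (simp add: nu) 
  qed
qed

end
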